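(* Let $k$ be a field and let $A$ be a left Artinian $k$-algebra with radical $r=r(A)$, and assume that $A/r$ can be lifted. Let $A/r=\bigoplus_{i=1}^{m}\overline{A}_i$ with $\overline{A}_i$ simple algebras, let $\mathcal{A}=\{\overline{A}_1,\dots,\overline{A}_m\}$, and let $\Delta$ be the quiver of $A$. Then there is a set $\rho$ of relations on $PSE_k(\Delta,\mathcal{A})$ such that $$A\cong PSE_k(\Delta,\mathcal{A},\rho)\quad\text{as } k\text{-algebras, with}\quad J^{s}\subset\langle\rho\rangle\subset J$$ for some integer $s\ge 1$.
   Context: Algebras are associative with identity, modules are unital, $\subset$ denotes not necessarily strict inclusion. An algebra is left Artinian if it satisfies the descending chain condition on left ideals; $r(A)$ is its radical. Lifting: with $\eta:A\to A/r$ the canonical map, $A/r$ can be lifted if there is a $k$-algebra morphism $\varepsilon:A/r\to A$ with $\eta\varepsilon=1$ (equivalently $A=B\oplus r$ as $k$-spaces for a subalgebra $B\cong A/r$). Rank: the rank of a finitely generated bimodule is the least cardinality of a generating set (the zero bimodule has rank $0$). Quiver of $A$: its vertices are $1,\dots,m$, and the number of arrows from $i$ to $j$ is the rank of the (finitely generated) $\overline{A}_i$-$\overline{A}_j$-bimodule $\overline{A}_i\cdot (r/r^2)\cdot\overline{A}_j$. Pseudo path algebra: let $\Delta=(\Delta_0,\Delta_1)$ be a finite quiver (an arrow $\beta$ starts at $s(\beta)$ and ends at $e(\beta)$; paths $\beta_1\cdots\beta_n$ satisfy $e(\beta_i)=s(\beta_{i+1})$) and let $\mathcal{A}=\{A_i: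 i\in\Delta_0\}$ be a family of $k$-algebras $A_i$ with identity $e_i$. The pseudo-paths of length $0$ are the elements of $\bigcup_i A_i$ (elements of $A_i$ start and end at $i$). A pure pseudo-path of length $n\ge1$ is a formal expression $a_1\beta_1b_1\cdot a_2\beta_2b_2\cdot\ldots\cdot a_n\beta_nb_n$ with $\beta_1\cdots\beta_n$ a path in $\Delta$, $a_i\in A_{s(\beta_i)}$, $b_i\in A_{e(\beta_i)}$. A general pseudo-path is a formal expression $\alpha_1\cdot c_1\cdot\alpha_2\cdot c_2\cdot\ldots\cdot\alpha_q$, optionally with an extra $c_0\cdot$ on the left and/or $\cdot c_q$ on the right, where the $\alpha_i$ are pure pseudo-paths with $e(\alpha_i)=s(\alpha_{i+1})$ and the $c_i$ are elements of the algebra at the corresponding vertex; its length is the total number of arrows. $PSE_k(\Delta,\mathcal{A})$ is the $k$-space spanned by all general pseudo-paths (including length $0$) modulo $k$-multilinearity in all entries and the relations $(ab)\cdot c\beta d=a\cdot(b\cdot c\beta d)$, $a\beta b\cdot(cd)=(a\beta b\cdot c)\cdot d$, $1\cdot a\beta b=a\beta b=a\beta b\cdot 1$ (also inside longer expressions), where $1=\sum_i e_i$. Multiplication is concatenation when the end vertex of the first factor is the start vertex of the second, and $0$ otherwise; elements of length $0$ in the same $A_i$ multiply as in $A_i$. (Note: $c\cdot a\beta b$ is not identified with $(ca)\beta b$. Equivalently, it is the $k$-algebra generated by $\bigoplus_iA_i$ and symbols $a\beta b$, bilinear in $(a,b)\in A_{s(\beta)}\times A_{e(\beta)}$, subject to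 $e_{s(\beta)}\cdot a\beta b=a\beta b=a\beta b\cdot e_{e(\beta)}$.) $J$ is the ideal generated by all pure pseudo-paths of length $1$. Relations: a relation on $PSE_k(\Delta,\mathcal{A})$ is a $k$-linear combination of general pseudo-paths all having the same start vertex and the same end vertex (no restriction on lengths). For a set $\rho$ of relations, $\langle\rho\rangle$ is the ideal it generates and $PSE_k(\Delta,\mathcal{A},\rho)=PSE_k(\Delta,\mathcal{A})/\langle\rho\rangle$. *)

theory Defs
  imports "Graph_Theory.Digraph" "HOL-Algebra.Generated_Groups" "HOL-Algebra.QuotRing"
    "HOL-Algebra.Ideal_Product" "HOL-Algebra.Module"
begin

section \<open>Algebras over a field\<close>

text \<open>The library locale \<^locale>\<open>algebra\<close> is commutative; here the algebra is any ring with identity.\<close>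

locale k_algebra = R?: field R + module R M + ring M for R and M (structure) +
  assumes smult_mult_left:
      "\<lbrakk>a \<in> carrier R; x \<in> carrier M; y \<in> carrier M\<rbrakk> \<Longrightarrow>
        (a \<odot>\<^bsub>M\<^esub> x) \<otimes>\<^bsub>M\<^esub> y = a \<odot>\<^bsub>M\<^esub> (x \<otimes>\<^bsub>M\<^esub> y)"
    and smult_mult_right:
      "\<lbrakk>a \<in> carrier R; x \<in> carrier M; y \<in> carrier M\<rbrakk> \<Longrightarrow>
        x \<otimes>\<^bsub>M\<^esub> (a \<odot>\<^bsub>M\<^esub> y) = a \<odot>\<^bsub>M\<^esub> (x \<otimes>\<^bsub>M\<^esub> y)"

definition alg_hom ::
  "('k, 'c) ring_scheme \<Rightarrow> ('k, 'a, 'd) module_scheme \<Rightarrow> ('k, 'b, 'e) module_scheme \<Rightarrow> ('a \<Rightarrow> 'b) set"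
  where "alg_hom K A B =
    {h \<in> ring_hom A B. \<forall>c \<in> carrier K. \<forall>x \<in> carrier A. h (c \<odot>\<^bsub>A\<^esub> x) = c \<odot>\<^bsub>B\<^esub> h x}"

definition alg_isomorphic ::
  "('k, 'c) ring_scheme \<Rightarrow> ('k, 'a, 'd) module_scheme \<Rightarrow> ('k, 'b, 'e) module_scheme \<Rightarrow> bool"
  where "alg_isomorphic K A B \<longleftrightarrow> (\<exists>h \<in> alg_hom K A B. bij_betw h (carrier A) (carrier B))"

definition quot_alg :: "('k, 'a, 'd) module_scheme \<Rightarrow> 'a set \<Rightarrow> ('k, 'a set) module"
  where "quot_alg A I =
    ring.extend (A Quot I) (module.fields (\<lambda>c Y. \<Union>x\<in>Y. I +>\<^bsub>A\<^esub> (c \<odot>\<^bsub>A\<^esub> x)))"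

text \<open>An ideal that is a direct summand of an algebra is an algebra with an identity of its own.\<close>

definition ideal_alg :: "('k, 'a, 'd) module_scheme \<Rightarrow> 'a set \<Rightarrow> ('k, 'a, 'd) module_scheme"
  where "ideal_alg A I =
    A\<lparr>carrier := I, one := (THE e. e \<in> I \<and> (\<forall>x\<in>I. e \<otimes>\<^bsub>A\<^esub> x = x \<and> x \<otimes>\<^bsub>A\<^esub> e = x))\<rparr>"

definition simple_alg :: "('k, 'c) ring_scheme \<Rightarrow> ('k, 'a, 'd) module_scheme \<Rightarrow> bool"
  where "simple_alg K S \<longleftrightarrow>
    k_algebra K S \<and> carrier S \<noteq> {\<zero>\<^bsub>S\<^esub>} \<and> (\<forall>I. ideal I S \<longrightarrow> I = {\<zero>\<^bsub>S\<^esub>} \<or> I = carrier S)"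

definition ideal_direct_sum :: "('a, 'd) ring_scheme \<Rightarrow> 'i set \<Rightarrow> ('i \<Rightarrow> 'a set) \<Rightarrow> bool"
  where "ideal_direct_sum R V B \<longleftrightarrow>
    (\<forall>i\<in>V. ideal (B i) R) \<and> (\<forall>x\<in>carrier R. \<exists>!f. f \<in> Pi\<^sub>E V B \<and> x = finsum R f V)"


section \<open>Left Artinian rings and the radical\<close>

definition left_ideal :: "'a set \<Rightarrow> ('a, 'd) ring_scheme \<Rightarrow> bool"
  where "left_ideal L R \<longleftrightarrow>
    additive_subgroup L R \<and> (\<forall>a\<in>carrier R. \<forall>x\<in>L. a \<otimes>\<^bsub>R\<^esub> x \<in> L)"

definition left_artinian :: "('a, 'd) ring_scheme \<Rightarrow> bool"
  where "left_artinian R \<longleftrightarrow>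
    (\<forall>L :: nat \<Rightarrow> 'a set. (\<forall>n. left_ideal (L n) R \<and> L (Suc n) \<subseteq> L n) \<longrightarrow> (\<exists>N. \<forall>n\<ge>N. L n = L N))"

definition maximal_left_ideal :: "'a set \<Rightarrow> ('a, 'd) ring_scheme \<Rightarrow> bool"
  where "maximal_left_ideal M R \<longleftrightarrow>
    left_ideal M R \<and> M \<noteq> carrier R \<and>
    (\<forall>L. left_ideal L R \<and> M \<subseteq> L \<longrightarrow> L = M \<or> L = carrier R)"

text \<open>The Jacobson radical.\<close>

definition radical :: "('a, 'd) ring_scheme \<Rightarrow> 'a set"
  where "radical R = {x \<in> carrier R. \<forall>M. maximal_left_ideal M R \<longrightarrow> x \<in> M}"

abbreviation semisimple_quot :: "('k, 'a, 'd) module_scheme \<Rightarrow> ('k, 'a set) module"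
  where "semisimple_quot A \<equiv> quot_alg A (radical A)"

definition liftable :: "('k, 'c) ring_scheme \<Rightarrow> ('k, 'a, 'd) module_scheme \<Rightarrow> bool"
  where "liftable K A \<longleftrightarrow>
    (\<exists>\<epsilon> \<in> alg_hom K (semisimple_quot A) A.
       \<forall>Y \<in> carrier (semisimple_quot A). radical A +>\<^bsub>A\<^esub> \<epsilon> Y = Y)"


section \<open>Bimodules and their rank\<close>

text \<open>As in the record \<^typ>\<open>('a, 'b) module\<close>, the fields \<open>mult\<close> and \<open>one\<close> inherited from
  \<^typ>\<open>'a ring\<close> play no role.\<close>

record ('a, 'b, 'm) bimodule = "'m ring" +
  lact :: "'a \<Rightarrow> 'm \<Rightarrow> 'm"
  ract :: "'m \<Rightarrow> 'b \<Rightarrow> 'm"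

definition bimod_span ::
  "('a, 'c) ring_scheme \<Rightarrow> ('b, 'd) ring_scheme \<Rightarrow> ('a, 'b, 'm, 'e) bimodule_scheme \<Rightarrow> 'm set \<Rightarrow> 'm set"
  where "bimod_span R S M G = \<Inter> {N. additive_subgroup N M \<and> G \<subseteq> N \<and>
    (\<forall>a\<in>carrier R. \<forall>x\<in>N. lact M a x \<in> N) \<and> (\<forall>x\<in>N. \<forall>b\<in>carrier S. ract M x b \<in> N)}"

text \<open>Only meaningful for finitely generated bimodules.\<close>

definition bimod_rank ::
  "('a, 'c) ring_scheme \<Rightarrow> ('b, 'd) ring_scheme \<Rightarrow> ('a, 'b, 'm, 'e) bimodule_scheme \<Rightarrow> nat"
  where "bimod_rank R S M =
    (LEAST n. \<exists>G \<subseteq> carrier M. finite G \<and> card G = n \<and> bimod_span R S M G = carrier M)"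

text \<open>The subgroup \<open>R \<cdot> M \<cdot> S\<close> of finite sums of products \<open>a \<cdot> x \<cdot> b\<close>.\<close>

definition bimod_prod ::
  "('a, 'c) ring_scheme \<Rightarrow> ('a, 'b, 'm, 'e) bimodule_scheme \<Rightarrow> ('b, 'd) ring_scheme
    \<Rightarrow> ('a, 'b, 'm, 'e) bimodule_scheme"
  where "bimod_prod R M S = M\<lparr>carrier := generate (add_monoid M)
    {ract M (lact M a x) b | a x b. a \<in> carrier R \<and> x \<in> carrier M \<and> b \<in> carrier S}\<rparr>"

text \<open>\<open>r / r\<^sup>2\<close> as a bimodule over \<open>A / r\<close>: both actions multiply cosets by multiplying
  representatives modulo \<open>r\<^sup>2\<close>.\<close>

definition rad_layer :: "('a, 'd) ring_scheme \<Rightarrow> ('a set, 'a set, 'a set) bimodule"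
  where "rad_layer A =
    (let r = radical A; r2 = ideal_prod A r r in
      ring.extend ((A Quot r2)\<lparr>carrier := (\<lambda>x. r2 +>\<^bsub>A\<^esub> x) ` r\<rparr>)
        (bimodule.fields (rcoset_mult A r2) (rcoset_mult A r2)))"


section \<open>The quiver of an algebra\<close>

text \<open>\<open>B i\<close>, for \<open>i \<in> {1..m}\<close>, are the simple ideals of \<open>A / r\<close>. The arrows may come from any type,
  since only their numbers are prescribed.\<close>

definition quiver_of ::
  "('k, 'a, 'd) module_scheme \<Rightarrow> nat \<Rightarrow> (nat \<Rightarrow> 'a set set) \<Rightarrow> (nat, 'e) pre_digraph \<Rightarrow> bool"
  where "quiver_of A m B \<Delta> \<longleftrightarrow>
    fin_digraph \<Delta> \<and> verts \<Delta> = {1..m} \<and>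
    (\<forall>i\<in>{1..m}. \<forall>j\<in>{1..m}.
      (let Ai = ideal_alg (semisimple_quot A) (B i); Aj = ideal_alg (semisimple_quot A) (B j) in
        card {\<beta> \<in> arcs \<Delta>. tail \<Delta> \<beta> = i \<and> head \<Delta> \<beta> = j} =
          bimod_rank Ai Aj (bimod_prod Ai (rad_layer A) Aj)))"


section \<open>Pseudo path algebras\<close>

text \<open>General pseudo-paths are encoded as nonempty composable words of two kinds of letters:
  \<open>Elt i a\<close> is the element \<open>a\<close> of the algebra at the vertex \<open>i\<close>, and \<open>Arr a \<beta> b\<close> is the pure
  pseudo-path \<open>a\<beta>b\<close> of length one. Adjacent \<open>Elt\<close> letters are allowed, as in the formal expression
  \<open>a \<cdot> (b \<cdot> c\<beta>d)\<close>; the relations below identify them with their product.\<close>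

datatype ('v, 'e, 'b) letter = Elt 'v 'b | Arr 'b 'e 'b

fun letter_start :: "('v, 'e) pre_digraph \<Rightarrow> ('v, 'e, 'b) letter \<Rightarrow> 'v" where
  "letter_start \<Delta> (Elt i a) = i"
| "letter_start \<Delta> (Arr a \<beta> b) = tail \<Delta> \<beta>"

fun letter_end :: "('v, 'e) pre_digraph \<Rightarrow> ('v, 'e, 'b) letter \<Rightarrow> 'v" where
  "letter_end \<Delta> (Elt i a) = i"
| "letter_end \<Delta> (Arr a \<beta> b) = head \<Delta> \<beta>"

fun is_letter ::
  "('v, 'e) pre_digraph \<Rightarrow> ('v \<Rightarrow> ('k, 'b, 'd) module_scheme) \<Rightarrow> ('v, 'e, 'b) letter \<Rightarrow> bool" where
  "is_letter \<Delta> \<A> (Elt i a) \<longleftrightarrow> i \<in> verts \<Delta> \<and> a \<in> carrier (\<A> i)"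
| "is_letter \<Delta> \<A> (Arr a \<beta> b) \<longleftrightarrow>
    \<beta> \<in> arcs \<Delta> \<and> a \<in> carrier (\<A> (tail \<Delta> \<beta>)) \<and> b \<in> carrier (\<A> (head \<Delta> \<beta>))"

definition pseudo_path ::
  "('v, 'e) pre_digraph \<Rightarrow> ('v \<Rightarrow> ('k, 'b, 'd) module_scheme) \<Rightarrow> ('v, 'e, 'b) letter list \<Rightarrow> bool"
  where "pseudo_path \<Delta> \<A> w \<longleftrightarrow> w \<noteq> [] \<and> (\<forall>l \<in> set w. is_letter \<Delta> \<A> l) \<and>
    successively (\<lambda>l l'. letter_end \<Delta> l = letter_start \<Delta> l') w"

definition path_start :: "('v, 'e) pre_digraph \<Rightarrow> ('v, 'e, 'b) letter list \<Rightarrow> 'v"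
  where "path_start \<Delta> w = letter_start \<Delta> (hd w)"

definition path_end :: "('v, 'e) pre_digraph \<Rightarrow> ('v, 'e, 'b) letter list \<Rightarrow> 'v"
  where "path_end \<Delta> w = letter_end \<Delta> (last w)"

text \<open>The \<open>k\<close>-space with basis the pseudo-paths, where the product of two basis elements is their
  concatenation if it is composable and \<open>0\<close> otherwise. The field \<open>one\<close> is \<open>\<Sum>\<^sub>i e\<^sub>i\<close>, which becomes
  an identity only modulo \<open>pse_null\<close> below.\<close>

definition path_space ::
  "('k, 'c) ring_scheme \<Rightarrow> ('v, 'e) pre_digraph \<Rightarrow> ('v \<Rightarrow> ('k, 'b, 'd) module_scheme)
    \<Rightarrow> ('k, ('v, 'e, 'b) letter list \<Rightarrow> 'k) module"
  where "path_space K \<Delta> \<A> =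
    \<lparr>carrier = {f. (\<forall>w. f w \<in> carrier K) \<and> finite {w. f w \<noteq> \<zero>\<^bsub>K\<^esub>} \<and>
                  (\<forall>w. f w \<noteq> \<zero>\<^bsub>K\<^esub> \<longrightarrow> pseudo_path \<Delta> \<A> w)},
     mult = (\<lambda>f g w. if pseudo_path \<Delta> \<A> w
               then \<Oplus>\<^bsub>K\<^esub> n \<in> {1..<length w}. f (take n w) \<otimes>\<^bsub>K\<^esub> g (drop n w) else \<zero>\<^bsub>K\<^esub>),
     one = (\<lambda>w. if \<exists>i \<in> verts \<Delta>. w = [Elt i \<one>\<^bsub>\<A> i\<^esub>] then \<one>\<^bsub>K\<^esub> else \<zero>\<^bsub>K\<^esub>),
     zero = (\<lambda>w. \<zero>\<^bsub>K\<^esub>),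
     add = (\<lambda>f g w. f w \<oplus>\<^bsub>K\<^esub> g w),
     smult = (\<lambda>c f w. c \<otimes>\<^bsub>K\<^esub> f w)\<rparr>"

definition path_vec ::
  "('k, 'c) ring_scheme \<Rightarrow> ('v, 'e, 'b) letter list \<Rightarrow> ('v, 'e, 'b) letter list \<Rightarrow> 'k"
  where "path_vec K w = (\<lambda>w'. if w' = w then \<one>\<^bsub>K\<^esub> else \<zero>\<^bsub>K\<^esub>)"

text \<open>The defining relations, inside an arbitrary expression \<open>u \<dots> v\<close>: linearity in each entry,
  multiplication of adjacent elements of one algebra, and \<open>1 \<cdot> a\<beta>b = a\<beta>b = a\<beta>b \<cdot> 1\<close>.\<close>

inductive_set pse_relators ::
  "('k, 'c) ring_scheme \<Rightarrow> ('v, 'e) pre_digraph \<Rightarrow> ('v \<Rightarrow> ('k, 'b, 'd) module_scheme)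
    \<Rightarrow> (('v, 'e, 'b) letter list \<Rightarrow> 'k) set"
  for K \<Delta> \<A> where
  linear_elt:
    "\<lbrakk>c \<in> carrier K; pseudo_path \<Delta> \<A> (u @ [Elt i a] @ v); pseudo_path \<Delta> \<A> (u @ [Elt i a'] @ v)\<rbrakk> \<Longrightarrow>
      path_vec K (u @ [Elt i (c \<odot>\<^bsub>\<A> i\<^esub> a \<oplus>\<^bsub>\<A> i\<^esub> a')] @ v)
        \<ominus>\<^bsub>path_space K \<Delta> \<A>\<^esub>
      (c \<odot>\<^bsub>path_space K \<Delta> \<A>\<^esub> path_vec K (u @ [Elt i a] @ v)
        \<oplus>\<^bsub>path_space K \<Delta> \<A>\<^esub> path_vec K (u @ [Elt i a'] @ v)) \<in> pse_relators K \<Delta> \<A>"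
| linear_arr_left:
    "\<lbrakk>c \<in> carrier K; pseudo_path \<Delta> \<A> (u @ [Arr a \<beta> b] @ v); pseudo_path \<Delta> \<A> (u @ [Arr a' \<beta> b] @ v)\<rbrakk> \<Longrightarrow>
      path_vec K (u @ [Arr (c \<odot>\<^bsub>\<A> (tail \<Delta> \<beta>)\<^esub> a \<oplus>\<^bsub>\<A> (tail \<Delta> \<beta>)\<^esub> a') \<beta> b] @ v)
        \<ominus>\<^bsub>path_space K \<Delta> \<A>\<^esub>
      (c \<odot>\<^bsub>path_space K \<Delta> \<A>\<^esub> path_vec K (u @ [Arr a \<beta> b] @ v)
        \<oplus>\<^bsub>path_space K \<Delta> \<A>\<^esub> path_vec K (u @ [Arr a' \<beta> b] @ v)) \<in> pse_relators K \<Delta> \<A>"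
| linear_arr_right:
    "\<lbrakk>c \<in> carrier K; pseudo_path \<Delta> \<A> (u @ [Arr a \<beta> b] @ v); pseudo_path \<Delta> \<A> (u @ [Arr a \<beta> b'] @ v)\<rbrakk> \<Longrightarrow>
      path_vec K (u @ [Arr a \<beta> (c \<odot>\<^bsub>\<A> (head \<Delta> \<beta>)\<^esub> b \<oplus>\<^bsub>\<A> (head \<Delta> \<beta>)\<^esub> b')] @ v)
        \<ominus>\<^bsub>path_space K \<Delta> \<A>\<^esub>
      (c \<odot>\<^bsub>path_space K \<Delta> \<A>\<^esub> path_vec K (u @ [Arr a \<beta> b] @ v)
        \<oplus>\<^bsub>path_space K \<Delta> \<A>\<^esub> path_vec K (u @ [Arr a \<beta> b'] @ v)) \<in> pse_relators K \<Delta> \<A>"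
| mult_elt:
    "pseudo_path \<Delta> \<A> (u @ [Elt i a, Elt i b] @ v) \<Longrightarrow>
      path_vec K (u @ [Elt i a, Elt i b] @ v)
        \<ominus>\<^bsub>path_space K \<Delta> \<A>\<^esub> path_vec K (u @ [Elt i (a \<otimes>\<^bsub>\<A> i\<^esub> b)] @ v) \<in> pse_relators K \<Delta> \<A>"
| one_left:
    "pseudo_path \<Delta> \<A> (u @ [Arr a \<beta> b] @ v) \<Longrightarrow>
      path_vec K (u @ [Elt (tail \<Delta> \<beta>) \<one>\<^bsub>\<A> (tail \<Delta> \<beta>)\<^esub>, Arr a \<beta> b] @ v)
        \<ominus>\<^bsub>path_space K \<Delta> \<A>\<^esub> path_vec K (u @ [Arr a \<beta> b] @ v) \<in> pse_relators K \<Delta> \<A>"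
| one_right:
    "pseudo_path \<Delta> \<A> (u @ [Arr a \<beta> b] @ v) \<Longrightarrow>
      path_vec K (u @ [Arr a \<beta> b, Elt (head \<Delta> \<beta>) \<one>\<^bsub>\<A> (head \<Delta> \<beta>)\<^esub>] @ v)
        \<ominus>\<^bsub>path_space K \<Delta> \<A>\<^esub> path_vec K (u @ [Arr a \<beta> b] @ v) \<in> pse_relators K \<Delta> \<A>"

definition pse_null ::
  "('k, 'c) ring_scheme \<Rightarrow> ('v, 'e) pre_digraph \<Rightarrow> ('v \<Rightarrow> ('k, 'b, 'd) module_scheme)
    \<Rightarrow> (('v, 'e, 'b) letter list \<Rightarrow> 'k) set"
  where "pse_null K \<Delta> \<A> =
    \<Inter> {N. submodule N K (path_space K \<Delta> \<A>) \<and> pse_relators K \<Delta> \<A> \<subseteq> N}"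

definition PSE ::
  "('k, 'c) ring_scheme \<Rightarrow> ('v, 'e) pre_digraph \<Rightarrow> ('v \<Rightarrow> ('k, 'b, 'd) module_scheme)
    \<Rightarrow> ('k, (('v, 'e, 'b) letter list \<Rightarrow> 'k) set) module"
  where "PSE K \<Delta> \<A> = quot_alg (path_space K \<Delta> \<A>) (pse_null K \<Delta> \<A>)"

definition pse_class ::
  "('k, 'c) ring_scheme \<Rightarrow> ('v, 'e) pre_digraph \<Rightarrow> ('v \<Rightarrow> ('k, 'b, 'd) module_scheme)
    \<Rightarrow> (('v, 'e, 'b) letter list \<Rightarrow> 'k) \<Rightarrow> (('v, 'e, 'b) letter list \<Rightarrow> 'k) set"
  where "pse_class K \<Delta> \<A> f = pse_null K \<Delta> \<A> +>\<^bsub>path_space K \<Delta> \<A>\<^esub> f"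

definition arrow_ideal ::
  "('k, 'c) ring_scheme \<Rightarrow> ('v, 'e) pre_digraph \<Rightarrow> ('v \<Rightarrow> ('k, 'b, 'd) module_scheme)
    \<Rightarrow> (('v, 'e, 'b) letter list \<Rightarrow> 'k) set set"
  where "arrow_ideal K \<Delta> \<A> = genideal (PSE K \<Delta> \<A>)
    {pse_class K \<Delta> \<A> (path_vec K [Arr a \<beta> b]) | a \<beta> b. is_letter \<Delta> \<A> (Arr a \<beta> b)}"

definition pse_relations ::
  "('k, 'c) ring_scheme \<Rightarrow> ('v, 'e) pre_digraph \<Rightarrow> ('v \<Rightarrow> ('k, 'b, 'd) module_scheme)
    \<Rightarrow> (('v, 'e, 'b) letter list \<Rightarrow> 'k) set set"
  where "pse_relations K \<Delta> \<A> =
    {pse_class K \<Delta> \<A> f | f i j. i \<in> verts \<Delta> \<and> j \<in> verts \<Delta> \<and> f \<in> carrier (path_space K \<Delta> \<A>) \<and>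
      (\<forall>w. f w \<noteq> \<zero>\<^bsub>K\<^esub> \<longrightarrow> path_start \<Delta> w = i \<and> path_end \<Delta> w = j)}"

definition PSE_rel ::
  "('k, 'c) ring_scheme \<Rightarrow> ('v, 'e) pre_digraph \<Rightarrow> ('v \<Rightarrow> ('k, 'b, 'd) module_scheme)
    \<Rightarrow> (('v, 'e, 'b) letter list \<Rightarrow> 'k) set set
    \<Rightarrow> ('k, (('v, 'e, 'b) letter list \<Rightarrow> 'k) set set) module"
  where "PSE_rel K \<Delta> \<A> \<rho> = quot_alg (PSE K \<Delta> \<A>) (genideal (PSE K \<Delta> \<A>) \<rho>)"

end

theory Submission
  imports Defs
begin

text \<open>Let \<open>r\<close> be the radical of \<open>A\<close> and \<open>\<epsilon> : A / r \<rightarrow> A\<close> a lifting. As \<open>A\<close> is left Artinian, \<open>r\<close> is nilpotent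
  and \<open>r / r\<^sup>2\<close> is finitely generated, so one can choose for every arrow \<open>\<beta>\<close> an element
  \<open>x\<^sub>\<beta>\<close> of \<open>r\<close> such that the classes of the \<open>x\<^sub>\<beta>\<close> generate the bimodule \<open>r / r\<^sup>2\<close>. Sending \<open>a\<close> to
  \<open>\<epsilon> a\<close> and \<open>a\<beta>b\<close> to \<open>\<epsilon> a \<cdot> x\<^sub>\<beta> \<cdot> \<epsilon> b\<close> defines an algebra morphism from the pseudo path algebra
  to \<open>A\<close>. Its image contains \<open>\<epsilon> (A / r)\<close> and generates \<open>r\<close> modulo \<open>r\<^sup>2\<close>; since \<open>r\<close> is nilpotent, it
  is all of \<open>A\<close>. The kernel is generated by its corners \<open>e\<^sub>i Y e\<^sub>j\<close>, which are relations. It contains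
  \<open>J\<^sup>s\<close> as soon as \<open>r\<^sup>s = 0\<close>, because \<open>J\<close> is mapped into \<open>r\<close>. It is contained in \<open>J\<close>, because modulo \<open>J\<close>
  the pseudo path algebra is the sum of the vertex algebras, on which the morphism followed by
  \<open>A \<rightarrow> A / r\<close> is injective.\<close>

section \<open>The radical of a left Artinian ring\<close>

text \<open>\<open>A\<close> need not be finite-dimensional, so finite generation of
  \<open>r / r2\<close> cannot come from counting dimensions. It is indispensable:
  \<open>bimod_rank\<close> is a least cardinality, and counting arrows yields actual generators
  only once some finite generating set is known. The source is that left ideals have complements
  modulo the radical, so cyclic pieces can be split off from \<open>r\<close> modulo
  \<open>r2\<close> until the chain condition stops the process. The left generators are then cut
  into pieces \<open>e i \<otimes> x \<otimes> e j\<close>, because an arrow carries a start and an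
  end. The space of formal paths has no identity: the sum of the vertex identities acts as one only
  modulo the relators. Quotients are therefore treated first for algebras without identity.
  Evaluation must send non-composable products to zero. This is why the lifted identities of the
  simple components have to be orthogonal idempotents with sum \<open>\<one>\<close>. The inclusion
  of the kernel in \<open>J\<close> rests on a linear map back from \<open>A\<close>: an element
  minus the vertex part of its value lies in \<open>J\<close>, and for an element of the kernel
  nothing is subtracted.\<close>

context ring
begin

text \<open>Closure under negatives need not be supplied: \<open>\<ominus> x\<close> is the multiple
  of \<open>x\<close> by \<open>\<ominus> \<one>\<close>.\<close>

lemma left_idealI:
  assumes "L \<subseteq> carrier R" "\<zero> \<in> L"
    and add: "\<And>x y. x \<in> L \<Longrightarrow> y \<in> L \<Longrightarrow> x \<oplus> y \<in> L"
    and mult: "\<And>a x. a \<in> carrier R \<Longrightarrow> x \<in> L \<Longrightarrow> a \<otimes> x \<in> L"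
  shows "left_ideal L R"
proof -
  have "\<ominus> x \<in> L" if "x \<in> L" for x
  proof -
    have "\<ominus> x = (\<ominus> \<one>) \<otimes> x"
      using that assms(1) by (simp add: l_minus subset_iff)
    then show ?thesis
      using mult[of "\<ominus> \<one>" x] that by simp
  qed
  then have "subgroup L (add_monoid R)"
    using assms by (intro add.subgroupI) auto
  then show ?thesis
    unfolding left_ideal_def additive_subgroup_def using mult by blast
qed

lemma left_idealD:
  assumes "left_ideal L R"
  shows "L \<subseteq> carrier R" "\<zero> \<in> L"
    and "\<And>x. x \<in> L \<Longrightarrow> x \<in> carrier R"
    and "\<And>x y. x \<in> L \<Longrightarrow> y \<in> L \<Longrightarrow> x \<oplus> y \<in> L"
    and "\<And>x. x \<in> L \<Longrightarrow> \<ominus> x \<in> L"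
    and "\<And>x y. x \<in> L \<Longrightarrow> y \<in> L \<Longrightarrow> x \<ominus> y \<in> L"
    and "\<And>a x. a \<in> carrier R \<Longrightarrow> x \<in> L \<Longrightarrow> a \<otimes> x \<in> L"
proof -
  interpret additive_subgroup L R
    using assms by (simp add: left_ideal_def)
  show "L \<subseteq> carrier R" "\<zero> \<in> L" "\<And>x. x \<in> L \<Longrightarrow> x \<in> carrier R"
    "\<And>x y. x \<in> L \<Longrightarrow> y \<in> L \<Longrightarrow> x \<oplus> y \<in> L"
    "\<And>x. x \<in> L \<Longrightarrow> \<ominus> x \<in> L"
    "\<And>x y. x \<in> L \<Longrightarrow> y \<in> L \<Longrightarrow> x \<ominus> y \<in> L"
    "\<And>a x. a \<in> carrier R \<Longrightarrow> x \<in> L \<Longrightarrow> a \<otimes> x \<in> L"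
    using assms a_subset by (auto simp: left_ideal_def a_minus_def)
qed

lemma left_ideal_carrier: "left_ideal (carrier R) R"
  by (rule left_idealI) auto

lemma left_ideal_of_ideal: "ideal I R \<Longrightarrow> left_ideal I R"
  by (simp add: left_ideal_def ideal.axioms(1) ideal.I_l_closed)

lemma left_ideal_eq_carrier:
  assumes "left_ideal L R" "\<one> \<in> L"
  shows "L = carrier R"
  using left_idealD[OF assms(1)] assms(2) by (metis r_one subsetI subset_antisym)

lemma left_ideal_Int:
  assumes "left_ideal L R" "left_ideal L' R"
  shows "left_ideal (L \<inter> L') R"
  using left_idealD[OF assms(1)] left_idealD[OF assms(2)]
  by (intro left_idealI) auto

lemma set_addI: "x \<in> L \<Longrightarrow> y \<in> L' \<Longrightarrow> x \<oplus> y \<in> L <+>\<^bsub>R\<^esub> L'"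
  by (auto simp: set_add_def')

lemma left_ideal_add:
  assumes "left_ideal L R" "left_ideal L' R"
  shows "left_ideal (L <+>\<^bsub>R\<^esub> L') R"
proof (rule left_idealI)
  note L = left_idealD[OF assms(1)] and L' = left_idealD[OF assms(2)]
  show "L <+>\<^bsub>R\<^esub> L' \<subseteq> carrier R"
    using L(1) L'(1) by (auto simp: set_add_def')
  show "\<zero> \<in> L <+>\<^bsub>R\<^esub> L'"
    using L(2) L'(2) l_zero[OF zero_closed] by (force simp: set_add_def')
  show "x \<oplus> y \<in> L <+>\<^bsub>R\<^esub> L'" if "x \<in> L <+>\<^bsub>R\<^esub> L'" "y \<in> L <+>\<^bsub>R\<^esub> L'" for x y
  proof -
    from that obtain a b c d where *: "a \<in> L" "b \<in> L'" "c \<in> L" "d \<in> L'" "x = a \<oplus> b" "y = c \<oplus> d"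
      by (auto simp: set_add_def')
    then have "x \<oplus> y = (a \<oplus> c) \<oplus> (b \<oplus> d)"
      using L(3) L'(3) by (simp add: a_ac)
    then show ?thesis
      using set_addI[OF L(4)[OF *(1,3)] L'(4)[OF *(2,4)]] *(5,6) by simp
  qed
  show "a \<otimes> x \<in> L <+>\<^bsub>R\<^esub> L'" if "a \<in> carrier R" "x \<in> L <+>\<^bsub>R\<^esub> L'" for a x
  proof -
    from that obtain x1 x2 where "x1 \<in> L" "x2 \<in> L'" "x = x1 \<oplus> x2"
      by (auto simp: set_add_def')
    then show ?thesis
      using set_addI[OF L(7)[OF that(1)] L'(7)[OF that(1)], of x1 x2] L(3) L'(3) that(1)
      by (simp add: r_distr)
  qed
qed

lemma set_add_upper:
  assumes "left_ideal L R" "left_ideal L' R"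
  shows "L \<subseteq> L <+>\<^bsub>R\<^esub> L'" "L' \<subseteq> L <+>\<^bsub>R\<^esub> L'"
proof -
  note L = left_idealD[OF assms(1)] and L' = left_idealD[OF assms(2)]
  show "L \<subseteq> L <+>\<^bsub>R\<^esub> L'"
    using L(3) L'(2) r_zero by (force simp: set_add_def')
  show "L' \<subseteq> L <+>\<^bsub>R\<^esub> L'"
    using L(2) L'(3) l_zero by (force simp: set_add_def')
qed

lemma left_ideal_principal:
  assumes "x \<in> carrier R"
  shows "left_ideal ((\<lambda>a. a \<otimes> x) ` carrier R) R" "x \<in> (\<lambda>a. a \<otimes> x) ` carrier R"
proof -
  show "x \<in> (\<lambda>a. a \<otimes> x) ` carrier R"
    using assms by (auto intro!: image_eqI[where x=\<one>])
  show "left_ideal ((\<lambda>a. a \<otimes> x) ` carrier R) R"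
  proof (rule left_idealI)
    show "\<zero> \<in> (\<lambda>a. a \<otimes> x) ` carrier R"
      using assms by (auto intro!: image_eqI[where x=\<zero>])
    show "y \<oplus> z \<in> (\<lambda>a. a \<otimes> x) ` carrier R"
      if "y \<in> (\<lambda>a. a \<otimes> x) ` carrier R" "z \<in> (\<lambda>a. a \<otimes> x) ` carrier R" for y z
    proof -
      from that obtain a b where "a \<in> carrier R" "b \<in> carrier R" "y = a \<otimes> x" "z = b \<otimes> x" by auto
      then show ?thesis using assms by (auto intro!: image_eqI[where x="a \<oplus> b"] simp: l_distr)
    qed
    show "a \<otimes> y \<in> (\<lambda>a. a \<otimes> x) ` carrier R"
      if "a \<in> carrier R" "y \<in> (\<lambda>a. a \<otimes> x) ` carrier R" for a y
    proof -
      from that obtain b where "b \<in> carrier R" "y = b \<otimes> x" by auto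
      then show ?thesis using assms that by (auto intro!: image_eqI[where x="a \<otimes> b"] simp: m_assoc)
    qed
  qed (use assms in auto)
qed

lemma left_ideal_chain_Union:
  assumes "C \<noteq> {}" "\<And>L. L \<in> C \<Longrightarrow> left_ideal L R" "\<And>L L'. L \<in> C \<Longrightarrow> L' \<in> C \<Longrightarrow> L \<subseteq> L' \<or> L' \<subseteq> L"
  shows "left_ideal (\<Union>C) R"
proof (rule left_idealI)
  show "\<Union>C \<subseteq> carrier R" "\<zero> \<in> \<Union>C"
    using left_idealD(1,2)[OF assms(2)] assms(1) by blast+
  show "x \<oplus> y \<in> \<Union>C" if "x \<in> \<Union>C" "y \<in> \<Union>C" for x y
  proof -
    from that obtain L where "L \<in> C" "x \<in> L" "y \<in> L"
      using assms(3) by blast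
    then show ?thesis
      using left_idealD(4)[OF assms(2)] by blast
  qed
  show "a \<otimes> x \<in> \<Union>C" if "a \<in> carrier R" "x \<in> \<Union>C" for a x
    using that left_idealD(7)[OF assms(2)] by blast
qed

text \<open>Zorn's lemma. Properness is expressed by \<open>\<one> \<notin> M\<close>, a condition
  that survives unions of chains.\<close>

lemma maximal_left_ideal_exists:
  assumes "left_ideal L R" "L \<noteq> carrier R"
  obtains M where "maximal_left_ideal M R" "L \<subseteq> M"
proof -
  define F where "F = {M. left_ideal M R \<and> L \<subseteq> M \<and> \<one> \<notin> M}"
  have "\<one> \<notin> L"
    using assms left_ideal_eq_carrier by blast
  then have "F \<noteq> {}"
    using assms(1) by (auto simp: F_def)
  moreover have "\<Union>C \<in> F" if "C \<noteq> {}" "subset.chain F C" for C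
  proof -
    have C: "left_ideal M R" "L \<subseteq> M" "\<one> \<notin> M" if "M \<in> C" for M
      using that \<open>subset.chain F C\<close> unfolding subset_chain_def F_def by blast+
    have "left_ideal (\<Union>C) R"
      using that C(1) unfolding subset_chain_def by (intro left_ideal_chain_Union) auto
    then show ?thesis
      using C(2,3) \<open>C \<noteq> {}\<close> unfolding F_def by blast
  qed
  ultimately have "\<exists>M\<in>F. \<forall>X\<in>F. M \<subseteq> X \<longrightarrow> X = M"
    by (rule subset_Zorn_nonempty)
  then obtain M where M: "M \<in> F" "\<And>X. X \<in> F \<Longrightarrow> M \<subseteq> X \<Longrightarrow> X = M"
    by blast
  have "maximal_left_ideal M R"
    unfolding maximal_left_ideal_def
  proof (intro conjI allI impI)
    show "left_ideal M R" "M \<noteq> carrier R"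
      using M(1) by (auto simp: F_def)
    show "N = M \<or> N = carrier R" if "left_ideal N R \<and> M \<subseteq> N" for N
      using that M left_ideal_eq_carrier[of N] by (cases "\<one> \<in> N") (auto simp: F_def)
  qed
  then show thesis
    using that M(1) by (auto simp: F_def)
qed

lemma radical_left_ideal: "left_ideal (radical R) R"
proof (rule left_idealI)
  have max: "left_ideal M R" if "maximal_left_ideal M R" for M
    using that by (simp add: maximal_left_ideal_def)
  show "\<zero> \<in> radical R"
    using left_idealD(2)[OF max] by (simp add: radical_def)
  show "x \<oplus> y \<in> radical R" if "x \<in> radical R" "y \<in> radical R" for x y
    using that left_idealD(4)[OF max] by (simp add: radical_def)
  show "a \<otimes> x \<in> radical R" if "a \<in> carrier R" "x \<in> radical R" for a x
    using that left_idealD(7)[OF max] by (simp add: radical_def)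
qed (simp add: radical_def)

text \<open>The form in which maximality gets used: the left ideals generated by \<open>a\<close>
  and \<open>M\<close> have a sum strictly above \<open>M\<close>, hence equal to the whole
  ring.\<close>

lemma maximal_left_ideal_add:
  assumes "maximal_left_ideal M R" "a \<in> carrier R" "a \<notin> M" "y \<in> carrier R"
  obtains b c where "b \<in> carrier R" "c \<in> M" "y = b \<otimes> a \<oplus> c"
proof -
  let ?P = "(\<lambda>b. b \<otimes> a) ` carrier R"
  have M: "left_ideal M R"
    using assms(1) by (simp add: maximal_left_ideal_def)
  note P = left_ideal_principal[OF assms(2)]
  have "left_ideal (?P <+>\<^bsub>R\<^esub> M) R" "M \<subseteq> ?P <+>\<^bsub>R\<^esub> M" "a \<in> ?P <+>\<^bsub>R\<^esub> M"
    using left_ideal_add[OF P(1) M] set_add_upper[OF P(1) M] P(2) by auto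
  then have "?P <+>\<^bsub>R\<^esub> M = carrier R"
    using assms(1,3) unfolding maximal_left_ideal_def by blast
  then show thesis
    using assms(4) that by (auto simp: set_add_def')
qed

text \<open>Right multiplication by \<open>a\<close> pulls a maximal left ideal not containing \<open>a\<close> back to a
  maximal left ideal.\<close>

lemma radical_mult_right:
  assumes "x \<in> radical R" "a \<in> carrier R"
  shows "x \<otimes> a \<in> radical R"
proof -
  have x: "x \<in> carrier R" "\<And>M. maximal_left_ideal M R \<Longrightarrow> x \<in> M"
    using assms(1) by (auto simp: radical_def)
  have "x \<otimes> a \<in> M" if max: "maximal_left_ideal M R" for M
  proof (cases "a \<in> M")
    case True
    then show ?thesis
      using max x left_idealD(7) by (auto simp: maximal_left_ideal_def)
  next
    case False
    have "left_ideal M R"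
      using max by (simp add: maximal_left_ideal_def)
    note M = left_idealD[OF this]
    let ?N = "{y \<in> carrier R. y \<otimes> a \<in> M}"
    have N: "left_ideal ?N R"
      using M assms(2) by (intro left_idealI) (auto simp: l_distr m_assoc)
    have "maximal_left_ideal ?N R"
      unfolding maximal_left_ideal_def
    proof (intro conjI allI impI)
      show "?N \<noteq> carrier R"
        using False assms(2) by (auto dest!: equalityD2 subsetD[where c=\<one>])
      show "L = ?N \<or> L = carrier R" if L: "left_ideal L R \<and> ?N \<subseteq> L" for L
      proof (rule disjCI)
        assume "L \<noteq> carrier R"
        show "L = ?N"
        proof (rule ccontr)
          note Ld = left_idealD[OF conjunct1[OF L]]
          assume "L \<noteq> ?N"
          then obtain y where y: "y \<in> L" "y \<notin> ?N"
            using L by blast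
          then have yc: "y \<in> carrier R" and ya: "y \<otimes> a \<notin> M"
            using Ld(3) by auto
          obtain b c where bc: "b \<in> carrier R" "c \<in> M" "a = b \<otimes> (y \<otimes> a) \<oplus> c"
            using maximal_left_ideal_add[OF max _ ya assms(2)] yc assms(2) by auto
          have cc: "c \<in> carrier R"
            using bc M(3) by blast
          \<comment> \<open>The decomposition of \<open>a\<close> says that
            \<open>\<one> \<ominus> b \<otimes> y\<close> multiplies \<open>a\<close> into
            \<open>M\<close>, so it belongs to \<open>?N\<close> and thus to \<open>L\<close>. As
            \<open>y\<close> is in \<open>L\<close> too, so is \<open>\<one>\<close>.\<close>
          have "(\<one> \<ominus> b \<otimes> y) \<otimes> a = a \<ominus> b \<otimes> (y \<otimes> a)"
            using bc(1) yc assms(2) by algebra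
          also have "\<dots> = (b \<otimes> (y \<otimes> a) \<oplus> c) \<ominus> b \<otimes> (y \<otimes> a)"
            using bc(3) by simp
          also have "\<dots> = c"
            using bc(1) cc yc assms(2) by algebra
          finally have "\<one> \<ominus> b \<otimes> y \<in> ?N"
            using bc yc by simp
          then have "\<one> \<ominus> b \<otimes> y \<oplus> b \<otimes> y \<in> L"
            using L Ld(4)[OF _ Ld(7)[OF bc(1) y(1)]] by blast
          moreover have "\<one> \<ominus> b \<otimes> y \<oplus> b \<otimes> y = \<one>"
            using bc(1) yc by algebra
          ultimately show False
            using \<open>L \<noteq> carrier R\<close> left_ideal_eq_carrier L by metis
        qed
      qed
    qed (rule N)
    then show ?thesis
      using x by blast
  qed
  then show ?thesis
    using x assms(2) by (simp add: radical_def)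
qed

lemma radical_ideal: "ideal (radical R) R"
proof (rule idealI)
  show "subgroup (radical R) (add_monoid R)"
    using radical_left_ideal by (simp add: left_ideal_def additive_subgroup_def)
qed (use ring_axioms radical_mult_right left_idealD(7)[OF radical_left_ideal] in auto)

text \<open>If the left ideal generated by \<open>\<one> \<ominus> x\<close> were proper, some
  maximal left ideal would contain it. That ideal also contains \<open>x\<close>, hence
  \<open>\<one>\<close>.\<close>

lemma radical_left_inverse:
  assumes "x \<in> radical R"
  obtains b where "b \<in> carrier R" "b \<otimes> (\<one> \<ominus> x) = \<one>"
proof -
  have x: "x \<in> carrier R"
    using assms by (simp add: radical_def)
  let ?P = "(\<lambda>a. a \<otimes> (\<one> \<ominus> x)) ` carrier R"
  have P: "left_ideal ?P R" "\<one> \<ominus> x \<in> ?P"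
    using left_ideal_principal[of "\<one> \<ominus> x"] x by auto
  have "?P = carrier R"
  proof (rule ccontr)
    assume "?P \<noteq> carrier R"
    then obtain M where M: "maximal_left_ideal M R" "?P \<subseteq> M"
      using maximal_left_ideal_exists[OF P(1)] by blast
    then have "x \<in> M" "\<one> \<ominus> x \<in> M" "left_ideal M R"
      using assms P(2) by (auto simp: radical_def maximal_left_ideal_def)
    then have "\<one> \<ominus> x \<oplus> x \<in> M"
      using left_idealD(4) by blast
    moreover have "\<one> \<ominus> x \<oplus> x = \<one>"
      using x by algebra
    ultimately show False
      using M(1) left_ideal_eq_carrier by (auto simp: maximal_left_ideal_def)
  qed
  then obtain b where "b \<in> carrier R" "\<one> = b \<otimes> (\<one> \<ominus> x)"
    using one_closed by (metis (no_types, lifting) imageE)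
  then show thesis
    using that by simp
qed

text \<open>If no member were minimal, iterating a choice of strictly smaller members would give a
  chain that never becomes constant.\<close>

lemma artinian_minimal:
  assumes "left_artinian R" "F \<noteq> {}" "\<And>L. L \<in> F \<Longrightarrow> left_ideal L R"
  obtains L where "L \<in> F" "\<And>L'. L' \<in> F \<Longrightarrow> L' \<subseteq> L \<Longrightarrow> L' = L"
proof (rule ccontr)
  assume "\<not> thesis"
  then have "\<forall>L\<in>F. \<exists>L'. L' \<in> F \<and> L' \<subset> L"
    using that by blast
  then obtain g where g: "\<And>L. L \<in> F \<Longrightarrow> g L \<in> F \<and> g L \<subset> L"
    by metis
  obtain L0 where "L0 \<in> F"
    using assms(2) by blast
  define L where "L n = (g ^^ n) L0" for n
  have F: "L n \<in> F" for n
    by (induct n) (auto simp: L_def \<open>L0 \<in> F\<close> g)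
  have lt: "L (Suc n) \<subset> L n" for n
    using g[OF F[of n]] by (simp add: L_def)
  then have "\<exists>N. \<forall>n\<ge>N. L n = L N"
    using assms(1,3) F unfolding left_artinian_def by blast
  then show False
    using lt by (metis le_SucI order_refl psubset_eq)
qed

end

section \<open>Powers of ideals and nilpotency of the radical\<close>

context ring
begin

lemma set_addE:
  assumes "z \<in> L <+>\<^bsub>R\<^esub> L'"
  obtains x y where "x \<in> L" "y \<in> L'" "z = x \<oplus> y"
  using assms by (auto simp: set_add_def')

text \<open>Powers of ideals are powers in \<open>ideals_set R\<close>. Its unit is the whole ring,
  so exponent 0 gives \<open>carrier R\<close>.\<close>

lemma ideals_set_mult [simp]: "mult (ideals_set R) = ideal_prod R"
  and ideals_set_one [simp]: "\<one>\<^bsub>ideals_set R\<^esub> = carrier R"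
  by (simp_all add: ideals_set_def)

lemma ideal_pow_ideal: "ideal I R \<Longrightarrow> ideal (I [^]\<^bsub>ideals_set R\<^esub> (n::nat)) R"
  by (induct n) (simp_all add: ideal_prod_is_ideal oneideal)

lemma ideal_prod_one_left:
  assumes "ideal I R"
  shows "ideal_prod R (carrier R) I = I"
proof
  show "I \<subseteq> ideal_prod R (carrier R) I"
  proof
    fix x assume "x \<in> I"
    then show "x \<in> ideal_prod R (carrier R) I"
      using ideal_prod.prod[of \<one> "carrier R" x I R] ideal.Icarr[OF assms] by simp
  qed
qed (use ideal_prod_inter[OF oneideal assms] in blast)

lemma ideal_pow_1: "ideal I R \<Longrightarrow> I [^]\<^bsub>ideals_set R\<^esub> (1::nat) = I"
  by (simp add: ideal_prod_one_left)

lemma ideal_pow_add: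
  assumes "ideal I R"
  shows "ideal_prod R (I [^]\<^bsub>ideals_set R\<^esub> (n::nat)) (I [^]\<^bsub>ideals_set R\<^esub> (m::nat)) = I [^]\<^bsub>ideals_set R\<^esub> (n + m)"
proof (induct m)
  case 0
  then show ?case
    by (simp add: ideal_prod_one ideal_pow_ideal assms)
next
  case (Suc m)
  then show ?case
    using ideal_prod_assoc[of "I [^]\<^bsub>ideals_set R\<^esub> n" "I [^]\<^bsub>ideals_set R\<^esub> m" I] assms ideal_pow_ideal
    by simp
qed

lemma ideal_pow_mono:
  assumes "ideal I R" "n \<le> m"
  shows "I [^]\<^bsub>ideals_set R\<^esub> (m::nat) \<subseteq> I [^]\<^bsub>ideals_set R\<^esub> (n::nat)"
  using ideal_pow_add[OF assms(1), of n "m - n"] assms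
    ideal_prod_inter[OF ideal_pow_ideal ideal_pow_ideal, of I I n "m - n"] by auto

text \<open>\<open>ideal_prod\<close> is generated inductively by products and sums, so these two
  closure properties suffice. \<open>S\<close> may be any such set, which allows sets defined by
  approximation or annihilation.\<close>

lemma ideal_prod_least:
  assumes "\<And>x y. x \<in> I \<Longrightarrow> y \<in> J \<Longrightarrow> x \<otimes> y \<in> S" "\<And>x y. x \<in> S \<Longrightarrow> y \<in> S \<Longrightarrow> x \<oplus> y \<in> S"
  shows "ideal_prod R I J \<subseteq> S"
proof
  fix x assume "x \<in> ideal_prod R I J"
  then show "x \<in> S"
    by induct (use assms in auto)
qed

text \<open>The element \<open>\<one> \<ominus> a\<close> annihilates \<open>x\<close> and has a
  left inverse. This plays the part of Nakayama's lemma for a cyclic module.\<close>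

lemma radical_fixes_zero:
  assumes "a \<in> radical R" "x \<in> carrier R" "x = a \<otimes> x"
  shows "x = \<zero>"
proof -
  have a: "a \<in> carrier R"
    using assms(1) by (simp add: radical_def)
  obtain b where b: "b \<in> carrier R" "b \<otimes> (\<one> \<ominus> a) = \<one>"
    using radical_left_inverse[OF assms(1)] .
  have "x = b \<otimes> (\<one> \<ominus> a) \<otimes> x"
    using b assms(2) by simp
  also have "\<dots> = b \<otimes> (x \<ominus> a \<otimes> x)"
    using a b(1) assms(2) by algebra
  also have "x \<ominus> a \<otimes> x = \<zero>"
    using assms(2,3) by (metis a_minus_def r_neg)
  finally show ?thesis
    using b by simp
qed

text \<open>The powers of the radical become constant at some \<open>I\<close> with
  \<open>I \<cdot> I = I\<close>. If \<open>I\<close> is nonzero, take a left ideal \<open>L\<close>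
  minimal among those not annihilated by \<open>I\<close>, and \<open>x\<close> in \<open>L\<close>
  with \<open>I x\<close> nonzero. Then \<open>I x\<close> lies in \<open>L\<close> and is not
  annihilated by \<open>I\<close> either, so it equals \<open>L\<close> and contains
  \<open>x\<close>. An equation \<open>x = c \<otimes> x\<close> with \<open>c\<close> in the
  radical forces \<open>x = \<zero>\<close>.\<close>

theorem radical_nilpotent:
  assumes "left_artinian R"
  obtains n :: nat where "radical R [^]\<^bsub>ideals_set R\<^esub> n = {\<zero>}"
proof -
  let ?p = "\<lambda>n::nat. radical R [^]\<^bsub>ideals_set R\<^esub> n"
  have p: "ideal (?p n) R" for n
    using ideal_pow_ideal radical_ideal by blast
  have "left_ideal (?p n) R \<and> ?p (Suc n) \<subseteq> ?p n" for n
    using left_ideal_of_ideal[OF p] ideal_pow_mono[OF radical_ideal, of n "Suc n"] by simp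
  then obtain N where N: "\<And>n. n \<ge> N \<Longrightarrow> ?p n = ?p N"
    using assms unfolding left_artinian_def by (metis (no_types, lifting))
  define I where "I = ?p N"
  \<comment> \<open>The exponent \<open>N\<close> may be 0, where the power is the whole ring. The
    inclusion in the radical is therefore read off at \<open>Suc N\<close>.\<close>
  have I: "ideal I R" "I \<subseteq> radical R"
    using p N[of "Suc N"] ideal_pow_mono[OF radical_ideal, of 1 "Suc N"]
      ideal_pow_1[OF radical_ideal] by (auto simp: I_def simp del: nat_pow_Suc nat_pow_0)
  have II: "ideal_prod R I I = I"
    unfolding I_def ideal_pow_add[OF radical_ideal] by (rule N) simp
  have "I = {\<zero>}"
  proof (rule ccontr)
    assume "I \<noteq> {\<zero>}"
    define F where "F = {L. left_ideal L R \<and> (\<exists>x\<in>L. \<exists>a\<in>I. a \<otimes> x \<noteq> \<zero>)}"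
    obtain a where "a \<in> I" "a \<noteq> \<zero>"
      using \<open>I \<noteq> {\<zero>}\<close> left_idealD(2)[OF left_ideal_of_ideal[OF I(1)]] by auto
    then have "a \<otimes> \<one> \<noteq> \<zero>"
      using ideal.Icarr[OF I(1)] by simp
    then have "carrier R \<in> F"
      using \<open>a \<in> I\<close> by (auto simp: F_def left_ideal_carrier)
    then obtain L where L: "L \<in> F" "\<And>L'. L' \<in> F \<Longrightarrow> L' \<subseteq> L \<Longrightarrow> L' = L"
      using artinian_minimal[OF assms, of F] unfolding F_def by blast
    then obtain x a0 where x: "x \<in> L" "a0 \<in> I" "a0 \<otimes> x \<noteq> \<zero>"
      by (auto simp: F_def)
    have Ll: "left_ideal L R"
      using L(1) by (simp add: F_def)
    have xc: "x \<in> carrier R"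
      using left_idealD(3)[OF Ll] x by blast
    let ?L = "(\<lambda>a. a \<otimes> x) ` I"
    note Icarr = ideal.Icarr[OF I(1)] and Il = left_idealD[OF left_ideal_of_ideal[OF I(1)]]
    have sub: "?L \<subseteq> L"
      using left_idealD(7)[OF Ll] x(1) Icarr by auto
    have left: "left_ideal ?L R"
    proof (rule left_idealI)
      show "?L \<subseteq> carrier R"
        using Icarr xc by auto
      show "\<zero> \<in> ?L"
        using Il(2) xc by (auto intro!: image_eqI[where x=\<zero>])
      show "y \<oplus> z \<in> ?L" if yz: "y \<in> ?L" "z \<in> ?L" for y z
      proof -
        from yz obtain b c where "b \<in> I" "c \<in> I" "y = b \<otimes> x" "z = c \<otimes> x"
          by auto
        then show ?thesis
          using Il(4) Icarr xc by (auto intro!: image_eqI[where x="b \<oplus> c"] simp: l_distr)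
      qed
      show "b \<otimes> y \<in> ?L" if bx: "b \<in> carrier R" "y \<in> ?L" for b y
      proof -
        from bx obtain c where "c \<in> I" "y = c \<otimes> x"
          by auto
        then show ?thesis
          using Il(7) Icarr xc bx(1) by (auto intro!: image_eqI[where x="b \<otimes> c"] simp: m_assoc)
      qed
    qed
    have "?L \<in> F"
    proof (rule ccontr)
      assume "?L \<notin> F"
      then have zero: "b \<otimes> (c \<otimes> x) = \<zero>" if "b \<in> I" "c \<in> I" for b c
        using that left by (auto simp: F_def)
      have "ideal_prod R I I \<subseteq> {c \<in> carrier R. c \<otimes> x = \<zero>}"
      proof (rule ideal_prod_least)
        show "b \<otimes> c \<in> {c \<in> carrier R. c \<otimes> x = \<zero>}" if "b \<in> I" "c \<in> I" for b c
          using zero[OF that] that Icarr xc by (simp add: m_assoc)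
      qed (use xc in \<open>auto simp: l_distr\<close>)
      then show False
        using x(2,3) II by auto
    qed
    then have "x \<in> ?L"
      using L(2) sub x(1) by metis
    then obtain c where "c \<in> I" "x = c \<otimes> x"
      by auto
    then have "x = \<zero>"
      using radical_fixes_zero[of c x] I(2) xc by blast
    then show False
      using x(2,3) Icarr by simp
  qed
  then show thesis
    using that I_def by blast
qed

section \<open>Complements modulo the radical and finite generation of semisimple layers\<close>

text \<open>The radical being the intersection of the maximal left ideals, a minimal supplement of a left
  ideal meets it inside the radical.\<close>

lemma complement_mod_radical:
  assumes "left_artinian R" "left_ideal L R"
  obtains C where "left_ideal C R" "L <+>\<^bsub>R\<^esub> C = carrier R" "L \<inter> C \<subseteq> radical R"
proof -
  define F where "F = {C. left_ideal C R \<and> L <+>\<^bsub>R\<^esub> C = carrier R}"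
  have "L <+>\<^bsub>R\<^esub> carrier R = carrier R"
    using set_add_upper(2)[OF assms(2) left_ideal_carrier]
      left_idealD(1)[OF left_ideal_add[OF assms(2) left_ideal_carrier]] by blast
  then have "carrier R \<in> F"
    by (simp add: F_def left_ideal_carrier)
  then obtain C where C: "C \<in> F" "\<And>C'. C' \<in> F \<Longrightarrow> C' \<subseteq> C \<Longrightarrow> C' = C"
    using artinian_minimal[OF assms(1), of F] unfolding F_def by blast
  then have Cl: "left_ideal C R" and LC: "L <+>\<^bsub>R\<^esub> C = carrier R"
    by (auto simp: F_def)
  have D: "left_ideal (L \<inter> C) R"
    using left_ideal_Int assms(2) Cl by blast
  have *: "x \<in> M" if x: "x \<in> L \<inter> C" and max: "maximal_left_ideal M R" for x M
  proof (rule ccontr)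
    assume "x \<notin> M"
    have xc: "x \<in> carrier R"
      using x left_idealD(3)[OF D] by blast
    have M: "left_ideal M R"
      using max by (simp add: maximal_left_ideal_def)
    have CM: "left_ideal (C \<inter> M) R"
      using left_ideal_Int Cl M by blast
    \<comment> \<open>Split \<open>y = l \<oplus> c\<close> along \<open>L\<close> and
      \<open>C\<close>, then \<open>c = b \<otimes> x \<oplus> d\<close> with \<open>d\<close> in
      \<open>M\<close>. The term \<open>b \<otimes> x\<close> lies in \<open>L\<close> as well as in
      \<open>C\<close>, so it can move to the first summand, and \<open>d\<close> remains in
      \<open>C \<inter> M\<close>. Thus \<open>C \<inter> M\<close> would be a smaller supplement of
      \<open>L\<close>.\<close>
    have "y \<in> L <+>\<^bsub>R\<^esub> (C \<inter> M)" if y: "y \<in> carrier R" for y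
    proof -
      obtain l c where lc: "l \<in> L" "c \<in> C" "y = l \<oplus> c"
        using y LC by (metis set_addE)
      have carr: "l \<in> carrier R" "c \<in> carrier R"
        using lc left_idealD(3) assms(2) Cl by blast+
      obtain b d where bd: "b \<in> carrier R" "d \<in> M" "c = b \<otimes> x \<oplus> d"
        using maximal_left_ideal_add[OF max xc \<open>x \<notin> M\<close> carr(2)] by blast
      have dc: "d \<in> carrier R"
        using bd(2) left_idealD(3)[OF M] by blast
      have "d = c \<ominus> b \<otimes> x"
        unfolding bd(3) using bd(1) dc xc by algebra
      moreover have "b \<otimes> x \<in> L \<inter> C"
        using left_idealD(7)[OF D bd(1) x] .
      ultimately have "d \<in> C \<inter> M" "l \<oplus> b \<otimes> x \<in> L"
        using left_idealD(6)[OF Cl] left_idealD(4)[OF assms(2)] lc bd(2) by auto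
      moreover have "y = (l \<oplus> b \<otimes> x) \<oplus> d"
        unfolding lc(3) bd(3) using carr bd(1) dc xc by algebra
      ultimately show ?thesis
        using set_addI by blast
    qed
    then have "L <+>\<^bsub>R\<^esub> (C \<inter> M) = carrier R"
      using left_idealD(1)[OF left_ideal_add[OF assms(2) CM]] by blast
    then have "C \<inter> M = C"
      using C(2)[of "C \<inter> M"] CM by (simp add: F_def)
    then show False
      using x \<open>x \<notin> M\<close> by blast
  qed
  have "L \<inter> C \<subseteq> radical R"
  proof
    fix x assume x: "x \<in> L \<inter> C"
    show "x \<in> radical R"
      unfolding radical_def
    proof (intro CollectI conjI allI impI)
      show "x \<in> carrier R"
        by (rule left_idealD(3)[OF D x])
      show "x \<in> M" if "maximal_left_ideal M R" for M
        by (rule *[OF x that])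
    qed
  qed
  then show thesis
    using that Cl LC by blast
qed

text \<open>\<open>M / S\<close> is a module over the semisimple ring \<open>R / r\<close>, hence cyclic submodules have
  complements.\<close>

lemma complement_of_cyclic:
  assumes "left_artinian R" "left_ideal L R" "left_ideal S R" "S \<subseteq> L" "y \<in> L"
    and kill: "\<And>a x. a \<in> radical R \<Longrightarrow> x \<in> L \<Longrightarrow> a \<otimes> x \<in> S"
  obtains N where "left_ideal N R" "S \<subseteq> N" "N \<subseteq> L" "N \<inter> (\<lambda>a. a \<otimes> y) ` carrier R \<subseteq> S"
    "L \<subseteq> N <+>\<^bsub>R\<^esub> (\<lambda>a. a \<otimes> y) ` carrier R"
proof -
  note Ld = left_idealD[OF assms(2)] and Sd = left_idealD[OF assms(3)]
  define Y where "Y = (\<lambda>a. a \<otimes> y) ` carrier R"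
  have yc: "y \<in> carrier R"
    using assms(5) Ld by blast
  have Yl: "left_ideal Y R" "y \<in> Y"
    using left_ideal_principal[OF yc] by (auto simp: Y_def)
  have YL: "Y \<subseteq> L"
    using assms(5) Ld(7) by (auto simp: Y_def)
  \<comment> \<open>The complement is a member of \<open>F\<close> maximal under inclusion, as
    provided by Zorn's lemma. The remaining work is to show that \<open>N\<close> and
    \<open>Y\<close> together exhaust \<open>L\<close>.\<close>
  define F where "F = {N. left_ideal N R \<and> S \<subseteq> N \<and> N \<subseteq> L \<and> N \<inter> Y \<subseteq> S}"
  have "S \<in> F"
    using assms(3,4) by (auto simp: F_def)
  then have "F \<noteq> {}"
    by blast
  moreover have "\<Union>C \<in> F" if "C \<noteq> {}" "subset.chain F C" for C
  proof -
    have C: "left_ideal N R" "S \<subseteq> N" "N \<subseteq> L" "N \<inter> Y \<subseteq> S" if "N \<in> C" for N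
      using that \<open>subset.chain F C\<close> unfolding subset_chain_def F_def by blast+
    have "left_ideal (\<Union>C) R"
      using that C(1) unfolding subset_chain_def by (intro left_ideal_chain_Union) auto
    moreover have "S \<subseteq> \<Union>C" "\<Union>C \<subseteq> L" "\<Union>C \<inter> Y \<subseteq> S"
      using C(2-4) that(1) by blast+
    ultimately show ?thesis
      by (simp add: F_def)
  qed
  ultimately have "\<exists>N\<in>F. \<forall>X\<in>F. N \<subseteq> X \<longrightarrow> X = N"
    by (rule subset_Zorn_nonempty)
  then obtain N where N: "N \<in> F" "\<And>X. X \<in> F \<Longrightarrow> N \<subseteq> X \<Longrightarrow> X = N"
    by blast
  then have Nl: "left_ideal N R" "S \<subseteq> N" "N \<subseteq> L" "N \<inter> Y \<subseteq> S"
    by (auto simp: F_def)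
  note Nd = left_idealD[OF Nl(1)]
  define T where "T = N <+>\<^bsub>R\<^esub> Y"
  have Tl: "left_ideal T R"
    unfolding T_def using left_ideal_add Nl(1) Yl(1) by blast
  note Td = left_idealD[OF Tl]
  have NT: "N \<subseteq> T" and YT: "Y \<subseteq> T"
    unfolding T_def using set_add_upper Nl(1) Yl(1) by blast+
  have "x \<in> T" if x: "x \<in> L" for x
  proof -
    have xc: "x \<in> carrier R"
      using x Ld by blast
    \<comment> \<open>\<open>I\<close> is the annihilator of \<open>x\<close> modulo
      \<open>T\<close>. With \<open>C\<close> a complement of \<open>I\<close> modulo the radical
      and \<open>\<one> = i \<oplus> c\<close>, the element \<open>i \<otimes> x\<close> is in
      \<open>T\<close>, while any multiple of \<open>x' = c \<otimes> x\<close> that falls into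
      \<open>T\<close> already falls into \<open>S\<close>. Adding the multiples of
      \<open>x'\<close> to \<open>N\<close> therefore creates no new intersection with
      \<open>Y\<close>, and maximality of \<open>N\<close> puts \<open>x'\<close> into
      \<open>N\<close>.\<close>
    define I where "I = {a \<in> carrier R. a \<otimes> x \<in> T}"
    have Il: "left_ideal I R"
      unfolding I_def using Td xc by (intro left_idealI) (auto simp: l_distr m_assoc)
    obtain C where C: "left_ideal C R" "I <+>\<^bsub>R\<^esub> C = carrier R" "I \<inter> C \<subseteq> radical R"
      using complement_mod_radical[OF assms(1) Il] .
    note Cd = left_idealD[OF C(1)]
    obtain i c where ic: "i \<in> I" "c \<in> C" "\<one> = i \<oplus> c"
      using C(2) one_closed by (metis set_addE)
    have icc: "i \<in> carrier R" "c \<in> carrier R" and ix: "i \<otimes> x \<in> T"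
      using ic Cd by (auto simp: I_def)
    define x' where "x' = c \<otimes> x"
    have x': "x' \<in> L" "x' \<in> carrier R"
      using x xc icc Ld(7) by (auto simp: x'_def)
    have indep: "a \<otimes> x' \<in> S" if a: "a \<in> carrier R" "a \<otimes> x' \<in> T" for a
    proof -
      have "a \<otimes> c \<otimes> x \<in> T"
        using a icc xc by (simp add: x'_def m_assoc)
      then have "a \<otimes> c \<in> I"
        using a icc by (simp add: I_def)
      then have "a \<otimes> c \<in> radical R"
        using C(3) Cd(7)[OF a(1) ic(2)] by blast
      then have "a \<otimes> c \<otimes> x \<in> S"
        using kill x by blast
      then show ?thesis
        using a icc xc by (simp add: x'_def m_assoc)
    qed
    define X where "X = (\<lambda>a. a \<otimes> x') ` carrier R"
    have Xl: "left_ideal X R" "x' \<in> X"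
      using left_ideal_principal[OF x'(2)] by (auto simp: X_def)
    have XL: "X \<subseteq> L"
      using Ld(7) x'(1) by (auto simp: X_def)
    have "N <+>\<^bsub>R\<^esub> X \<in> F"
    proof -
      have "left_ideal (N <+>\<^bsub>R\<^esub> X) R" "S \<subseteq> N <+>\<^bsub>R\<^esub> X"
        using left_ideal_add[OF Nl(1) Xl(1)] set_add_upper(1)[OF Nl(1) Xl(1)] Nl(2) by auto
      moreover have "N <+>\<^bsub>R\<^esub> X \<subseteq> L"
      proof
        fix z assume "z \<in> N <+>\<^bsub>R\<^esub> X"
        then obtain n v where "n \<in> N" "v \<in> X" "z = n \<oplus> v"
          by (auto simp: set_add_def')
        then show "z \<in> L"
          using Nl(3) XL Ld(4) by blast
      qed
      moreover have "(N <+>\<^bsub>R\<^esub> X) \<inter> Y \<subseteq> S"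
      proof
        fix z assume z: "z \<in> (N <+>\<^bsub>R\<^esub> X) \<inter> Y"
        then obtain n a where na: "n \<in> N" "a \<in> carrier R" "z = n \<oplus> a \<otimes> x'"
          by (auto simp: set_add_def' X_def)
        have nc: "n \<in> carrier R"
          using na(1) Nd(3) by blast
        have "a \<otimes> x' = z \<ominus> n"
          unfolding na(3) using na(2) nc x'(2) by algebra
        moreover have "z \<ominus> n \<in> T"
          using Td(6)[of z n] subsetD[OF YT] subsetD[OF NT] z na(1) by simp
        ultimately have "a \<otimes> x' \<in> S"
          using indep[OF na(2)] by simp
        then have "z \<in> N"
          using na(1,3) Nl(2) Nd(4) by blast
        then show "z \<in> S"
          using z Nl(4) by blast
      qed
      ultimately show ?thesis
        by (simp add: F_def)
    qed
    then have "N <+>\<^bsub>R\<^esub> X = N"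
      using N(2) set_add_upper(1)[OF Nl(1) Xl(1)] by blast
    then have "x' \<in> T"
      using set_add_upper(2)[OF Nl(1) Xl(1)] Xl(2) NT by blast
    then have "i \<otimes> x \<oplus> x' \<in> T"
      using Td(4) ix by blast
    moreover have "i \<otimes> x \<oplus> x' = (i \<oplus> c) \<otimes> x"
      using icc xc by (simp add: x'_def l_distr)
    ultimately show ?thesis
      using ic(3) xc by (metis l_one)
  qed
  then show thesis
    using that[of N] Nl unfolding T_def Y_def by blast
qed

text \<open>Choose \<open>L\<close> minimal among the left ideals between \<open>S\<close> and
  \<open>M\<close> over which \<open>M\<close> is generated by finitely many elements. If
  \<open>L\<close> is larger than \<open>S\<close>, a cyclic piece generated by some
  \<open>y\<close> outside \<open>S\<close> splits off from \<open>L\<close> modulo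
  \<open>S\<close>. Its complement is a strictly smaller left ideal over which one further
  generator, \<open>y\<close>, suffices. Hence \<open>L = S\<close>.\<close>

lemma semisimple_layer_finitely_generated:
  assumes "left_artinian R" "left_ideal M R" "left_ideal S R" "S \<subseteq> M"
    and kill: "\<And>a x. a \<in> radical R \<Longrightarrow> x \<in> M \<Longrightarrow> a \<otimes> x \<in> S"
  obtains X where "finite X" "X \<subseteq> M" "\<And>L. left_ideal L R \<Longrightarrow> S \<subseteq> L \<Longrightarrow> X \<subseteq> L \<Longrightarrow> M \<subseteq> L"
proof -
  define gen where "gen L X \<longleftrightarrow> finite X \<and> X \<subseteq> M \<and> (\<forall>L'. left_ideal L' R \<and> L \<subseteq> L' \<and> X \<subseteq> L' \<longrightarrow> M \<subseteq> L')"
    for L X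
  define F where "F = {L. left_ideal L R \<and> S \<subseteq> L \<and> L \<subseteq> M \<and> (\<exists>X. gen L X)}"
  have "gen M {}"
    by (simp add: gen_def)
  then have "M \<in> F"
    using assms(2,4) by (auto simp: F_def)
  then obtain L where L: "L \<in> F" "\<And>L'. L' \<in> F \<Longrightarrow> L' \<subseteq> L \<Longrightarrow> L' = L"
    using artinian_minimal[OF assms(1), of F] unfolding F_def by blast
  obtain X where X: "gen L X"
    using L(1) by (auto simp: F_def)
  have Ll: "left_ideal L R" "S \<subseteq> L" "L \<subseteq> M"
    using L(1) by (auto simp: F_def)
  have "L = S"
  proof (rule ccontr)
    assume "L \<noteq> S"
    then obtain y where y: "y \<in> L" "y \<notin> S"
      using Ll by blast
    define Y where "Y = (\<lambda>a. a \<otimes> y) ` carrier R"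
    have kill': "a \<otimes> x \<in> S" if "a \<in> radical R" "x \<in> L" for a x
      using kill that Ll(3) by blast
    obtain N where N: "left_ideal N R" "S \<subseteq> N" "N \<subseteq> L" "N \<inter> Y \<subseteq> S" "L \<subseteq> N <+>\<^bsub>R\<^esub> Y"
      using complement_of_cyclic[OF assms(1) Ll(1) assms(3) Ll(2) y(1) kill'] unfolding Y_def by blast
    have "gen N (insert y X)"
      unfolding gen_def
    proof (intro conjI allI impI)
      show "finite (insert y X)" "insert y X \<subseteq> M"
        using X y(1) Ll(3) by (auto simp: gen_def)
      fix L' assume L': "left_ideal L' R \<and> N \<subseteq> L' \<and> insert y X \<subseteq> L'"
      then have "Y \<subseteq> L'"
        unfolding Y_def using left_idealD(7)[of L'] by auto
      have "L \<subseteq> L'"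
      proof
        fix z assume "z \<in> L"
        then obtain n v where "n \<in> N" "v \<in> Y" "z = n \<oplus> v"
          using N(5) by (auto simp: set_add_def')
        then show "z \<in> L'"
          using left_idealD(4)[of L' n v] L' \<open>Y \<subseteq> L'\<close> by blast
      qed
      then show "M \<subseteq> L'"
        using X L' by (simp add: gen_def)
    qed
    then have "N \<in> F"
      using N Ll by (auto simp: F_def)
    then have "N = L"
      using L(2) N(3) by blast
    moreover have "y \<in> Y"
      unfolding Y_def using left_ideal_principal(2) y(1) left_idealD(3)[OF Ll(1)] by blast
    ultimately show False
      using N(4) y by blast
  qed
  then show thesis
    using that X by (auto simp: gen_def)
qed

end

section \<open>Quotients of algebras\<close>

lemma (in abelian_group) minus_eq_zero_iff:
  assumes "x \<in> carrier G" "y \<in> carrier G"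
  shows "x \<ominus> y = \<zero> \<longleftrightarrow> x = y"
proof
  assume "x \<ominus> y = \<zero>"
  then have "x \<oplus> (\<ominus> y \<oplus> y) = \<zero> \<oplus> y"
    using assms by (simp add: a_minus_def a_assoc[symmetric] del: l_neg)
  then show "x = y"
    using assms by (simp add: l_neg)
qed (use assms in \<open>simp add: a_minus_def r_neg\<close>)

text \<open>Common ground for \<open>k_algebra\<close> and for the space of formal paths, whose
  field \<open>one\<close> is not an identity.\<close>

locale nonunital_algebra = R?: field R + module R M for R and M (structure) +
  assumes mult_closed [simp, intro]: "\<lbrakk>x \<in> carrier M; y \<in> carrier M\<rbrakk> \<Longrightarrow> x \<otimes> y \<in> carrier M"
    and mult_assoc: "\<lbrakk>x \<in> carrier M; y \<in> carrier M; z \<in> carrier M\<rbrakk> \<Longrightarrow>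
        (x \<otimes> y) \<otimes> z = x \<otimes> (y \<otimes> z)"
    and mult_add_left: "\<lbrakk>x \<in> carrier M; y \<in> carrier M; z \<in> carrier M\<rbrakk> \<Longrightarrow>
        (x \<oplus> y) \<otimes> z = x \<otimes> z \<oplus> y \<otimes> z"
    and mult_add_right: "\<lbrakk>x \<in> carrier M; y \<in> carrier M; z \<in> carrier M\<rbrakk> \<Longrightarrow>
        z \<otimes> (x \<oplus> y) = z \<otimes> x \<oplus> z \<otimes> y"
    and smult_mult_left: "\<lbrakk>a \<in> carrier R; x \<in> carrier M; y \<in> carrier M\<rbrakk> \<Longrightarrow>
        (a \<odot> x) \<otimes> y = a \<odot> (x \<otimes> y)"
    and smult_mult_right: "\<lbrakk>a \<in> carrier R; x \<in> carrier M; y \<in> carrier M\<rbrakk> \<Longrightarrow>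
        x \<otimes> (a \<odot> y) = a \<odot> (x \<otimes> y)"

lemma (in k_algebra) nonunital_algebra: "nonunital_algebra R M"
  by unfold_locales (auto simp: m_assoc l_distr r_distr smult_mult_left smult_mult_right)

lemma quot_alg_simps:
  "carrier (quot_alg A I) = (\<lambda>x. I +>\<^bsub>A\<^esub> x) ` carrier A"
  "add (quot_alg A I) = set_add A"
  "mult (quot_alg A I) = rcoset_mult A I"
  "\<zero>\<^bsub>quot_alg A I\<^esub> = I"
  "\<one>\<^bsub>quot_alg A I\<^esub> = I +>\<^bsub>A\<^esub> \<one>\<^bsub>A\<^esub>"
  "c \<odot>\<^bsub>quot_alg A I\<^esub> Y = (\<Union>x\<in>Y. I +>\<^bsub>A\<^esub> (c \<odot>\<^bsub>A\<^esub> x))"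
  by (auto simp: quot_alg_def FactRing_def ring.defs module.defs A_RCOSETS_def')

context nonunital_algebra
begin

text \<open>Stability under scalars is demanded explicitly. It follows from absorption only when
  scalars can be written as multiples of an identity.\<close>

definition alg_ideal :: "'c set \<Rightarrow> bool"
  where "alg_ideal I \<longleftrightarrow> submodule I R M \<and>
    (\<forall>x\<in>carrier M. \<forall>y\<in>I. x \<otimes> y \<in> I \<and> y \<otimes> x \<in> I)"

lemma mult_zero_left [simp]: "x \<in> carrier M \<Longrightarrow> \<zero> \<otimes> x = \<zero>"
  by (metis M.zero_closed R.zero_closed mult_closed smult_l_null smult_mult_left)

lemma mult_zero_right [simp]: "x \<in> carrier M \<Longrightarrow> x \<otimes> \<zero> = \<zero>"
  by (metis M.zero_closed R.zero_closed mult_closed smult_l_null smult_mult_right)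

lemma minus_zero: "\<ominus> \<zero> = \<zero>"
  using M.r_neg[of "\<zero>"] by simp

lemma coset_memE:
  assumes "x' \<in> I +> x"
  obtains i where "i \<in> I" "x' = i \<oplus> x"
  using assms by (auto simp: a_r_coset_def')

lemma mult_minus_left:
  assumes "x \<in> carrier M" "y \<in> carrier M"
  shows "(\<ominus> x) \<otimes> y = \<ominus> (x \<otimes> y)"
  using smult_mult_left[of "\<ominus>\<^bsub>R\<^esub> \<one>\<^bsub>R\<^esub>" x y] assms by (simp add: smult_l_minus)

lemma mult_minus_right:
  assumes "x \<in> carrier M" "y \<in> carrier M"
  shows "x \<otimes> (\<ominus> y) = \<ominus> (x \<otimes> y)"
  using smult_mult_right[of "\<ominus>\<^bsub>R\<^esub> \<one>\<^bsub>R\<^esub>" x y] assms by (simp add: smult_l_minus)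

lemma mult_diff_left:
  "\<lbrakk>x \<in> carrier M; y \<in> carrier M; z \<in> carrier M\<rbrakk> \<Longrightarrow>
    (x \<ominus> y) \<otimes> z = x \<otimes> z \<ominus> y \<otimes> z"
  by (simp add: a_minus_def mult_add_left mult_minus_left)

lemma mult_diff_right:
  "\<lbrakk>x \<in> carrier M; y \<in> carrier M; z \<in> carrier M\<rbrakk> \<Longrightarrow>
    z \<otimes> (x \<ominus> y) = z \<otimes> x \<ominus> z \<otimes> y"
  by (simp add: a_minus_def mult_add_right mult_minus_right)

lemma smult_diff:
  "\<lbrakk>a \<in> carrier R; x \<in> carrier M; y \<in> carrier M\<rbrakk> \<Longrightarrow>
    a \<odot> (x \<ominus> y) = a \<odot> x \<ominus> a \<odot> y"
  by (simp add: a_minus_def smult_r_distr smult_r_minus)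

lemma submodule_abelian_subgroup:
  assumes "submodule I R M"
  shows "abelian_subgroup I M"
  using assms by (intro abelian_subgroupI3 additive_subgroup.intro)
    (auto simp: submodule_def M.abelian_group_axioms)

lemma alg_idealD:
  assumes "alg_ideal I"
  shows "submodule I R M" "I \<subseteq> carrier M" "\<zero> \<in> I"
    and "\<And>x y. x \<in> I \<Longrightarrow> y \<in> I \<Longrightarrow> x \<oplus> y \<in> I"
    and "\<And>x. x \<in> I \<Longrightarrow> \<ominus> x \<in> I"
    and "\<And>x y. x \<in> I \<Longrightarrow> y \<in> I \<Longrightarrow> x \<ominus> y \<in> I"
    and "\<And>c x. c \<in> carrier R \<Longrightarrow> x \<in> I \<Longrightarrow> c \<odot> x \<in> I"
    and "\<And>x y. x \<in> carrier M \<Longrightarrow> y \<in> I \<Longrightarrow> x \<otimes> y \<in> I"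
    and "\<And>x y. x \<in> carrier M \<Longrightarrow> y \<in> I \<Longrightarrow> y \<otimes> x \<in> I"
proof -
  show sub: "submodule I R M"
    using assms by (simp add: alg_ideal_def)
  note E = submoduleE[OF sub]
  interpret I: abelian_subgroup I M
    by (rule submodule_abelian_subgroup[OF sub])
  show "I \<subseteq> carrier M" "\<zero> \<in> I"
    using E(1) by auto
  show "\<And>x y. x \<in> I \<Longrightarrow> y \<in> I \<Longrightarrow> x \<oplus> y \<in> I" "\<And>x. x \<in> I \<Longrightarrow> \<ominus> x \<in> I"
    "\<And>x y. x \<in> I \<Longrightarrow> y \<in> I \<Longrightarrow> x \<ominus> y \<in> I" "\<And>c x. c \<in> carrier R \<Longrightarrow> x \<in> I \<Longrightarrow> c \<odot> x \<in> I"
    using E(3-5) by (auto simp: a_minus_def)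
  show "\<And>x y. x \<in> carrier M \<Longrightarrow> y \<in> I \<Longrightarrow> x \<otimes> y \<in> I"
    "\<And>x y. x \<in> carrier M \<Longrightarrow> y \<in> I \<Longrightarrow> y \<otimes> x \<in> I"
    using assms by (auto simp: alg_ideal_def)
qed

context
  fixes I assumes I: "alg_ideal I"
begin

lemma coset_eq_iff:
  assumes "x \<in> carrier M" "y \<in> carrier M"
  shows "I +> x = I +> y \<longleftrightarrow> x \<ominus> y \<in> I"
proof -
  interpret I: abelian_subgroup I M
    by (rule submodule_abelian_subgroup[OF alg_idealD(1)[OF I]])
  show ?thesis
    using assms I.a_rcos_module[OF assms(2,1)] I.a_repr_independence'[of x y] I.a_rcos_self[of x]
    by (auto simp: a_minus_def)
qed

lemma coset_add: "\<lbrakk>x \<in> carrier M; y \<in> carrier M\<rbrakk> \<Longrightarrow>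
    (I +> x) \<oplus>\<^bsub>quot_alg M I\<^esub> (I +> y) = I +> (x \<oplus> y)"
  using abelian_subgroup.a_rcos_sum[OF submodule_abelian_subgroup[OF alg_idealD(1)[OF I]]]
  by (simp add: quot_alg_simps)

lemma coset_self: "x \<in> carrier M \<Longrightarrow> x \<in> I +> x"
  by (rule abelian_subgroup.a_rcos_self[OF submodule_abelian_subgroup[OF alg_idealD(1)[OF I]]])

text \<open>\<open>rcoset_mult\<close> is the union of the cosets of all products of
  representatives. All these cosets coincide, since changing the factors by \<open>i\<close> and
  \<open>j\<close> in \<open>I\<close> changes the product by \<open>i \<otimes> j \<oplus> (x
  \<otimes> j \<oplus> i \<otimes> y)\<close>.\<close>

lemma coset_mult:
  assumes "x \<in> carrier M" "y \<in> carrier M"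
  shows "(I +> x) \<otimes>\<^bsub>quot_alg M I\<^esub> (I +> y) = I +> (x \<otimes> y)"
proof -
  have *: "I +> (x' \<otimes> y') = I +> (x \<otimes> y)"
    if x': "x' \<in> I +> x" and y': "y' \<in> I +> y" for x' y'
  proof -
    obtain i j where ij: "i \<in> I" "j \<in> I" "x' = i \<oplus> x" "y' = j \<oplus> y"
      using x' y' coset_memE by metis
    have c: "i \<in> carrier M" "j \<in> carrier M"
      using ij alg_idealD(2)[OF I] by auto
    have "x' \<otimes> y' = (i \<otimes> j \<oplus> (x \<otimes> j \<oplus> i \<otimes> y)) \<oplus> x \<otimes> y"
      unfolding ij using c assms by (simp add: mult_add_left mult_add_right M.a_ac)
    then have "x' \<otimes> y' \<ominus> x \<otimes> y = i \<otimes> j \<oplus> (x \<otimes> j \<oplus> i \<otimes> y)"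
      using c assms by (simp add: a_minus_def M.a_assoc M.r_neg)
    also have "\<dots> \<in> I"
      using alg_idealD(4,8,9)[OF I] ij(1,2) assms c by auto
    finally show ?thesis
      using coset_eq_iff c assms ij by simp
  qed
  show ?thesis
    unfolding quot_alg_simps rcoset_mult_def using * coset_self assms by blast
qed

lemma coset_smult:
  assumes "c \<in> carrier R" "x \<in> carrier M"
  shows "c \<odot>\<^bsub>quot_alg M I\<^esub> (I +> x) = I +> (c \<odot> x)"
proof -
  have *: "I +> (c \<odot> x') = I +> (c \<odot> x)" if x': "x' \<in> I +> x" for x'
  proof -
    obtain i where i: "i \<in> I" "x' = i \<oplus> x"
      using x' coset_memE by metis
    have ic: "i \<in> carrier M"
      using i alg_idealD(2)[OF I] by auto
    have "c \<odot> x' \<ominus> c \<odot> x = c \<odot> i"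
      using i ic assms by (simp add: smult_r_distr a_minus_def M.a_assoc M.r_neg)
    then show ?thesis
      using coset_eq_iff ic assms i alg_idealD(7)[OF I] by simp
  qed
  show ?thesis
    unfolding quot_alg_simps using * coset_self assms by blast
qed

lemma coset_zero: "I +> \<zero> = I"
  by (simp add: M.a_coset_add_zero alg_idealD(2)[OF I])

lemma coset_eq_zero_iff: "x \<in> carrier M \<Longrightarrow> I +> x = I \<longleftrightarrow> x \<in> I"
  using coset_eq_iff[of x "\<zero>"] by (simp add: coset_zero a_minus_def minus_zero)

lemma quot_alg_abelian_group: "abelian_group (quot_alg M I)"
proof (rule abelian_groupI)
  show "\<And>x y. x \<in> carrier (quot_alg M I) \<Longrightarrow> y \<in> carrier (quot_alg M I) \<Longrightarrow>
      x \<oplus>\<^bsub>quot_alg M I\<^esub> y \<in> carrier (quot_alg M I)"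
    by (auto simp: quot_alg_simps(1) coset_add)
  show "\<zero>\<^bsub>quot_alg M I\<^esub> \<in> carrier (quot_alg M I)"
    by (auto simp: quot_alg_simps(1,4) intro!: image_eqI[where x="\<zero>"] coset_zero[symmetric])
  show "\<And>x y z. x \<in> carrier (quot_alg M I) \<Longrightarrow> y \<in> carrier (quot_alg M I) \<Longrightarrow> z \<in> carrier (quot_alg M I) \<Longrightarrow>
      x \<oplus>\<^bsub>quot_alg M I\<^esub> y \<oplus>\<^bsub>quot_alg M I\<^esub> z = x \<oplus>\<^bsub>quot_alg M I\<^esub> (y \<oplus>\<^bsub>quot_alg M I\<^esub> z)"
    by (auto simp: quot_alg_simps(1) coset_add M.a_assoc)
  show "\<And>x y. x \<in> carrier (quot_alg M I) \<Longrightarrow> y \<in> carrier (quot_alg M I) \<Longrightarrow>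
      x \<oplus>\<^bsub>quot_alg M I\<^esub> y = y \<oplus>\<^bsub>quot_alg M I\<^esub> x"
    by (auto simp: quot_alg_simps(1) coset_add M.a_comm)
  show "\<zero>\<^bsub>quot_alg M I\<^esub> \<oplus>\<^bsub>quot_alg M I\<^esub> x = x" if "x \<in> carrier (quot_alg M I)" for x
  proof -
    have "\<zero>\<^bsub>quot_alg M I\<^esub> = I +> \<zero>"
      by (simp add: coset_zero quot_alg_simps(4))
    then show ?thesis
      using that by (auto simp: quot_alg_simps(1) coset_add)
  qed
  show "\<exists>y\<in>carrier (quot_alg M I). y \<oplus>\<^bsub>quot_alg M I\<^esub> x = \<zero>\<^bsub>quot_alg M I\<^esub>"
    if "x \<in> carrier (quot_alg M I)" for x
  proof -
    from that obtain y where "y \<in> carrier M" "x = I +> y"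
      by (auto simp: quot_alg_simps(1))
    then show ?thesis
      by (intro bexI[of _ "I +> \<ominus> y"])
        (auto simp: quot_alg_simps(1,4) coset_add M.l_neg coset_zero)
  qed
qed

text \<open>The field \<open>one\<close> only has to act as an identity modulo \<open>I\<close>.
  This is how the pseudo path algebra acquires its identity.\<close>

lemma quot_alg_k_algebra:
  assumes one: "\<one> \<in> carrier M" "\<And>x. x \<in> carrier M \<Longrightarrow> \<one> \<otimes> x \<ominus> x \<in> I"
    "\<And>x. x \<in> carrier M \<Longrightarrow> x \<otimes> \<one> \<ominus> x \<in> I"
  shows "k_algebra R (quot_alg M I)"
proof -
  let ?Q = "quot_alg M I"
  have carr: "x \<in> carrier ?Q \<Longrightarrow> \<exists>y\<in>carrier M. x = I +> y" for x
    by (auto simp: quot_alg_simps(1))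
  have carrI: "y \<in> carrier M \<Longrightarrow> I +> y \<in> carrier ?Q" for y
    by (auto simp: quot_alg_simps(1))
  have o: "\<one>\<^bsub>?Q\<^esub> = I +> \<one>"
    by (simp add: quot_alg_simps)
  have mon: "monoid ?Q"
  proof (rule monoidI)
    show "\<one>\<^bsub>?Q\<^esub> \<in> carrier ?Q"
      using one by (simp add: o carrI)
  next
    fix x assume "x \<in> carrier ?Q"
    then obtain y where y: "y \<in> carrier M" "x = I +> y"
      using carr by blast
    show "\<one>\<^bsub>?Q\<^esub> \<otimes>\<^bsub>?Q\<^esub> x = x" "x \<otimes>\<^bsub>?Q\<^esub> \<one>\<^bsub>?Q\<^esub> = x"
      unfolding o using y one by (simp_all add: coset_mult coset_eq_iff)
  qed (auto dest!: carr simp: coset_mult carrI mult_assoc)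
  have ring: "ring ?Q"
    using mon by (intro ringI quot_alg_abelian_group)
      (auto dest!: carr simp: coset_mult coset_add mult_add_left mult_add_right)
  have "module R ?Q"
    by (intro moduleI R.is_cring quot_alg_abelian_group)
      (auto dest!: carr simp: coset_add coset_smult carrI smult_l_distr smult_r_distr smult_assoc1)
  then show ?thesis
    using ring R.field_axioms
    by (intro k_algebra.intro k_algebra_axioms.intro)
      (auto dest!: carr simp: coset_mult coset_smult smult_mult_left smult_mult_right)
qed

end

end

context k_algebra
begin

interpretation N: nonunital_algebra R M
  by (rule nonunital_algebra)

text \<open>Scalars act through the identity: the multiple of \<open>x\<close> by \<open>c\<close>
  is the product of the multiple of \<open>\<one>\<close> by \<open>c\<close> with
  \<open>x\<close>.\<close>

lemma ideal_submodule:
  assumes "ideal I M"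
  shows "submodule I R M"
proof (rule submoduleI)
  interpret ideal I M
    by fact
  show "I \<subseteq> carrier M" "\<zero>\<^bsub>M\<^esub> \<in> I"
    using a_subset by auto
  show "c \<odot>\<^bsub>M\<^esub> x \<in> I" if "c \<in> carrier R" "x \<in> I" for c x
  proof -
    have "c \<odot>\<^bsub>M\<^esub> x = (c \<odot>\<^bsub>M\<^esub> \<one>) \<otimes> x"
      using that smult_mult_left[of c \<one> x] by simp
    then show ?thesis
      using that I_l_closed[of x "c \<odot>\<^bsub>M\<^esub> \<one>"] by simp
  qed
  show "\<ominus> x \<in> I" if "x \<in> I" for x
    using that by (rule a_inv_closed)
  show "x \<oplus> y \<in> I" if "x \<in> I" "y \<in> I" for x y
    using that by (rule additive_subgroup.a_closed[OF additive_subgroup_axioms])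
qed

lemma ideal_alg_ideal: "ideal I M \<Longrightarrow> N.alg_ideal I"
  unfolding N.alg_ideal_def by (auto intro: ideal_submodule ideal.I_l_closed ideal.I_r_closed)

lemma quot_ideal_k_algebra:
  assumes "ideal I M"
  shows "k_algebra R (quot_alg M I)"
  using additive_subgroup.zero_closed[OF ideal.axioms(1)[OF assms]]
  by (intro N.quot_alg_k_algebra ideal_alg_ideal[OF assms]) (auto simp: a_minus_def r_neg)

lemmas ideal_coset_eq_iff = N.coset_eq_iff[OF ideal_alg_ideal]
  and ideal_coset_eq_zero_iff = N.coset_eq_zero_iff[OF ideal_alg_ideal]
  and ideal_coset_add = N.coset_add[OF ideal_alg_ideal]
  and ideal_coset_mult = N.coset_mult[OF ideal_alg_ideal]
  and ideal_coset_smult = N.coset_smult[OF ideal_alg_ideal]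
  and ideal_coset_self = N.coset_self[OF ideal_alg_ideal]

end

section \<open>Algebra morphisms and the quotient by a kernel\<close>

lemma alg_homD:
  assumes "h \<in> alg_hom K A B"
  shows "\<And>x. x \<in> carrier A \<Longrightarrow> h x \<in> carrier B"
    and "\<And>x y. x \<in> carrier A \<Longrightarrow> y \<in> carrier A \<Longrightarrow> h (x \<otimes>\<^bsub>A\<^esub> y) = h x \<otimes>\<^bsub>B\<^esub> h y"
    and "\<And>x y. x \<in> carrier A \<Longrightarrow> y \<in> carrier A \<Longrightarrow> h (x \<oplus>\<^bsub>A\<^esub> y) = h x \<oplus>\<^bsub>B\<^esub> h y"
    and "h \<one>\<^bsub>A\<^esub> = \<one>\<^bsub>B\<^esub>"
    and "\<And>c x. c \<in> carrier K \<Longrightarrow> x \<in> carrier A \<Longrightarrow> h (c \<odot>\<^bsub>A\<^esub> x) = c \<odot>\<^bsub>B\<^esub> h x"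
  using assms by (auto simp: alg_hom_def ring_hom_def)

lemma alg_hom_ring_hom_ring:
  assumes "k_algebra K A" "k_algebra K B" "h \<in> alg_hom K A B"
  shows "ring_hom_ring A B h"
  using assms by (intro ring_hom_ringI2) (auto simp: k_algebra_def alg_hom_def)

text \<open>The inverse direction of the first isomorphism theorem: \<open>y\<close> is sent to its
  fibre under \<open>h\<close>, which is a coset of the kernel. \<open>alg_isomorphic\<close> asks
  for a map out of its first algebra, and the presentation has \<open>A\<close> in that
  place.\<close>

lemma quot_alg_isomorphic:
  assumes "k_algebra K A" "k_algebra K B" and h: "h \<in> alg_hom K A B" and surj: "h ` carrier A = carrier B"
    and I: "I = {x \<in> carrier A. h x = \<zero>\<^bsub>B\<^esub>}"
  shows "alg_isomorphic K B (quot_alg A I)"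
proof -
  interpret A: k_algebra K A by fact
  interpret B: k_algebra K B by fact
  interpret h: ring_hom_ring A B h
    by (rule alg_hom_ring_hom_ring[OF assms(1,2) h])
  have idl: "ideal I A"
    using h.kernel_is_ideal unfolding I a_kernel_def' .
  define g where "g y = {x \<in> carrier A. h x = y}" for y
  have eq: "h x = h y \<longleftrightarrow> I +>\<^bsub>A\<^esub> x = I +>\<^bsub>A\<^esub> y" if "x \<in> carrier A" "y \<in> carrier A" for x y
  proof -
    have "x \<ominus>\<^bsub>A\<^esub> y \<in> I \<longleftrightarrow> h x \<ominus>\<^bsub>B\<^esub> h y = \<zero>\<^bsub>B\<^esub>"
      using that by (simp add: I a_minus_def)
    then show ?thesis
      using A.ideal_coset_eq_iff[OF idl that] that by (simp add: B.minus_eq_zero_iff)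
  qed
  have g: "g (h x) = I +>\<^bsub>A\<^esub> x" if x: "x \<in> carrier A" for x
  proof -
    have "y \<in> I +>\<^bsub>A\<^esub> x \<longleftrightarrow> y \<in> carrier A \<and> I +>\<^bsub>A\<^esub> y = I +>\<^bsub>A\<^esub> x" for y
    proof -
      interpret ideal I A by (rule idl)
      show ?thesis
        using x a_repr_independence'[of y x] a_rcos_self[of y] A.a_r_coset_subset_G[OF a_subset x]
        by auto
    qed
    then show ?thesis
      using eq x by (auto simp: g_def)
  qed
  have "g \<in> alg_hom K B (quot_alg A I)"
    unfolding alg_hom_def
  proof (intro CollectI conjI ballI ring_hom_memI)
    fix x y assume "x \<in> carrier B" "y \<in> carrier B"
    then obtain x' y' where xy: "x' \<in> carrier A" "y' \<in> carrier A" "x = h x'" "y = h y'"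
      using surj by (metis imageE)
    show "g x \<in> carrier (quot_alg A I)"
      using xy g by (auto simp: quot_alg_simps(1))
    show "g (x \<otimes>\<^bsub>B\<^esub> y) = g x \<otimes>\<^bsub>quot_alg A I\<^esub> g y"
      using xy g[of "x' \<otimes>\<^bsub>A\<^esub> y'"] by (simp add: g A.ideal_coset_mult[OF idl])
    show "g (x \<oplus>\<^bsub>B\<^esub> y) = g x \<oplus>\<^bsub>quot_alg A I\<^esub> g y"
      using xy g[of "x' \<oplus>\<^bsub>A\<^esub> y'"] by (simp add: g A.ideal_coset_add[OF idl])
  next
    show "g \<one>\<^bsub>B\<^esub> = \<one>\<^bsub>quot_alg A I\<^esub>"
      using g[of "\<one>\<^bsub>A\<^esub>"] by (simp add: quot_alg_simps)
  next
    fix c x assume c: "c \<in> carrier K" "x \<in> carrier B"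
    then obtain x' where x: "x' \<in> carrier A" "x = h x'"
      using surj by (metis imageE)
    show "g (c \<odot>\<^bsub>B\<^esub> x) = c \<odot>\<^bsub>quot_alg A I\<^esub> g x"
      using x c g[of "c \<odot>\<^bsub>A\<^esub> x'"] alg_homD(5)[OF h] by (simp add: g A.ideal_coset_smult[OF idl])
  qed
  moreover have "bij_betw g (carrier B) (carrier (quot_alg A I))"
  proof (rule bij_betw_imageI)
    show "inj_on g (carrier B)"
      unfolding surj[symmetric] by (auto intro!: inj_onI simp: g eq)
    show "g ` carrier B = carrier (quot_alg A I)"
      unfolding surj[symmetric] by (auto simp: g quot_alg_simps(1) image_image)
  qed
  ultimately show ?thesis
    by (auto simp: alg_isomorphic_def)
qed

section \<open>The path space\<close>

locale pseudo_path_data = K: field K for K :: "('k, 'c) ring_scheme" +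
  fixes \<Delta> :: "('v, 'e) pre_digraph" and \<A> :: "'v \<Rightarrow> ('k, 'b, 'd) module_scheme"
  assumes finite_verts: "finite (verts \<Delta>)"
    and tail_vert: "\<beta> \<in> arcs \<Delta> \<Longrightarrow> tail \<Delta> \<beta> \<in> verts \<Delta>"
    and head_vert: "\<beta> \<in> arcs \<Delta> \<Longrightarrow> head \<Delta> \<beta> \<in> verts \<Delta>"
    and vertex_algebra: "i \<in> verts \<Delta> \<Longrightarrow> k_algebra K (\<A> i)"
begin

abbreviation "P \<equiv> path_space K \<Delta> \<A>"
abbreviation "pp \<equiv> pseudo_path \<Delta> \<A>"
abbreviation "pv \<equiv> path_vec K"
abbreviation "src \<equiv> path_start \<Delta>"
abbreviation "tgt \<equiv> path_end \<Delta>"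

lemma pp_not_Nil: "pp w \<Longrightarrow> w \<noteq> []"
  by (simp add: pseudo_path_def)

lemma pp_append:
  "u \<noteq> [] \<Longrightarrow> v \<noteq> [] \<Longrightarrow> pp (u @ v) \<longleftrightarrow> pp u \<and> pp v \<and> tgt u = src v"
  by (auto simp: pseudo_path_def successively_append_iff path_start_def path_end_def)

lemma src_append [simp]: "u \<noteq> [] \<Longrightarrow> src (u @ v) = src u"
  by (simp add: path_start_def)

lemma tgt_append [simp]: "v \<noteq> [] \<Longrightarrow> tgt (u @ v) = tgt v"
  by (simp add: path_end_def)

lemma src_Cons [simp]: "src (l # v) = letter_start \<Delta> l"
  by (simp add: path_start_def)

lemma tgt_single [simp]: "tgt [l] = letter_end \<Delta> l"
  by (simp add: path_end_def)

lemma tgt_Cons [simp]: "v \<noteq> [] \<Longrightarrow> tgt (l # v) = tgt v"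
  by (simp add: path_end_def)

lemma pp_single: "pp [l] \<longleftrightarrow> is_letter \<Delta> \<A> l"
  by (simp add: pseudo_path_def)

lemma pp_Cons: "v \<noteq> [] \<Longrightarrow> pp (l # v) \<longleftrightarrow> is_letter \<Delta> \<A> l \<and> pp v \<and> letter_end \<Delta> l = src v"
  using pp_append[of "[l]" v] by (simp add: pp_single)

text \<open>Relators replace a subword by one with the same ends, which does not disturb
  composability. The cases of empty \<open>u\<close> or \<open>v\<close> are separate because
  \<open>pp_append\<close> speaks of nonempty factors.\<close>

lemma pp_subst:
  assumes "pp (u @ x @ v)" "x \<noteq> []" "pp x'" "src x' = src x" "tgt x' = tgt x"
  shows "pp (u @ x' @ v)" "src (u @ x' @ v) = src (u @ x @ v)" "tgt (u @ x' @ v) = tgt (u @ x @ v)"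
proof -
  have x': "x' \<noteq> []"
    using assms(3) pp_not_Nil by blast
  have *: "pp (x @ v) \<Longrightarrow> pp (x' @ v)" "src (x' @ v) = src (x @ v)" "tgt (x' @ v) = tgt (x @ v)"
    using assms x' by (cases "v = []"; simp add: pp_append)+
  show "pp (u @ x' @ v)" "src (u @ x' @ v) = src (u @ x @ v)" "tgt (u @ x' @ v) = tgt (u @ x @ v)"
    using assms(1,2) x' * by (cases "u = []"; simp add: pp_append)+
qed

lemma src_vert: "pp w \<Longrightarrow> src w \<in> verts \<Delta>"
  by (cases w; cases "hd w") (auto simp: pseudo_path_def path_start_def tail_vert)

lemma tgt_vert: "pp w \<Longrightarrow> tgt w \<in> verts \<Delta>"
  by (cases w rule: rev_cases; cases "last w") (auto simp: pseudo_path_def path_end_def head_vert)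

section \<open>The vector space of formal paths and its concatenation product\<close>

lemma path_space_simps [simp]:
  "\<zero>\<^bsub>P\<^esub> = (\<lambda>w. \<zero>\<^bsub>K\<^esub>)"
  "f \<oplus>\<^bsub>P\<^esub> g = (\<lambda>w. f w \<oplus>\<^bsub>K\<^esub> g w)"
  "c \<odot>\<^bsub>P\<^esub> f = (\<lambda>w. c \<otimes>\<^bsub>K\<^esub> f w)"
  by (simp_all add: path_space_def)

lemma path_space_carrier:
  "f \<in> carrier P \<longleftrightarrow> (\<forall>w. f w \<in> carrier K) \<and> finite {w. f w \<noteq> \<zero>\<^bsub>K\<^esub>} \<and> (\<forall>w. f w \<noteq> \<zero>\<^bsub>K\<^esub> \<longrightarrow> pp w)"
  by (simp add: path_space_def)

lemma path_space_apply: "f \<in> carrier P \<Longrightarrow> f w \<in> carrier K"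
  by (simp add: path_space_carrier)

lemma path_space_mult:
  "f \<otimes>\<^bsub>P\<^esub> g = (\<lambda>w. if pp w
     then \<Oplus>\<^bsub>K\<^esub> n \<in> {1..<length w}. f (take n w) \<otimes>\<^bsub>K\<^esub> g (drop n w) else \<zero>\<^bsub>K\<^esub>)"
  by (simp add: path_space_def)

lemma path_vec_carrier [simp, intro]: "pp w \<Longrightarrow> pv w \<in> carrier P"
  by (auto simp: path_space_carrier path_vec_def)

lemma path_space_zero_closed: "\<zero>\<^bsub>P\<^esub> \<in> carrier P"
  by (simp add: path_space_carrier)

lemma path_space_add_closed:
  assumes "f \<in> carrier P" "g \<in> carrier P"
  shows "f \<oplus>\<^bsub>P\<^esub> g \<in> carrier P"
proof -
  have "{w. f w \<oplus>\<^bsub>K\<^esub> g w \<noteq> \<zero>\<^bsub>K\<^esub>} \<subseteq> {w. f w \<noteq> \<zero>\<^bsub>K\<^esub>} \<union> {w. g w \<noteq> \<zero>\<^bsub>K\<^esub>}"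
    by auto
  then have "finite {w. f w \<oplus>\<^bsub>K\<^esub> g w \<noteq> \<zero>\<^bsub>K\<^esub>}"
    using assms by (auto simp: path_space_carrier intro: finite_subset)
  moreover have "pp w" if "f w \<oplus>\<^bsub>K\<^esub> g w \<noteq> \<zero>\<^bsub>K\<^esub>" for w
    using that assms by (cases "f w = \<zero>\<^bsub>K\<^esub>") (auto simp: path_space_carrier)
  ultimately show ?thesis
    using assms by (simp add: path_space_carrier)
qed

lemma path_space_smult_closed:
  assumes "c \<in> carrier K" "f \<in> carrier P"
  shows "c \<odot>\<^bsub>P\<^esub> f \<in> carrier P"
proof -
  have nz: "f w \<noteq> \<zero>\<^bsub>K\<^esub>" if "c \<otimes>\<^bsub>K\<^esub> f w \<noteq> \<zero>\<^bsub>K\<^esub>" for w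
    using that assms by auto
  then have "{w. c \<otimes>\<^bsub>K\<^esub> f w \<noteq> \<zero>\<^bsub>K\<^esub>} \<subseteq> {w. f w \<noteq> \<zero>\<^bsub>K\<^esub>}"
    by auto
  then have "finite {w. c \<otimes>\<^bsub>K\<^esub> f w \<noteq> \<zero>\<^bsub>K\<^esub>}"
    using assms by (auto simp: path_space_carrier intro: finite_subset)
  then show ?thesis
    using assms nz by (auto simp: path_space_carrier)
qed

lemma path_space_module: "module K P"
proof (rule moduleI)
  note c = path_space_apply
  show "cring K"
    by (rule K.is_cring)
  show "abelian_group P"
  proof (rule abelian_groupI)
    show "\<exists>g\<in>carrier P. g \<oplus>\<^bsub>P\<^esub> f = \<zero>\<^bsub>P\<^esub>" if f: "f \<in> carrier P" for f
    proof (rule bexI[of _ "(\<ominus>\<^bsub>K\<^esub> \<one>\<^bsub>K\<^esub>) \<odot>\<^bsub>P\<^esub> f"])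
      show "(\<ominus>\<^bsub>K\<^esub> \<one>\<^bsub>K\<^esub>) \<odot>\<^bsub>P\<^esub> f \<oplus>\<^bsub>P\<^esub> f = \<zero>\<^bsub>P\<^esub>"
        by (simp add: c[OF f] K.l_minus K.l_neg)
      show "(\<ominus>\<^bsub>K\<^esub> \<one>\<^bsub>K\<^esub>) \<odot>\<^bsub>P\<^esub> f \<in> carrier P"
        by (rule path_space_smult_closed[OF _ f]) simp
    qed
    show "f \<oplus>\<^bsub>P\<^esub> g \<oplus>\<^bsub>P\<^esub> h = f \<oplus>\<^bsub>P\<^esub> (g \<oplus>\<^bsub>P\<^esub> h)"
      if "f \<in> carrier P" "g \<in> carrier P" "h \<in> carrier P" for f g h
      by (simp add: that[THEN c] K.a_assoc)
    show "f \<oplus>\<^bsub>P\<^esub> g = g \<oplus>\<^bsub>P\<^esub> f" if "f \<in> carrier P" "g \<in> carrier P" for f g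
      by (simp add: that[THEN c] K.a_comm)
    show "\<zero>\<^bsub>P\<^esub> \<oplus>\<^bsub>P\<^esub> f = f" if "f \<in> carrier P" for f
      by (simp add: that[THEN c])
  qed (rule path_space_add_closed path_space_zero_closed; assumption?)+
  show "a \<odot>\<^bsub>P\<^esub> f \<in> carrier P" if "a \<in> carrier K" "f \<in> carrier P" for a f
    by (rule path_space_smult_closed[OF that])
  show "(a \<oplus>\<^bsub>K\<^esub> b) \<odot>\<^bsub>P\<^esub> f = a \<odot>\<^bsub>P\<^esub> f \<oplus>\<^bsub>P\<^esub> b \<odot>\<^bsub>P\<^esub> f"
    if "a \<in> carrier K" "b \<in> carrier K" "f \<in> carrier P" for a b f
    by (simp add: that(1,2) that(3)[THEN c] K.l_distr)
  show "a \<odot>\<^bsub>P\<^esub> (f \<oplus>\<^bsub>P\<^esub> g) = a \<odot>\<^bsub>P\<^esub> f \<oplus>\<^bsub>P\<^esub> a \<odot>\<^bsub>P\<^esub> g"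
    if "a \<in> carrier K" "f \<in> carrier P" "g \<in> carrier P" for a f g
    by (simp add: that(1) that(2,3)[THEN c] K.r_distr)
  show "(a \<otimes>\<^bsub>K\<^esub> b) \<odot>\<^bsub>P\<^esub> f = a \<odot>\<^bsub>P\<^esub> (b \<odot>\<^bsub>P\<^esub> f)"
    if "a \<in> carrier K" "b \<in> carrier K" "f \<in> carrier P" for a b f
    by (simp add: that(1,2) that(3)[THEN c] K.m_assoc)
  show "\<one>\<^bsub>K\<^esub> \<odot>\<^bsub>P\<^esub> f = f" if "f \<in> carrier P" for f
    by (simp add: that[THEN c])
qed

text \<open>A word in the support of the product is the concatenation of a word in the support of
  \<open>f\<close> and one in the support of \<open>g\<close>, so there are only finitely
  many.\<close>

lemma path_space_mult_closed:
  assumes "f \<in> carrier P" "g \<in> carrier P"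
  shows "f \<otimes>\<^bsub>P\<^esub> g \<in> carrier P"
proof -
  let ?F = "{w. f w \<noteq> \<zero>\<^bsub>K\<^esub>}" and ?G = "{w. g w \<noteq> \<zero>\<^bsub>K\<^esub>}"
  have closed: "(\<lambda>n. f (take n w) \<otimes>\<^bsub>K\<^esub> g (drop n w)) \<in> {1..<length w} \<rightarrow> carrier K" for w
    using assms by (auto intro: path_space_apply)
  have supp: "w \<in> (\<lambda>(u, v). u @ v) ` (?F \<times> ?G)" if w: "(f \<otimes>\<^bsub>P\<^esub> g) w \<noteq> \<zero>\<^bsub>K\<^esub>" for w
  proof -
    have "(\<Oplus>\<^bsub>K\<^esub> n \<in> {1..<length w}. f (take n w) \<otimes>\<^bsub>K\<^esub> g (drop n w)) \<noteq> \<zero>\<^bsub>K\<^esub>"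
      using w by (auto simp: path_space_mult split: if_splits)
    moreover have "(\<Oplus>\<^bsub>K\<^esub> n \<in> {1..<length w}. f (take n w) \<otimes>\<^bsub>K\<^esub> g (drop n w)) = \<zero>\<^bsub>K\<^esub>"
      if "\<And>n. f (take n w) \<otimes>\<^bsub>K\<^esub> g (drop n w) = \<zero>\<^bsub>K\<^esub>"
      using that by (rule K.add.finprod_one_eqI)
    ultimately obtain n where n: "f (take n w) \<otimes>\<^bsub>K\<^esub> g (drop n w) \<noteq> \<zero>\<^bsub>K\<^esub>"
      by metis
    have "f (take n w) \<noteq> \<zero>\<^bsub>K\<^esub>" "g (drop n w) \<noteq> \<zero>\<^bsub>K\<^esub>"
      using n path_space_apply[OF assms(1), of "take n w"] path_space_apply[OF assms(2), of "drop n w"] by auto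
    then have "take n w \<in> ?F" "drop n w \<in> ?G"
      by simp_all
    then show ?thesis
      by (intro image_eqI[of _ _ "(take n w, drop n w)"]) auto
  qed
  have "finite ((\<lambda>(u, v). u @ v) ` (?F \<times> ?G))"
    using assms by (auto simp: path_space_carrier)
  then have "finite {w. (f \<otimes>\<^bsub>P\<^esub> g) w \<noteq> \<zero>\<^bsub>K\<^esub>}"
    using supp by (blast intro: finite_subset)
  then show ?thesis
    using K.finsum_closed[OF closed] by (auto simp: path_space_carrier path_space_mult split: if_splits)
qed

lemma path_space_mult_add_left:
  assumes "f \<in> carrier P" "g \<in> carrier P" "h \<in> carrier P"
  shows "(f \<oplus>\<^bsub>P\<^esub> g) \<otimes>\<^bsub>P\<^esub> h = f \<otimes>\<^bsub>P\<^esub> h \<oplus>\<^bsub>P\<^esub> g \<otimes>\<^bsub>P\<^esub> h"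
proof
  fix w
  note c = assms[THEN path_space_apply]
  have "(\<Oplus>\<^bsub>K\<^esub> n \<in> {1..<length w}. (f (take n w) \<oplus>\<^bsub>K\<^esub> g (take n w)) \<otimes>\<^bsub>K\<^esub> h (drop n w)) =
      (\<Oplus>\<^bsub>K\<^esub> n \<in> {1..<length w}. f (take n w) \<otimes>\<^bsub>K\<^esub> h (drop n w) \<oplus>\<^bsub>K\<^esub> g (take n w) \<otimes>\<^bsub>K\<^esub> h (drop n w))"
    by (intro K.finsum_cong' refl K.l_distr) (simp_all add: c)
  also have "\<dots> = (\<Oplus>\<^bsub>K\<^esub> n \<in> {1..<length w}. f (take n w) \<otimes>\<^bsub>K\<^esub> h (drop n w)) \<oplus>\<^bsub>K\<^esub>
      (\<Oplus>\<^bsub>K\<^esub> n \<in> {1..<length w}. g (take n w) \<otimes>\<^bsub>K\<^esub> h (drop n w))"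
    by (rule K.finsum_addf) (simp_all add: c)
  finally show "((f \<oplus>\<^bsub>P\<^esub> g) \<otimes>\<^bsub>P\<^esub> h) w = (f \<otimes>\<^bsub>P\<^esub> h \<oplus>\<^bsub>P\<^esub> g \<otimes>\<^bsub>P\<^esub> h) w"
    by (simp add: path_space_mult)
qed

lemma path_space_mult_add_right:
  assumes "f \<in> carrier P" "g \<in> carrier P" "h \<in> carrier P"
  shows "h \<otimes>\<^bsub>P\<^esub> (f \<oplus>\<^bsub>P\<^esub> g) = h \<otimes>\<^bsub>P\<^esub> f \<oplus>\<^bsub>P\<^esub> h \<otimes>\<^bsub>P\<^esub> g"
proof
  fix w
  note c = assms[THEN path_space_apply]
  have "(\<Oplus>\<^bsub>K\<^esub> n \<in> {1..<length w}. h (take n w) \<otimes>\<^bsub>K\<^esub> (f (drop n w) \<oplus>\<^bsub>K\<^esub> g (drop n w))) =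
      (\<Oplus>\<^bsub>K\<^esub> n \<in> {1..<length w}. h (take n w) \<otimes>\<^bsub>K\<^esub> f (drop n w) \<oplus>\<^bsub>K\<^esub> h (take n w) \<otimes>\<^bsub>K\<^esub> g (drop n w))"
    by (intro K.finsum_cong' refl K.r_distr) (simp_all add: c)
  also have "\<dots> = (\<Oplus>\<^bsub>K\<^esub> n \<in> {1..<length w}. h (take n w) \<otimes>\<^bsub>K\<^esub> f (drop n w)) \<oplus>\<^bsub>K\<^esub>
      (\<Oplus>\<^bsub>K\<^esub> n \<in> {1..<length w}. h (take n w) \<otimes>\<^bsub>K\<^esub> g (drop n w))"
    by (rule K.finsum_addf) (simp_all add: c)
  finally show "(h \<otimes>\<^bsub>P\<^esub> (f \<oplus>\<^bsub>P\<^esub> g)) w = (h \<otimes>\<^bsub>P\<^esub> f \<oplus>\<^bsub>P\<^esub> h \<otimes>\<^bsub>P\<^esub> g) w"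
    by (simp add: path_space_mult)
qed

lemma path_space_smult_mult_left:
  assumes "c \<in> carrier K" "f \<in> carrier P" "g \<in> carrier P"
  shows "(c \<odot>\<^bsub>P\<^esub> f) \<otimes>\<^bsub>P\<^esub> g = c \<odot>\<^bsub>P\<^esub> (f \<otimes>\<^bsub>P\<^esub> g)"
proof
  fix w
  note c = assms(1) assms(2,3)[THEN path_space_apply]
  have "(\<Oplus>\<^bsub>K\<^esub> n \<in> {1..<length w}. (c \<otimes>\<^bsub>K\<^esub> f (take n w)) \<otimes>\<^bsub>K\<^esub> g (drop n w)) =
      (\<Oplus>\<^bsub>K\<^esub> n \<in> {1..<length w}. c \<otimes>\<^bsub>K\<^esub> (f (take n w) \<otimes>\<^bsub>K\<^esub> g (drop n w)))"
    by (intro K.finsum_cong' refl K.m_assoc) (simp_all add: c)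
  also have "\<dots> = c \<otimes>\<^bsub>K\<^esub> (\<Oplus>\<^bsub>K\<^esub> n \<in> {1..<length w}. f (take n w) \<otimes>\<^bsub>K\<^esub> g (drop n w))"
    by (rule K.finsum_rdistr[symmetric]) (simp_all add: c)
  finally show "((c \<odot>\<^bsub>P\<^esub> f) \<otimes>\<^bsub>P\<^esub> g) w = (c \<odot>\<^bsub>P\<^esub> (f \<otimes>\<^bsub>P\<^esub> g)) w"
    using c(1) by (simp add: path_space_mult)
qed

lemma path_space_smult_mult_right:
  assumes "c \<in> carrier K" "f \<in> carrier P" "g \<in> carrier P"
  shows "f \<otimes>\<^bsub>P\<^esub> (c \<odot>\<^bsub>P\<^esub> g) = c \<odot>\<^bsub>P\<^esub> (f \<otimes>\<^bsub>P\<^esub> g)"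
proof
  fix w
  note c = assms(1) assms(2,3)[THEN path_space_apply]
  have "(\<Oplus>\<^bsub>K\<^esub> n \<in> {1..<length w}. f (take n w) \<otimes>\<^bsub>K\<^esub> (c \<otimes>\<^bsub>K\<^esub> g (drop n w))) =
      (\<Oplus>\<^bsub>K\<^esub> n \<in> {1..<length w}. c \<otimes>\<^bsub>K\<^esub> (f (take n w) \<otimes>\<^bsub>K\<^esub> g (drop n w)))"
    by (intro K.finsum_cong' refl K.m_lcomm) (simp_all add: c)
  also have "\<dots> = c \<otimes>\<^bsub>K\<^esub> (\<Oplus>\<^bsub>K\<^esub> n \<in> {1..<length w}. f (take n w) \<otimes>\<^bsub>K\<^esub> g (drop n w))"
    by (rule K.finsum_rdistr[symmetric]) (simp_all add: c)
  finally show "(f \<otimes>\<^bsub>P\<^esub> (c \<odot>\<^bsub>P\<^esub> g)) w = (c \<odot>\<^bsub>P\<^esub> (f \<otimes>\<^bsub>P\<^esub> g)) w"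
    using c(1) by (simp add: path_space_mult)
qed

text \<open>Linear extension from basis vectors, by induction on a finite set that contains the
  support. Identities among vectors are from here on checked on single words.\<close>

lemma path_space_induct [consumes 1, case_names zero vec add]:
  assumes "f \<in> carrier P"
    and zero: "Q \<zero>\<^bsub>P\<^esub>"
    and vec: "\<And>c w. c \<in> carrier K \<Longrightarrow> pp w \<Longrightarrow> Q (c \<odot>\<^bsub>P\<^esub> pv w)"
    and add: "\<And>f g. f \<in> carrier P \<Longrightarrow> g \<in> carrier P \<Longrightarrow> Q f \<Longrightarrow> Q g \<Longrightarrow> Q (f \<oplus>\<^bsub>P\<^esub> g)"
  shows "Q f"
proof -
  have "Q f" if "finite S" "f \<in> carrier P" "{w. f w \<noteq> \<zero>\<^bsub>K\<^esub>} \<subseteq> S" for f S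
    using that
  proof (induct S arbitrary: f)
    case empty
    then have "f = \<zero>\<^bsub>P\<^esub>"
      by (simp add: fun_eq_iff)
    then show ?case
      using zero by simp
  next
    case (insert w S)
    let ?g = "f(w := \<zero>\<^bsub>K\<^esub>)"
    have sub: "{v. ?g v \<noteq> \<zero>\<^bsub>K\<^esub>} \<subseteq> {v. f v \<noteq> \<zero>\<^bsub>K\<^esub>}" "{v. ?g v \<noteq> \<zero>\<^bsub>K\<^esub>} \<subseteq> S"
      using insert.prems(2) by (auto split: if_splits)
    then have g: "?g \<in> carrier P"
      using insert.prems(1) by (auto simp: path_space_carrier intro: finite_subset)
    show ?case
    proof (cases "f w = \<zero>\<^bsub>K\<^esub>")
      case True
      then have "?g = f"
        by auto
      then show ?thesis
        using insert.hyps(3)[OF g sub(2)] by simp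
    next
      case False
      then have w: "pp w" "f w \<in> carrier K"
        using insert.prems(1) by (auto simp: path_space_carrier)
      have "f = ?g \<oplus>\<^bsub>P\<^esub> f w \<odot>\<^bsub>P\<^esub> pv w"
        using path_space_apply[OF insert.prems(1)] by (auto simp: path_vec_def fun_eq_iff)
      moreover have "Q (?g \<oplus>\<^bsub>P\<^esub> f w \<odot>\<^bsub>P\<^esub> pv w)"
        by (rule add[OF g path_space_smult_closed[OF w(2) path_vec_carrier[OF w(1)]]
            insert.hyps(3)[OF g sub(2)] vec[OF w(2,1)]])
      ultimately show ?thesis
        by (metis (no_types))
    qed
  qed
  then show ?thesis
    using assms(1) by (auto simp: path_space_carrier)
qed

text \<open>Only the cut at \<open>length u\<close> can contribute to the convolution, and it is an
  admissible cut because both words are nonempty. If the ends do not match, \<open>u @ v\<close> is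
  no pseudo-path and the guard in the product returns zero.\<close>

lemma path_vec_mult:
  assumes "pp u" "pp v"
  shows "pv u \<otimes>\<^bsub>P\<^esub> pv v = (if tgt u = src v then pv (u @ v) else \<zero>\<^bsub>P\<^esub>)"
proof
  fix w
  have ne: "u \<noteq> []" "v \<noteq> []"
    using assms pp_not_Nil by auto
  have term_eq: "pv u (take n w) \<otimes>\<^bsub>K\<^esub> pv v (drop n w) =
      (if length u = n then (if w = u @ v then \<one>\<^bsub>K\<^esub> else \<zero>\<^bsub>K\<^esub>) else \<zero>\<^bsub>K\<^esub>)"
    if "n \<in> {1..<length w}" for n
    using that append_take_drop_id[of n w] by (auto simp: path_vec_def)
  have "(\<Oplus>\<^bsub>K\<^esub> n \<in> {1..<length w}. pv u (take n w) \<otimes>\<^bsub>K\<^esub> pv v (drop n w)) =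
      (\<Oplus>\<^bsub>K\<^esub> n \<in> {1..<length w}. if length u = n then (if w = u @ v then \<one>\<^bsub>K\<^esub> else \<zero>\<^bsub>K\<^esub>) else \<zero>\<^bsub>K\<^esub>)"
    by (intro K.finsum_cong' refl term_eq) auto
  also have "\<dots> = (if w = u @ v then \<one>\<^bsub>K\<^esub> else \<zero>\<^bsub>K\<^esub>)"
  proof (cases "length u \<in> {1..<length w}")
    case True
    then show ?thesis
      using K.finsum_singleton[of "length u" "{1..<length w}" "\<lambda>_. if w = u @ v then \<one>\<^bsub>K\<^esub> else \<zero>\<^bsub>K\<^esub>"]
      by simp
  next
    case False
    then have "w \<noteq> u @ v"
      using ne by (auto simp: Suc_le_eq)
    then show ?thesis
      by simp
  qed
  finally show "(pv u \<otimes>\<^bsub>P\<^esub> pv v) w = (if tgt u = src v then pv (u @ v) else \<zero>\<^bsub>P\<^esub>) w"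
    using assms ne by (auto simp: path_space_mult path_vec_def pp_append)
qed

lemma path_space_zero_mult: "f \<in> carrier P \<Longrightarrow> \<zero>\<^bsub>P\<^esub> \<otimes>\<^bsub>P\<^esub> f = \<zero>\<^bsub>P\<^esub>"
  by (auto simp: path_space_mult fun_eq_iff path_space_apply)

lemma path_space_mult_zero: "f \<in> carrier P \<Longrightarrow> f \<otimes>\<^bsub>P\<^esub> \<zero>\<^bsub>P\<^esub> = \<zero>\<^bsub>P\<^esub>"
  by (auto simp: path_space_mult fun_eq_iff path_space_apply)

lemma path_vec_mult_assoc:
  assumes "pp u" "pp v" "pp w"
  shows "(pv u \<otimes>\<^bsub>P\<^esub> pv v) \<otimes>\<^bsub>P\<^esub> pv w = pv u \<otimes>\<^bsub>P\<^esub> (pv v \<otimes>\<^bsub>P\<^esub> pv w)"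
proof -
  have "u \<noteq> []" "v \<noteq> []" "w \<noteq> []"
    using assms pp_not_Nil by auto
  then show ?thesis
    using assms path_space_zero_mult path_space_mult_zero
    by (simp add: path_vec_mult pp_append del: path_space_simps)
qed

text \<open>Associativity is clear for words. It extends by linearity to one factor after the other,
  which avoids re-indexing a double sum of cuts.\<close>

lemma path_space_mult_assoc:
  assumes "f \<in> carrier P" "g \<in> carrier P" "h \<in> carrier P"
  shows "(f \<otimes>\<^bsub>P\<^esub> g) \<otimes>\<^bsub>P\<^esub> h = f \<otimes>\<^bsub>P\<^esub> (g \<otimes>\<^bsub>P\<^esub> h)"
proof -
  note rules = path_space_zero_mult path_space_mult_zero path_space_mult_closed path_space_smult_closed
    path_space_smult_mult_left path_space_smult_mult_right path_space_mult_add_left path_space_mult_add_right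
    path_space_zero_closed path_space_add_closed
  have 1: "(pv u \<otimes>\<^bsub>P\<^esub> pv v) \<otimes>\<^bsub>P\<^esub> h = pv u \<otimes>\<^bsub>P\<^esub> (pv v \<otimes>\<^bsub>P\<^esub> h)" if "pp u" "pp v" for u v
    using assms(3) by (induct rule: path_space_induct)
      (simp_all add: that rules path_vec_mult_assoc del: path_space_simps)
  have 2: "(pv u \<otimes>\<^bsub>P\<^esub> g) \<otimes>\<^bsub>P\<^esub> h = pv u \<otimes>\<^bsub>P\<^esub> (g \<otimes>\<^bsub>P\<^esub> h)" if "pp u" for u
    using assms(2) by (induct rule: path_space_induct)
      (simp_all add: that rules assms(3) 1 del: path_space_simps)
  show ?thesis
    using assms(1) by (induct rule: path_space_induct)
      (simp_all add: rules assms(2,3) 2 del: path_space_simps)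
qed

lemma path_space_nonunital_algebra: "nonunital_algebra K P"
proof -
  interpret module K P
    by (rule path_space_module)
  show ?thesis
    using path_space_mult_closed path_space_mult_assoc path_space_mult_add_left path_space_mult_add_right
      path_space_smult_mult_left path_space_smult_mult_right
    by unfold_locales (simp_all del: path_space_simps)
qed

end

sublocale pseudo_path_data \<subseteq> P: nonunital_algebra K "path_space K \<Delta> \<A>"
  by (rule path_space_nonunital_algebra)

section \<open>The pseudo path algebra\<close>

context pseudo_path_data
begin

abbreviation "N \<equiv> pse_null K \<Delta> \<A>"

text \<open>The common shape of the three linearity relators. The other three, which identify two
  words, have the shape \<open>rel2\<close>.\<close>

definition rel3 :: "'k \<Rightarrow> ('v, 'e, 'b) letter list \<Rightarrow> ('v, 'e, 'b) letter list \<Rightarrow> ('v, 'e, 'b) letter list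
    \<Rightarrow> ('v, 'e, 'b) letter list \<Rightarrow> 'k"
  where "rel3 c w1 w2 w3 = pv w1 \<ominus>\<^bsub>P\<^esub> (c \<odot>\<^bsub>P\<^esub> pv w2 \<oplus>\<^bsub>P\<^esub> pv w3)"

definition rel2 :: "('v, 'e, 'b) letter list \<Rightarrow> ('v, 'e, 'b) letter list \<Rightarrow> ('v, 'e, 'b) letter list \<Rightarrow> 'k"
  where "rel2 w1 w2 = pv w1 \<ominus>\<^bsub>P\<^esub> pv w2"

definition parallel :: "('v, 'e, 'b) letter list \<Rightarrow> ('v, 'e, 'b) letter list \<Rightarrow> bool"
  where "parallel w w' \<longleftrightarrow> pp w \<and> pp w' \<and> src w = src w' \<and> tgt w = tgt w'"

text \<open>Multiplication by a word on either side sends \<open>r\<close> into \<open>X\<close> or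
  to zero, the latter when the words do not compose. A set of such vectors spans an ideal, not just
  a subspace.\<close>

definition stable :: "(('v, 'e, 'b) letter list \<Rightarrow> 'k) set \<Rightarrow> (('v, 'e, 'b) letter list \<Rightarrow> 'k) \<Rightarrow> bool"
  where "stable X r \<longleftrightarrow> r \<in> carrier P \<and>
    (\<forall>y. pp y \<longrightarrow> r \<otimes>\<^bsub>P\<^esub> pv y \<in> insert \<zero>\<^bsub>P\<^esub> X \<and> pv y \<otimes>\<^bsub>P\<^esub> r \<in> insert \<zero>\<^bsub>P\<^esub> X)"

lemma parallelD: "parallel w w' \<Longrightarrow> pp w \<and> pp w' \<and> src w = src w' \<and> tgt w = tgt w'"
  by (simp add: parallel_def)

lemma parallel_subst:
  "pp (u @ x @ v) \<Longrightarrow> x \<noteq> [] \<Longrightarrow> pp x' \<Longrightarrow> src x' = src x \<Longrightarrow> tgt x' = tgt x \<Longrightarrow>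
    parallel (u @ x' @ v) (u @ x @ v)"
  using pp_subst[of u x v x'] by (simp add: parallel_def)

lemma pp_factor:
  assumes "pp (u @ x @ v)" "x \<noteq> []"
  shows "pp x"
  using assms by (cases "u = []"; cases "v = []") (auto simp: pp_append)

lemma rel3_carrier:
  "c \<in> carrier K \<Longrightarrow> parallel w1 w2 \<Longrightarrow> parallel w3 w2 \<Longrightarrow> rel3 c w1 w2 w3 \<in> carrier P"
  unfolding rel3_def by (auto simp: parallel_def simp del: path_space_simps)

lemma rel2_carrier: "parallel w1 w2 \<Longrightarrow> rel2 w1 w2 \<in> carrier P"
  unfolding rel2_def by (auto simp: parallel_def simp del: path_space_simps)

lemma rel3_mult_right:
  assumes "c \<in> carrier K" "parallel w1 w2" "parallel w3 w2" "pp y"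
  shows "rel3 c w1 w2 w3 \<otimes>\<^bsub>P\<^esub> pv y = (if tgt w2 = src y then rel3 c (w1 @ y) (w2 @ y) (w3 @ y) else \<zero>\<^bsub>P\<^esub>)"
proof -
  note p = parallelD[OF assms(2)] parallelD[OF assms(3)]
  show ?thesis
    unfolding rel3_def using p assms(1,4)
    by (simp add: P.mult_diff_left P.mult_add_left P.smult_mult_left path_vec_mult P.minus_zero a_minus_def[of P "\<zero>\<^bsub>P\<^esub>"]
        del: path_space_simps)
qed

lemma rel3_mult_left:
  assumes "c \<in> carrier K" "parallel w1 w2" "parallel w3 w2" "pp y"
  shows "pv y \<otimes>\<^bsub>P\<^esub> rel3 c w1 w2 w3 = (if tgt y = src w2 then rel3 c (y @ w1) (y @ w2) (y @ w3) else \<zero>\<^bsub>P\<^esub>)"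
proof -
  note p = parallelD[OF assms(2)] parallelD[OF assms(3)]
  show ?thesis
    unfolding rel3_def using p assms(1,4)
    by (simp add: P.mult_diff_right P.mult_add_right P.smult_mult_right path_vec_mult P.minus_zero a_minus_def[of P "\<zero>\<^bsub>P\<^esub>"]
        del: path_space_simps)
qed

lemma rel2_mult_right:
  assumes "parallel w1 w2" "pp y"
  shows "rel2 w1 w2 \<otimes>\<^bsub>P\<^esub> pv y = (if tgt w2 = src y then rel2 (w1 @ y) (w2 @ y) else \<zero>\<^bsub>P\<^esub>)"
  using parallelD[OF assms(1)] assms(2) unfolding rel2_def
  by (simp add: P.mult_diff_left path_vec_mult P.minus_zero a_minus_def[of P "\<zero>\<^bsub>P\<^esub>"] del: path_space_simps)

lemma rel2_mult_left:
  assumes "parallel w1 w2" "pp y"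
  shows "pv y \<otimes>\<^bsub>P\<^esub> rel2 w1 w2 = (if tgt y = src w2 then rel2 (y @ w1) (y @ w2) else \<zero>\<^bsub>P\<^esub>)"
  using parallelD[OF assms(1)] assms(2) unfolding rel2_def
  by (simp add: P.mult_diff_right path_vec_mult P.minus_zero a_minus_def[of P "\<zero>\<^bsub>P\<^esub>"] del: path_space_simps)

lemma stable_rel3:
  assumes "c \<in> carrier K" "parallel w1 w2" "parallel w3 w2"
    and right: "\<And>y. pp (w2 @ y) \<Longrightarrow> pp (w3 @ y) \<Longrightarrow> rel3 c (w1 @ y) (w2 @ y) (w3 @ y) \<in> X"
    and left: "\<And>y. pp (y @ w2) \<Longrightarrow> pp (y @ w3) \<Longrightarrow> rel3 c (y @ w1) (y @ w2) (y @ w3) \<in> X"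
  shows "stable X (rel3 c w1 w2 w3)"
proof -
  have ne: "w2 \<noteq> []" "w3 \<noteq> []"
    using parallelD[OF assms(2)] parallelD[OF assms(3)] pp_not_Nil by auto
  show ?thesis
    unfolding stable_def
  proof (intro conjI allI impI)
    show "rel3 c w1 w2 w3 \<in> carrier P"
      by (rule rel3_carrier[OF assms(1-3)])
    fix y assume y: "pp y"
    show "rel3 c w1 w2 w3 \<otimes>\<^bsub>P\<^esub> pv y \<in> insert \<zero>\<^bsub>P\<^esub> X"
      using right[of y] y parallelD[OF assms(2)] parallelD[OF assms(3)] ne pp_not_Nil[OF y]
      by (simp add: rel3_mult_right[OF assms(1-3)] pp_append)
    show "pv y \<otimes>\<^bsub>P\<^esub> rel3 c w1 w2 w3 \<in> insert \<zero>\<^bsub>P\<^esub> X"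
      using left[of y] y parallelD[OF assms(2)] parallelD[OF assms(3)] ne pp_not_Nil[OF y]
      by (simp add: rel3_mult_left[OF assms(1-3)] pp_append)
  qed
qed

lemma stable_rel2:
  assumes "parallel w1 w2"
    and right: "\<And>y. pp (w1 @ y) \<Longrightarrow> pp (w2 @ y) \<Longrightarrow> rel2 (w1 @ y) (w2 @ y) \<in> X"
    and left: "\<And>y. pp (y @ w1) \<Longrightarrow> pp (y @ w2) \<Longrightarrow> rel2 (y @ w1) (y @ w2) \<in> X"
  shows "stable X (rel2 w1 w2)"
proof -
  have ne: "w1 \<noteq> []" "w2 \<noteq> []"
    using parallelD[OF assms(1)] pp_not_Nil by auto
  show ?thesis
    unfolding stable_def
  proof (intro conjI allI impI)
    show "rel2 w1 w2 \<in> carrier P"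
      by (rule rel2_carrier[OF assms(1)])
    fix y assume y: "pp y"
    show "rel2 w1 w2 \<otimes>\<^bsub>P\<^esub> pv y \<in> insert \<zero>\<^bsub>P\<^esub> X"
      using right[of y] y parallelD[OF assms(1)] ne pp_not_Nil[OF y]
      by (simp add: rel2_mult_right[OF assms(1)] pp_append)
    show "pv y \<otimes>\<^bsub>P\<^esub> rel2 w1 w2 \<in> insert \<zero>\<^bsub>P\<^esub> X"
      using left[of y] y parallelD[OF assms(1)] ne pp_not_Nil[OF y]
      by (simp add: rel2_mult_left[OF assms(1)] pp_append)
  qed
qed

lemma pp_elt: "pp [Elt i a] \<longleftrightarrow> i \<in> verts \<Delta> \<and> a \<in> carrier (\<A> i)"
  by (simp add: pp_single)

lemma pp_arr: "pp [Arr a \<beta> b] \<longleftrightarrow>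
    \<beta> \<in> arcs \<Delta> \<and> a \<in> carrier (\<A> (tail \<Delta> \<beta>)) \<and> b \<in> carrier (\<A> (head \<Delta> \<beta>))"
  by (simp add: pp_single)

lemma vertex_lincomb:
  assumes "i \<in> verts \<Delta>" "c \<in> carrier K" "a \<in> carrier (\<A> i)" "a' \<in> carrier (\<A> i)"
  shows "c \<odot>\<^bsub>\<A> i\<^esub> a \<oplus>\<^bsub>\<A> i\<^esub> a' \<in> carrier (\<A> i)"
proof -
  interpret k_algebra K "\<A> i"
    by (rule vertex_algebra[OF assms(1)])
  show ?thesis
    using assms by simp
qed

lemma vertex_mult:
  assumes "i \<in> verts \<Delta>" "a \<in> carrier (\<A> i)" "b \<in> carrier (\<A> i)"
  shows "a \<otimes>\<^bsub>\<A> i\<^esub> b \<in> carrier (\<A> i)"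
proof -
  interpret k_algebra K "\<A> i"
    by (rule vertex_algebra[OF assms(1)])
  show ?thesis
    using assms by simp
qed

lemma vertex_one:
  assumes "i \<in> verts \<Delta>"
  shows "\<one>\<^bsub>\<A> i\<^esub> \<in> carrier (\<A> i)"
    and "a \<in> carrier (\<A> i) \<Longrightarrow> \<one>\<^bsub>\<A> i\<^esub> \<otimes>\<^bsub>\<A> i\<^esub> a = a"
    and "a \<in> carrier (\<A> i) \<Longrightarrow> a \<otimes>\<^bsub>\<A> i\<^esub> \<one>\<^bsub>\<A> i\<^esub> = a"
proof -
  interpret k_algebra K "\<A> i"
    by (rule vertex_algebra[OF assms(1)])
  show "\<one>\<^bsub>\<A> i\<^esub> \<in> carrier (\<A> i)" "a \<in> carrier (\<A> i) \<Longrightarrow> \<one>\<^bsub>\<A> i\<^esub> \<otimes>\<^bsub>\<A> i\<^esub> a = a"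
    "a \<in> carrier (\<A> i) \<Longrightarrow> a \<otimes>\<^bsub>\<A> i\<^esub> \<one>\<^bsub>\<A> i\<^esub> = a"
    by simp_all
qed

section \<open>The relators and the ideal that they span\<close>

text \<open>The relators come in two shapes: linearity in one letter, and equality of two words.\<close>

inductive linear_letters ::
  "'k \<Rightarrow> ('v, 'e, 'b) letter \<Rightarrow> ('v, 'e, 'b) letter \<Rightarrow> ('v, 'e, 'b) letter \<Rightarrow> bool" for c where
  "is_letter \<Delta> \<A> (Elt i a) \<Longrightarrow> is_letter \<Delta> \<A> (Elt i a') \<Longrightarrow>
    linear_letters c (Elt i (c \<odot>\<^bsub>\<A> i\<^esub> a \<oplus>\<^bsub>\<A> i\<^esub> a')) (Elt i a) (Elt i a')"
| "is_letter \<Delta> \<A> (Arr a \<beta> b) \<Longrightarrow> is_letter \<Delta> \<A> (Arr a' \<beta> b) \<Longrightarrow>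
    linear_letters c (Arr (c \<odot>\<^bsub>\<A> (tail \<Delta> \<beta>)\<^esub> a \<oplus>\<^bsub>\<A> (tail \<Delta> \<beta>)\<^esub> a') \<beta> b) (Arr a \<beta> b) (Arr a' \<beta> b)"
| "is_letter \<Delta> \<A> (Arr a \<beta> b) \<Longrightarrow> is_letter \<Delta> \<A> (Arr a \<beta> b') \<Longrightarrow>
    linear_letters c (Arr a \<beta> (c \<odot>\<^bsub>\<A> (head \<Delta> \<beta>)\<^esub> b \<oplus>\<^bsub>\<A> (head \<Delta> \<beta>)\<^esub> b')) (Arr a \<beta> b) (Arr a \<beta> b')"

inductive equal_words :: "('v, 'e, 'b) letter list \<Rightarrow> ('v, 'e, 'b) letter list \<Rightarrow> bool" where
  "is_letter \<Delta> \<A> (Elt i a) \<Longrightarrow> is_letter \<Delta> \<A> (Elt i b) \<Longrightarrow>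
    equal_words [Elt i a, Elt i b] [Elt i (a \<otimes>\<^bsub>\<A> i\<^esub> b)]"
| "is_letter \<Delta> \<A> (Arr a \<beta> b) \<Longrightarrow>
    equal_words [Elt (tail \<Delta> \<beta>) \<one>\<^bsub>\<A> (tail \<Delta> \<beta>)\<^esub>, Arr a \<beta> b] [Arr a \<beta> b]"
| "is_letter \<Delta> \<A> (Arr a \<beta> b) \<Longrightarrow>
    equal_words [Arr a \<beta> b, Elt (head \<Delta> \<beta>) \<one>\<^bsub>\<A> (head \<Delta> \<beta>)\<^esub>] [Arr a \<beta> b]"

lemma linear_letters_parallel:
  assumes "linear_letters c l1 l2 l3" "c \<in> carrier K"
  shows "parallel [l1] [l2]" "parallel [l3] [l2]"
  using assms
  by (cases; simp add: parallel_def pp_single vertex_lincomb tail_vert head_vert)+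

lemma equal_words_parallel: "equal_words w1 w2 \<Longrightarrow> parallel w1 w2"
  by (cases rule: equal_words.cases)
    (auto simp: parallel_def pp_single pp_Cons vertex_mult vertex_one(1) tail_vert head_vert)

lemma parallel_context:
  assumes "parallel x y" "pp (u @ x @ v) \<or> pp (u @ y @ v)"
  shows "parallel (u @ x @ v) (u @ y @ v)"
  using assms(2)
proof
  assume "pp (u @ y @ v)"
  then show ?thesis
    using parallelD[OF assms(1)] pp_not_Nil by (intro parallel_subst) auto
next
  assume "pp (u @ x @ v)"
  then have "parallel (u @ y @ v) (u @ x @ v)"
    using parallelD[OF assms(1)] pp_not_Nil by (intro parallel_subst) auto
  then show ?thesis
    by (auto simp: parallel_def)
qed

lemma relator_cases:
  assumes "r \<in> pse_relators K \<Delta> \<A>"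
  obtains (linear) c u v l1 l2 l3 where "c \<in> carrier K" "linear_letters c l1 l2 l3" "pp (u @ [l2] @ v)"
      "r = rel3 c (u @ [l1] @ v) (u @ [l2] @ v) (u @ [l3] @ v)"
    | (equal) u v w1 w2 where "equal_words w1 w2" "pp (u @ w2 @ v)" "r = rel2 (u @ w1 @ v) (u @ w2 @ v)"
  using assms
proof cases
  case (linear_elt c u i a v a')
  have "is_letter \<Delta> \<A> (Elt i a)" "is_letter \<Delta> \<A> (Elt i a')"
    using pp_factor[OF linear_elt(3)] pp_factor[OF linear_elt(4)] by (simp_all only: pp_single not_Cons_self2 not_False_eq_True)
  then show thesis
    using linear[OF linear_elt(2) linear_letters.intros(1) linear_elt(3)] linear_elt(1) by (simp only: rel3_def)
next
  case (linear_arr_left c u a \<beta> b v a')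
  have "is_letter \<Delta> \<A> (Arr a \<beta> b)" "is_letter \<Delta> \<A> (Arr a' \<beta> b)"
    using pp_factor[OF linear_arr_left(3)] pp_factor[OF linear_arr_left(4)] by (simp_all only: pp_single not_Cons_self2 not_False_eq_True)
  then show thesis
    using linear[OF linear_arr_left(2) linear_letters.intros(2) linear_arr_left(3)] linear_arr_left(1)
    by (simp only: rel3_def)
next
  case (linear_arr_right c u a \<beta> b v b')
  have "is_letter \<Delta> \<A> (Arr a \<beta> b)" "is_letter \<Delta> \<A> (Arr a \<beta> b')"
    using pp_factor[OF linear_arr_right(3)] pp_factor[OF linear_arr_right(4)] by (simp_all only: pp_single not_Cons_self2 not_False_eq_True)
  then show thesis
    using linear[OF linear_arr_right(2) linear_letters.intros(3) linear_arr_right(3)] linear_arr_right(1)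
    by (simp only: rel3_def)
next
  case (mult_elt u i a b v)
  have "equal_words [Elt i a, Elt i b] [Elt i (a \<otimes>\<^bsub>\<A> i\<^esub> b)]"
    using pp_factor[OF mult_elt(2)] by (intro equal_words.intros) (auto simp: pp_Cons pp_elt)
  \<comment> \<open>The rule \<open>mult_elt\<close> assumes composability of the longer word,
    whereas the case \<open>equal\<close> is stated with the shorter one. The two conditions are
    equivalent because the words are parallel.\<close>
  then show thesis
    using equal parallelD[OF parallel_context[OF equal_words_parallel disjI1[OF mult_elt(2)]]] mult_elt(1)
    unfolding rel2_def by blast
next
  case (one_left u a \<beta> b v)
  have "equal_words [Elt (tail \<Delta> \<beta>) \<one>\<^bsub>\<A> (tail \<Delta> \<beta>)\<^esub>, Arr a \<beta> b] [Arr a \<beta> b]"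
    using pp_factor[OF one_left(2)] by (intro equal_words.intros) (simp add: pp_single)
  then show thesis
    using equal one_left unfolding rel2_def by blast
next
  case (one_right u a \<beta> b v)
  have "equal_words [Arr a \<beta> b, Elt (head \<Delta> \<beta>) \<one>\<^bsub>\<A> (head \<Delta> \<beta>)\<^esub>] [Arr a \<beta> b]"
    using pp_factor[OF one_right(2)] by (intro equal_words.intros) (simp add: pp_single)
  then show thesis
    using equal one_right unfolding rel2_def by blast
qed

lemma linear_relator:
  assumes "c \<in> carrier K" "linear_letters c l1 l2 l3" "pp (u @ [l2] @ v)"
  shows "rel3 c (u @ [l1] @ v) (u @ [l2] @ v) (u @ [l3] @ v) \<in> pse_relators K \<Delta> \<A>"
proof -
  have "pp (u @ [l3] @ v)"
    using parallelD[OF parallel_context[OF linear_letters_parallel(2)[OF assms(2,1)] disjI2[OF assms(3)]]] by blast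
  with assms(2,3) show ?thesis
    unfolding rel3_def using assms(1) by cases (auto intro: pse_relators.intros simp del: append_Cons append_Nil path_space_simps)
qed

lemma equal_relator:
  assumes "equal_words w1 w2" "pp (u @ w2 @ v)"
  shows "rel2 (u @ w1 @ v) (u @ w2 @ v) \<in> pse_relators K \<Delta> \<A>"
proof -
  have "pp (u @ w1 @ v)"
    using parallelD[OF parallel_context[OF equal_words_parallel[OF assms(1)] disjI2[OF assms(2)]]] by blast
  with assms show ?thesis
    unfolding rel2_def by cases (auto intro: pse_relators.intros simp del: append_Cons append_Nil path_space_simps)
qed

text \<open>Every relator lives in an arbitrary context of words on both sides. Multiplying by a
  word merely lengthens that context.\<close>

lemma relator_stable:
  assumes "r \<in> pse_relators K \<Delta> \<A>"
  shows "stable (pse_relators K \<Delta> \<A>) r"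
  using assms
proof (cases rule: relator_cases)
  case (linear c u v l1 l2 l3)
  note par = linear_letters_parallel[OF linear(2,1), THEN parallel_context, OF disjI2, OF linear(3)]
  show ?thesis
    unfolding linear(4)
  proof (rule stable_rel3[OF linear(1) par])
    show "rel3 c ((u @ [l1] @ v) @ y) ((u @ [l2] @ v) @ y) ((u @ [l3] @ v) @ y) \<in> pse_relators K \<Delta> \<A>"
      if "pp ((u @ [l2] @ v) @ y)" for y
      using linear_relator[OF linear(1,2), of u "v @ y"] that by simp
    show "rel3 c (y @ u @ [l1] @ v) (y @ u @ [l2] @ v) (y @ u @ [l3] @ v) \<in> pse_relators K \<Delta> \<A>"
      if "pp (y @ u @ [l2] @ v)" for y
      using linear_relator[OF linear(1,2), of "y @ u" v] that by simp
  qed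
next
  case (equal u v w1 w2)
  note par = parallel_context[OF equal_words_parallel[OF equal(1)] disjI2[OF equal(2)]]
  show ?thesis
    unfolding equal(3)
  proof (rule stable_rel2[OF par])
    show "rel2 ((u @ w1 @ v) @ y) ((u @ w2 @ v) @ y) \<in> pse_relators K \<Delta> \<A>"
      if "pp ((u @ w2 @ v) @ y)" for y
      using equal_relator[OF equal(1), of u "v @ y"] that by simp
    show "rel2 (y @ u @ w1 @ v) (y @ u @ w2 @ v) \<in> pse_relators K \<Delta> \<A>"
      if "pp (y @ u @ w2 @ v)" for y
      using equal_relator[OF equal(1), of "y @ u" v] that by simp
  qed
qed

lemma pse_null_least: "submodule S K P \<Longrightarrow> pse_relators K \<Delta> \<A> \<subseteq> S \<Longrightarrow> N \<subseteq> S"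
  by (auto simp: pse_null_def)

lemma relators_in_null: "pse_relators K \<Delta> \<A> \<subseteq> N"
  by (auto simp: pse_null_def)

lemma relators_in_carrier: "pse_relators K \<Delta> \<A> \<subseteq> carrier P"
  using relator_stable by (auto simp: stable_def)

lemma pse_null_submodule: "submodule N K P"
proof (rule P.submoduleI)
  have top: "carrier P \<in> {S. submodule S K P \<and> pse_relators K \<Delta> \<A> \<subseteq> S}"
    using relators_in_carrier P.carrier_is_submodule by simp
  then show "N \<subseteq> carrier P"
    unfolding pse_null_def by (rule Inter_lower)
  have E: "\<zero>\<^bsub>P\<^esub> \<in> S" "\<And>x. x \<in> S \<Longrightarrow> \<ominus>\<^bsub>P\<^esub> x \<in> S" "\<And>x y. x \<in> S \<Longrightarrow> y \<in> S \<Longrightarrow> x \<oplus>\<^bsub>P\<^esub> y \<in> S"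
    "\<And>c x. c \<in> carrier K \<Longrightarrow> x \<in> S \<Longrightarrow> c \<odot>\<^bsub>P\<^esub> x \<in> S" if S: "submodule S K P" for S
    using P.submoduleE[OF S] additive_subgroup.zero_closed[OF additive_subgroup.intro[OF submodule.axioms(1)[OF S]]]
    by (auto simp del: path_space_simps)
  show "\<zero>\<^bsub>P\<^esub> \<in> N" "\<And>x. x \<in> N \<Longrightarrow> \<ominus>\<^bsub>P\<^esub> x \<in> N" "\<And>x y. x \<in> N \<Longrightarrow> y \<in> N \<Longrightarrow> x \<oplus>\<^bsub>P\<^esub> y \<in> N"
    "\<And>c x. c \<in> carrier K \<Longrightarrow> x \<in> N \<Longrightarrow> c \<odot>\<^bsub>P\<^esub> x \<in> N"
    unfolding pse_null_def using E by (blast+)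
qed

text \<open>\<open>N\<close> is defined as the smallest subspace containing the relators, so
  absorption has to be proved. The vectors whose products with all others lie in \<open>N\<close>
  form a subspace. It contains the relators by stability, hence it contains
  \<open>N\<close>.\<close>

lemma pse_null_alg_ideal: "P.alg_ideal N"
  unfolding P.alg_ideal_def
proof (intro conjI pse_null_submodule)
  note N = P.submoduleE[OF pse_null_submodule]
  have N0: "\<zero>\<^bsub>P\<^esub> \<in> N"
    by (rule additive_subgroup.zero_closed[OF additive_subgroup.intro[OF submodule.axioms(1)[OF pse_null_submodule]]])
  define S where "S = {r \<in> carrier P. \<forall>y\<in>carrier P. y \<otimes>\<^bsub>P\<^esub> r \<in> N \<and> r \<otimes>\<^bsub>P\<^esub> y \<in> N}"
  have "submodule S K P"
  proof (rule P.submoduleI)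
    show "S \<subseteq> carrier P"
      by (auto simp: S_def)
    show "\<zero>\<^bsub>P\<^esub> \<in> S"
      using N0 by (simp add: S_def del: path_space_simps)
    show "\<ominus>\<^bsub>P\<^esub> x \<in> S" if "x \<in> S" for x
      using that N(3) by (simp add: S_def P.mult_minus_left P.mult_minus_right del: path_space_simps)
    show "x \<oplus>\<^bsub>P\<^esub> y \<in> S" if "x \<in> S" "y \<in> S" for x y
      using that N(5) by (simp add: S_def P.mult_add_left P.mult_add_right del: path_space_simps)
    show "c \<odot>\<^bsub>P\<^esub> x \<in> S" if "c \<in> carrier K" "x \<in> S" for c x
      using that N(4) by (simp add: S_def P.smult_mult_left P.smult_mult_right del: path_space_simps)
  qed
  moreover have "pse_relators K \<Delta> \<A> \<subseteq> S"
  proof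
    fix r assume "r \<in> pse_relators K \<Delta> \<A>"
    then have st: "stable (pse_relators K \<Delta> \<A>) r"
      by (rule relator_stable)
    have ins: "insert \<zero>\<^bsub>P\<^esub> (pse_relators K \<Delta> \<A>) \<subseteq> N"
      using relators_in_null N0 by (rule insert_subsetI[rotated])
    have r: "r \<in> carrier P" "\<And>y. pp y \<Longrightarrow> r \<otimes>\<^bsub>P\<^esub> pv y \<in> N" "\<And>y. pp y \<Longrightarrow> pv y \<otimes>\<^bsub>P\<^esub> r \<in> N"
      using st ins unfolding stable_def by (simp_all only: subset_iff)
    have "y \<otimes>\<^bsub>P\<^esub> r \<in> N \<and> r \<otimes>\<^bsub>P\<^esub> y \<in> N" if "y \<in> carrier P" for y
      using that
    proof (induct rule: path_space_induct)
      case zero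
      then show ?case
        using r(1) N0 by (simp del: path_space_simps)
    next
      case (vec c w)
      then show ?case
        using r N(4) by (simp add: P.smult_mult_left P.smult_mult_right del: path_space_simps)
    next
      case (add f g)
      then show ?case
        using r(1) N(5) by (simp add: P.mult_add_left P.mult_add_right del: path_space_simps)
    qed
    then show "r \<in> S"
      using r(1) by (simp add: S_def)
  qed
  ultimately have "N \<subseteq> S"
    by (rule pse_null_least)
  then show "\<forall>x\<in>carrier P. \<forall>y\<in>N. x \<otimes>\<^bsub>P\<^esub> y \<in> N \<and> y \<otimes>\<^bsub>P\<^esub> x \<in> N"
    by (auto simp: S_def)
qed

section \<open>The identity of the pseudo path algebra\<close>

lemma path_one: "\<one>\<^bsub>P\<^esub> = (\<lambda>w. if \<exists>i \<in> verts \<Delta>. w = [Elt i \<one>\<^bsub>\<A> i\<^esub>] then \<one>\<^bsub>K\<^esub> else \<zero>\<^bsub>K\<^esub>)"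
  by (simp add: path_space_def)

lemma path_one_carrier: "\<one>\<^bsub>P\<^esub> \<in> carrier P"
proof -
  have "{w. \<one>\<^bsub>P\<^esub> w \<noteq> \<zero>\<^bsub>K\<^esub>} \<subseteq> (\<lambda>i. [Elt i \<one>\<^bsub>\<A> i\<^esub>]) ` verts \<Delta>"
    by (auto simp: path_one)
  then have "finite {w. \<one>\<^bsub>P\<^esub> w \<noteq> \<zero>\<^bsub>K\<^esub>}"
    using finite_verts by (blast intro: finite_subset)
  then show ?thesis
    using vertex_one(1) by (auto simp: path_space_carrier path_one pp_elt)
qed

text \<open>Collapses the convolution to the single cut that can contribute. That cut may lie
  outside the range, in which case the sum is zero.\<close>

lemma sum_over_first:
  assumes "pp w'" "\<And>n. n \<in> {1..<length w'} \<Longrightarrow> f n \<in> carrier K" "\<And>n. n \<in> {1..<length w'} \<Longrightarrow> n \<noteq> k \<Longrightarrow> f n = \<zero>\<^bsub>K\<^esub>"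
  shows "(\<Oplus>\<^bsub>K\<^esub> n \<in> {1..<length w'}. f n) = (if k \<in> {1..<length w'} then f k else \<zero>\<^bsub>K\<^esub>)"
proof -
  have "(\<Oplus>\<^bsub>K\<^esub> n \<in> {1..<length w'}. f n) = (\<Oplus>\<^bsub>K\<^esub> n \<in> {1..<length w'}. if k = n then f n else \<zero>\<^bsub>K\<^esub>)"
    using assms(2,3) by (intro K.finsum_cong') auto
  also have "\<dots> = (if k \<in> {1..<length w'} then f k else \<zero>\<^bsub>K\<^esub>)"
  proof (cases "k \<in> {1..<length w'}")
    case True
    then show ?thesis
      using K.finsum_singleton[of k "{1..<length w'}" f] assms(2) by auto
  next
    case False
    then have "(\<Oplus>\<^bsub>K\<^esub> n \<in> {1..<length w'}. if k = n then f n else \<zero>\<^bsub>K\<^esub>) = \<zero>\<^bsub>K\<^esub>"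
      by (intro K.add.finprod_one_eqI) auto
    then show ?thesis
      using False by auto
  qed
  finally show ?thesis .
qed

text \<open>Among the vertex identities only the one at the start of \<open>w\<close> composes with
  \<open>w\<close>. Before passing to the quotient, the unit thus prefixes a letter to the word and
  does not fix it.\<close>

lemma path_one_mult_left:
  assumes "pp w"
  shows "\<one>\<^bsub>P\<^esub> \<otimes>\<^bsub>P\<^esub> pv w = pv (Elt (src w) \<one>\<^bsub>\<A> (src w)\<^esub> # w)"
proof
  fix w'
  have ne: "w \<noteq> []"
    using assms pp_not_Nil by blast
  have ppe: "pp (Elt (src w) \<one>\<^bsub>\<A> (src w)\<^esub> # w)"
    using assms src_vert vertex_one(1) ne by (simp add: pp_Cons)
  show "(\<one>\<^bsub>P\<^esub> \<otimes>\<^bsub>P\<^esub> pv w) w' = pv (Elt (src w) \<one>\<^bsub>\<A> (src w)\<^esub> # w) w'"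
  proof (cases "pp w'")
    case True
    have "(\<one>\<^bsub>P\<^esub> \<otimes>\<^bsub>P\<^esub> pv w) w' = (\<Oplus>\<^bsub>K\<^esub> n \<in> {1..<length w'}. \<one>\<^bsub>P\<^esub> (take n w') \<otimes>\<^bsub>K\<^esub> pv w (drop n w'))"
      using True by (simp add: path_space_mult)
    also have "\<dots> = (if 1 \<in> {1..<length w'} then \<one>\<^bsub>P\<^esub> (take 1 w') \<otimes>\<^bsub>K\<^esub> pv w (drop 1 w') else \<zero>\<^bsub>K\<^esub>)"
    proof (rule sum_over_first[OF True])
      show "\<one>\<^bsub>P\<^esub> (take n w') \<otimes>\<^bsub>K\<^esub> pv w (drop n w') \<in> carrier K" for n
        by (intro K.m_closed path_space_apply path_one_carrier path_vec_carrier assms)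
      show "\<one>\<^bsub>P\<^esub> (take n w') \<otimes>\<^bsub>K\<^esub> pv w (drop n w') = \<zero>\<^bsub>K\<^esub>" if "n \<in> {1..<length w'}" "n \<noteq> 1" for n
      proof -
        have "length (take n w') = n"
          using that(1) by simp
        then have "take n w' \<noteq> [l]" for l
          using that(2) by (metis One_nat_def length_Cons list.size(3))
        then have "\<one>\<^bsub>P\<^esub> (take n w') = \<zero>\<^bsub>K\<^esub>"
          by (simp add: path_one)
        then show ?thesis
          using path_space_apply[OF path_vec_carrier[OF assms]] by simp
      qed
    qed
    also have "\<dots> = pv (Elt (src w) \<one>\<^bsub>\<A> (src w)\<^esub> # w) w'"
    proof (cases w')
      case (Cons l v)
      show ?thesis
      proof (cases "v = w")
        case eq: True
        then have "letter_end \<Delta> l = src w" "is_letter \<Delta> \<A> l"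
          using True Cons ne by (auto simp: pp_Cons)
        then show ?thesis
          using Cons eq ne by (cases l) (auto simp: path_one path_vec_def Suc_le_eq)
      next
        case False
        then show ?thesis
          using Cons by (auto simp: path_one path_vec_def)
      qed
    qed (simp add: path_vec_def)
    finally show ?thesis .
  next
    case False
    then show ?thesis
      using ppe by (auto simp: path_space_mult path_vec_def)
  qed
qed

lemma path_one_mult_right:
  assumes "pp w"
  shows "pv w \<otimes>\<^bsub>P\<^esub> \<one>\<^bsub>P\<^esub> = pv (w @ [Elt (tgt w) \<one>\<^bsub>\<A> (tgt w)\<^esub>])"
proof
  fix w'
  have ne: "w \<noteq> []"
    using assms pp_not_Nil by blast
  have ppe: "pp (w @ [Elt (tgt w) \<one>\<^bsub>\<A> (tgt w)\<^esub>])"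
    using assms tgt_vert vertex_one(1) ne by (simp add: pp_append pp_elt)
  show "(pv w \<otimes>\<^bsub>P\<^esub> \<one>\<^bsub>P\<^esub>) w' = pv (w @ [Elt (tgt w) \<one>\<^bsub>\<A> (tgt w)\<^esub>]) w'"
  proof (cases "pp w'")
    case True
    have "(pv w \<otimes>\<^bsub>P\<^esub> \<one>\<^bsub>P\<^esub>) w' = (\<Oplus>\<^bsub>K\<^esub> n \<in> {1..<length w'}. pv w (take n w') \<otimes>\<^bsub>K\<^esub> \<one>\<^bsub>P\<^esub> (drop n w'))"
      using True by (simp add: path_space_mult)
    also have "\<dots> =
        (if length w \<in> {1..<length w'} then pv w (take (length w) w') \<otimes>\<^bsub>K\<^esub> \<one>\<^bsub>P\<^esub> (drop (length w) w') else \<zero>\<^bsub>K\<^esub>)"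
    proof (rule sum_over_first[OF True])
      show "pv w (take n w') \<otimes>\<^bsub>K\<^esub> \<one>\<^bsub>P\<^esub> (drop n w') \<in> carrier K" for n
        by (intro K.m_closed path_space_apply path_one_carrier path_vec_carrier assms)
      show "pv w (take n w') \<otimes>\<^bsub>K\<^esub> \<one>\<^bsub>P\<^esub> (drop n w') = \<zero>\<^bsub>K\<^esub>" if "n \<in> {1..<length w'}" "n \<noteq> length w" for n
      proof -
        have "length (take n w') = n"
          using that(1) by simp
        then have "take n w' \<noteq> w"
          using that(2) by metis
        then show ?thesis
          using path_space_apply[OF path_one_carrier] by (simp add: path_vec_def)
      qed
    qed
    also have "\<dots> = pv (w @ [Elt (tgt w) \<one>\<^bsub>\<A> (tgt w)\<^esub>]) w'"
    proof (cases "\<exists>l. w' = w @ [l]")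
      case eq: True
      then obtain l where l: "w' = w @ [l]"
        by blast
      then have "tgt w = letter_start \<Delta> l" "is_letter \<Delta> \<A> l"
        using True ne by (auto simp: pp_append pp_single)
      then show ?thesis
        using l ne by (cases l) (auto simp: path_one path_vec_def Suc_le_eq)
    next
      case False
      then have "drop (length w) w' \<noteq> [l]" if "take (length w) w' = w" for l
        using that append_take_drop_id[of "length w" w'] by metis
      then have "pv w (take (length w) w') \<otimes>\<^bsub>K\<^esub> \<one>\<^bsub>P\<^esub> (drop (length w) w') = \<zero>\<^bsub>K\<^esub>"
        by (auto simp: path_one path_vec_def)
      then show ?thesis
        using False by (auto simp: path_vec_def)
    qed
    finally show ?thesis .
  next
    case False
    then show ?thesis
      using ppe by (auto simp: path_space_mult path_vec_def)
  qed
qed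

text \<open>A single relator removes the prefixed identity: \<open>mult_elt\<close> if the word
  begins with an element of a vertex algebra, \<open>one_left\<close> if it begins with an
  arrow.\<close>

lemma path_one_left_null:
  assumes "pp w"
  shows "\<one>\<^bsub>P\<^esub> \<otimes>\<^bsub>P\<^esub> pv w \<ominus>\<^bsub>P\<^esub> pv w \<in> N"
proof -
  obtain l v where w: "w = l # v"
    using pp_not_Nil[OF assms] by (cases w) auto
  have "\<one>\<^bsub>P\<^esub> \<otimes>\<^bsub>P\<^esub> pv w \<ominus>\<^bsub>P\<^esub> pv w \<in> pse_relators K \<Delta> \<A>"
  proof (cases l)
    case (Elt i a)
    have "pp ([Elt i a] @ v)"
      using assms w Elt by simp
    then have i: "i \<in> verts \<Delta>" "a \<in> carrier (\<A> i)"
      using pp_factor[of "[]" "[Elt i a]" v] by (auto simp: pp_elt)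
    have "pp (Elt i \<one>\<^bsub>\<A> i\<^esub> # w)"
      using assms w Elt i vertex_one(1) by (simp add: pp_Cons)
    then show ?thesis
      using pse_relators.mult_elt[of \<Delta> \<A> "[]" i "\<one>\<^bsub>\<A> i\<^esub>" a v K] i w Elt
        path_one_mult_left[OF assms] by (simp add: vertex_one del: path_space_simps)
  next
    case (Arr a \<beta> b)
    then show ?thesis
      using pse_relators.one_left[of \<Delta> \<A> "[]" a \<beta> b v K] assms w
        path_one_mult_left[OF assms] by (simp del: path_space_simps)
  qed
  then show ?thesis
    using relators_in_null by blast
qed

lemma path_one_right_null:
  assumes "pp w"
  shows "pv w \<otimes>\<^bsub>P\<^esub> \<one>\<^bsub>P\<^esub> \<ominus>\<^bsub>P\<^esub> pv w \<in> N"
proof -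
  obtain l v where w: "w = v @ [l]"
    using pp_not_Nil[OF assms] by (cases w rule: rev_cases) auto
  have "pv w \<otimes>\<^bsub>P\<^esub> \<one>\<^bsub>P\<^esub> \<ominus>\<^bsub>P\<^esub> pv w \<in> pse_relators K \<Delta> \<A>"
  proof (cases l)
    case (Elt i a)
    have "pp (v @ [Elt i a] @ [])"
      using assms w Elt by simp
    then have i: "i \<in> verts \<Delta>" "a \<in> carrier (\<A> i)"
      using pp_factor[of v "[Elt i a]" "[]"] by (auto simp: pp_elt)
    have "pp (w @ [Elt i \<one>\<^bsub>\<A> i\<^esub>])"
      using assms w Elt i vertex_one(1) by (simp add: pp_append[of "v @ [Elt i a]"] pp_elt del: append_assoc)
    then show ?thesis
      using pse_relators.mult_elt[of \<Delta> \<A> v i a "\<one>\<^bsub>\<A> i\<^esub>" "[]" K] i w Elt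
        path_one_mult_right[OF assms] by (simp add: vertex_one del: path_space_simps)
  next
    case (Arr a \<beta> b)
    then show ?thesis
      using pse_relators.one_right[of \<Delta> \<A> v a \<beta> b "[]" K] assms w
        path_one_mult_right[OF assms] by (simp del: path_space_simps)
  qed
  then show ?thesis
    using relators_in_null by blast
qed

lemma path_one_null:
  assumes "f \<in> carrier P"
  shows "\<one>\<^bsub>P\<^esub> \<otimes>\<^bsub>P\<^esub> f \<ominus>\<^bsub>P\<^esub> f \<in> N \<and> f \<otimes>\<^bsub>P\<^esub> \<one>\<^bsub>P\<^esub> \<ominus>\<^bsub>P\<^esub> f \<in> N"
  using assms
proof (induct rule: path_space_induct)
  case zero
  then show ?case
    using P.alg_idealD(3)[OF pse_null_alg_ideal] path_one_carrier
    by (simp add: a_minus_def P.minus_zero del: path_space_simps)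
next
  case (vec c w)
  then have "c \<odot>\<^bsub>P\<^esub> (\<one>\<^bsub>P\<^esub> \<otimes>\<^bsub>P\<^esub> pv w \<ominus>\<^bsub>P\<^esub> pv w) \<in> N" "c \<odot>\<^bsub>P\<^esub> (pv w \<otimes>\<^bsub>P\<^esub> \<one>\<^bsub>P\<^esub> \<ominus>\<^bsub>P\<^esub> pv w) \<in> N"
    using P.alg_idealD(7)[OF pse_null_alg_ideal] path_one_left_null path_one_right_null by blast+
  then show ?case
    using vec path_one_carrier
    by (simp add: P.smult_diff P.smult_mult_left P.smult_mult_right del: path_space_simps)
next
  case (add f g)
  have *: "(a \<oplus>\<^bsub>P\<^esub> b) \<ominus>\<^bsub>P\<^esub> (f \<oplus>\<^bsub>P\<^esub> g) = (a \<ominus>\<^bsub>P\<^esub> f) \<oplus>\<^bsub>P\<^esub> (b \<ominus>\<^bsub>P\<^esub> g)"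
    if "a \<in> carrier P" "b \<in> carrier P" for a b
    using that add(1,2) by (simp add: a_minus_def P.M.minus_add P.M.a_ac del: path_space_simps)
  show ?case
    using add path_one_carrier P.alg_idealD(4)[OF pse_null_alg_ideal]
    by (simp add: P.mult_add_left P.mult_add_right * del: path_space_simps)
qed

lemma PSE_k_algebra: "k_algebra K (PSE K \<Delta> \<A>)"
  unfolding PSE_def using path_one_null path_one_carrier
  by (intro P.quot_alg_k_algebra pse_null_alg_ideal) auto

end

section \<open>Evaluation of pseudo-paths in an algebra\<close>

text \<open>The data for the universal property: linear multiplicative maps on the vertex algebras
  with orthogonal images, whose identities sum to \<open>\<one>\<close>, and an arbitrary element of
  \<open>A\<close> for each arrow. Such an element gets its start and end from the factors put
  around it in \<open>letter_val\<close>.\<close>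

locale path_evaluation = pseudo_path_data K \<Delta> \<A> + A: k_algebra K A
  for K :: "('k, 'c) ring_scheme" and \<Delta> :: "('v, 'e) pre_digraph"
    and \<A> :: "'v \<Rightarrow> ('k, 'b, 'd) module_scheme" and A :: "('k, 'a, 'f) module_scheme" (structure) +
  fixes E :: "'v \<Rightarrow> 'b \<Rightarrow> 'a" and x :: "'e \<Rightarrow> 'a"
  assumes E_closed: "i \<in> verts \<Delta> \<Longrightarrow> a \<in> carrier (\<A> i) \<Longrightarrow> E i a \<in> carrier A"
    and E_linear: "i \<in> verts \<Delta> \<Longrightarrow> c \<in> carrier K \<Longrightarrow> a \<in> carrier (\<A> i) \<Longrightarrow> a' \<in> carrier (\<A> i) \<Longrightarrow>
      E i (c \<odot>\<^bsub>\<A> i\<^esub> a \<oplus>\<^bsub>\<A> i\<^esub> a') = c \<odot> E i a \<oplus> E i a'"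
    and E_mult: "i \<in> verts \<Delta> \<Longrightarrow> a \<in> carrier (\<A> i) \<Longrightarrow> b \<in> carrier (\<A> i) \<Longrightarrow>
      E i (a \<otimes>\<^bsub>\<A> i\<^esub> b) = E i a \<otimes> E i b"
    and E_orthogonal: "i \<in> verts \<Delta> \<Longrightarrow> j \<in> verts \<Delta> \<Longrightarrow> i \<noteq> j \<Longrightarrow> a \<in> carrier (\<A> i) \<Longrightarrow> b \<in> carrier (\<A> j) \<Longrightarrow>
      E i a \<otimes> E j b = \<zero>"
    and E_one: "(\<Oplus>\<^bsub>A\<^esub> i \<in> verts \<Delta>. E i \<one>\<^bsub>\<A> i\<^esub>) = \<one>"
    and x_closed: "\<beta> \<in> arcs \<Delta> \<Longrightarrow> x \<beta> \<in> carrier A"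
begin

fun letter_val :: "('v, 'e, 'b) letter \<Rightarrow> 'a" where
  "letter_val (Elt i a) = E i a"
| "letter_val (Arr a \<beta> b) = E (tail \<Delta> \<beta>) a \<otimes> x \<beta> \<otimes> E (head \<Delta> \<beta>) b"

definition word_val :: "('v, 'e, 'b) letter list \<Rightarrow> 'a"
  where "word_val w = foldr (\<lambda>l y. letter_val l \<otimes> y) w \<one>"

lemma word_val_Nil [simp]: "word_val [] = \<one>"
  by (simp add: word_val_def)

lemma word_val_Cons [simp]: "word_val (l # w) = letter_val l \<otimes> word_val w"
  by (simp add: word_val_def)

lemma letter_val_closed: "is_letter \<Delta> \<A> l \<Longrightarrow> letter_val l \<in> carrier A"
  by (cases l) (simp_all add: E_closed x_closed tail_vert head_vert)

lemma word_val_closed': "\<forall>l\<in>set w. is_letter \<Delta> \<A> l \<Longrightarrow> word_val w \<in> carrier A"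
  by (induct w) (simp_all add: letter_val_closed)

lemma pp_letters: "pp w \<Longrightarrow> \<forall>l\<in>set w. is_letter \<Delta> \<A> l"
  by (simp add: pseudo_path_def)

lemma word_val_closed: "pp w \<Longrightarrow> word_val w \<in> carrier A"
  using word_val_closed' pp_letters by blast

lemma word_val_append:
  assumes "\<forall>l\<in>set u. is_letter \<Delta> \<A> l" "\<forall>l\<in>set v. is_letter \<Delta> \<A> l"
  shows "word_val (u @ v) = word_val u \<otimes> word_val v"
  using assms(1)
  by (induct u) (simp_all add: word_val_closed' assms(2) letter_val_closed A.m_assoc)

lemma E_one_left: "i \<in> verts \<Delta> \<Longrightarrow> a \<in> carrier (\<A> i) \<Longrightarrow> E i \<one>\<^bsub>\<A> i\<^esub> \<otimes> E i a = E i a"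
  using E_mult[of i "\<one>\<^bsub>\<A> i\<^esub>" a] by (simp add: vertex_one)

lemma E_one_right: "i \<in> verts \<Delta> \<Longrightarrow> a \<in> carrier (\<A> i) \<Longrightarrow> E i a \<otimes> E i \<one>\<^bsub>\<A> i\<^esub> = E i a"
  using E_mult[of i a "\<one>\<^bsub>\<A> i\<^esub>"] by (simp add: vertex_one)

abbreviation "e i \<equiv> E i \<one>\<^bsub>\<A> i\<^esub>"

lemma e_closed: "i \<in> verts \<Delta> \<Longrightarrow> e i \<in> carrier A"
  by (simp add: E_closed vertex_one(1))

lemma e_orthogonal: "i \<in> verts \<Delta> \<Longrightarrow> j \<in> verts \<Delta> \<Longrightarrow> i \<noteq> j \<Longrightarrow> e i \<otimes> e j = \<zero>"
  by (simp add: E_orthogonal vertex_one(1))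

lemma letter_val_start: "is_letter \<Delta> \<A> l \<Longrightarrow> e (letter_start \<Delta> l) \<otimes> letter_val l = letter_val l"
proof (cases l)
  case (Arr a \<beta> b)
  assume "is_letter \<Delta> \<A> l"
  then have b: "\<beta> \<in> arcs \<Delta>" "a \<in> carrier (\<A> (tail \<Delta> \<beta>))" "b \<in> carrier (\<A> (head \<Delta> \<beta>))"
    using Arr by auto
  then have "e (tail \<Delta> \<beta>) \<otimes> (E (tail \<Delta> \<beta>) a \<otimes> x \<beta> \<otimes> E (head \<Delta> \<beta>) b)
      = (e (tail \<Delta> \<beta>) \<otimes> E (tail \<Delta> \<beta>) a) \<otimes> x \<beta> \<otimes> E (head \<Delta> \<beta>) b"
    by (simp add: A.m_assoc e_closed E_closed x_closed tail_vert head_vert)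
  then show ?thesis
    using Arr b by (simp add: E_one_left tail_vert)
qed (simp add: E_one_left)

lemma letter_val_end: "is_letter \<Delta> \<A> l \<Longrightarrow> letter_val l \<otimes> e (letter_end \<Delta> l) = letter_val l"
proof (cases l)
  case (Arr a \<beta> b)
  assume "is_letter \<Delta> \<A> l"
  then have b: "\<beta> \<in> arcs \<Delta>" "a \<in> carrier (\<A> (tail \<Delta> \<beta>))" "b \<in> carrier (\<A> (head \<Delta> \<beta>))"
    using Arr by auto
  then show ?thesis
    using Arr by (simp add: A.m_assoc e_closed E_closed x_closed tail_vert head_vert E_one_right)
qed (simp add: E_one_right)

lemma word_val_start:
  assumes "pp w"
  shows "e (src w) \<otimes> word_val w = word_val w"
proof -
  obtain l v where w: "w = l # v"
    using pp_not_Nil[OF assms] by (cases w) auto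
  then have l: "is_letter \<Delta> \<A> l" "word_val v \<in> carrier A"
    using pp_letters[OF assms] by (auto intro: word_val_closed')
  have "e (letter_start \<Delta> l) \<in> carrier A"
    using e_closed src_vert[OF assms] w by simp
  then show ?thesis
    using w l letter_val_start[OF l(1)] by (simp add: A.m_assoc[symmetric] letter_val_closed)
qed

lemma word_val_end:
  assumes "pp w"
  shows "word_val w \<otimes> e (tgt w) = word_val w"
proof -
  obtain l v where w: "w = v @ [l]"
    using pp_not_Nil[OF assms] by (cases w rule: rev_cases) auto
  then have l: "is_letter \<Delta> \<A> l" "word_val v \<in> carrier A" "\<forall>l\<in>set v. is_letter \<Delta> \<A> l"
    using pp_letters[OF assms] by (auto intro: word_val_closed')
  have "e (letter_end \<Delta> l) \<in> carrier A"
    using e_closed tgt_vert[OF assms] w by simp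
  then show ?thesis
    using w l letter_val_end[OF l(1)] by (simp add: word_val_append A.m_assoc letter_val_closed)
qed

text \<open>Values absorb the identities at both their ends. If the ends do not match, two
  orthogonal idempotents meet in the middle, which agrees with the zero product of non-composable
  words.\<close>

lemma word_val_mult:
  assumes "pp u" "pp v"
  shows "word_val u \<otimes> word_val v = (if tgt u = src v then word_val (u @ v) else \<zero>)"
proof (cases "tgt u = src v")
  case True
  then show ?thesis
    using word_val_append assms pp_letters by simp
next
  case False
  have c: "word_val u \<in> carrier A" "word_val v \<in> carrier A" "e (tgt u) \<in> carrier A" "e (src v) \<in> carrier A"
    using assms word_val_closed e_closed src_vert tgt_vert by auto
  have "word_val u \<otimes> word_val v = (word_val u \<otimes> e (tgt u)) \<otimes> (e (src v) \<otimes> word_val v)"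
    using assms by (simp add: word_val_start word_val_end)
  also have "\<dots> = word_val u \<otimes> ((e (tgt u) \<otimes> e (src v)) \<otimes> word_val v)"
    using c by (simp add: A.m_assoc)
  also have "\<dots> = \<zero>"
    using c False assms by (simp add: e_orthogonal src_vert tgt_vert)
  finally show ?thesis
    using False by simp
qed

section \<open>Linear extension of the evaluation to formal paths\<close>

definition eval_path :: "(('v, 'e, 'b) letter list \<Rightarrow> 'k) \<Rightarrow> 'a"
  where "eval_path f = (\<Oplus>\<^bsub>A\<^esub> w \<in> {w. f w \<noteq> \<zero>\<^bsub>K\<^esub>}. f w \<odot> word_val w)"

text \<open>Supports vary under addition and scaling, so sums are compared over a common finite
  index set. Its members are pseudo-paths, which keeps their values in \<open>A\<close>.\<close>

lemma eval_path_superset: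
  assumes "f \<in> carrier P" "finite S" "{w. f w \<noteq> \<zero>\<^bsub>K\<^esub>} \<subseteq> S" "\<And>w. w \<in> S \<Longrightarrow> pp w"
  shows "eval_path f = (\<Oplus>\<^bsub>A\<^esub> w \<in> S. f w \<odot> word_val w)"
  unfolding eval_path_def
proof (rule A.add.finprod_mono_neutral_cong_left)
  show "(\<lambda>w. f w \<odot> word_val w) \<in> S \<rightarrow> carrier A"
    using assms(1,4) by (auto intro!: A.smult_closed word_val_closed path_space_apply)
  show "f w \<odot> word_val w = \<zero>" if "w \<in> S - {w. f w \<noteq> \<zero>\<^bsub>K\<^esub>}" for w
    using that assms(4) by (simp add: word_val_closed)
qed (use assms in auto)

lemma eval_path_closed: "f \<in> carrier P \<Longrightarrow> eval_path f \<in> carrier A"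
  unfolding eval_path_def
  by (rule A.finsum_closed) (auto intro!: A.smult_closed word_val_closed path_space_apply simp: path_space_carrier)

lemma supp_finite: "f \<in> carrier P \<Longrightarrow> finite {w. f w \<noteq> \<zero>\<^bsub>K\<^esub>}"
  and supp_pp: "f \<in> carrier P \<Longrightarrow> f w \<noteq> \<zero>\<^bsub>K\<^esub> \<Longrightarrow> pp w"
  by (auto simp: path_space_carrier)

lemma eval_path_add:
  assumes "f \<in> carrier P" "g \<in> carrier P"
  shows "eval_path (f \<oplus>\<^bsub>P\<^esub> g) = eval_path f \<oplus> eval_path g"
proof -
  define S where "S = {w. f w \<noteq> \<zero>\<^bsub>K\<^esub>} \<union> {w. g w \<noteq> \<zero>\<^bsub>K\<^esub>}"
  have S: "finite S" "\<And>w. w \<in> S \<Longrightarrow> pp w"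
    using assms supp_finite supp_pp by (auto simp: S_def)
  have sub: "{w. f w \<noteq> \<zero>\<^bsub>K\<^esub>} \<subseteq> S" "{w. g w \<noteq> \<zero>\<^bsub>K\<^esub>} \<subseteq> S" "{w. (f \<oplus>\<^bsub>P\<^esub> g) w \<noteq> \<zero>\<^bsub>K\<^esub>} \<subseteq> S"
    by (auto simp: S_def)
  have closed: "(\<lambda>w. h w \<odot> word_val w) \<in> S \<rightarrow> carrier A" if "h \<in> carrier P" for h
    using that S(2) by (auto intro!: A.smult_closed word_val_closed path_space_apply)
  have "eval_path (f \<oplus>\<^bsub>P\<^esub> g) = (\<Oplus>\<^bsub>A\<^esub> w \<in> S. (f \<oplus>\<^bsub>P\<^esub> g) w \<odot> word_val w)"
    by (rule eval_path_superset[OF path_space_add_closed[OF assms] S(1) sub(3) S(2)])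
  also have "\<dots> = (\<Oplus>\<^bsub>A\<^esub> w \<in> S. f w \<odot> word_val w \<oplus> g w \<odot> word_val w)"
    using assms closed S(2) by (intro A.finsum_cong')
      (simp_all add: A.smult_l_distr path_space_apply word_val_closed)
  also have "\<dots> = (\<Oplus>\<^bsub>A\<^esub> w \<in> S. f w \<odot> word_val w) \<oplus> (\<Oplus>\<^bsub>A\<^esub> w \<in> S. g w \<odot> word_val w)"
    by (rule A.finsum_addf[OF closed[OF assms(1)] closed[OF assms(2)]])
  finally show ?thesis
    using eval_path_superset[OF assms(1) S(1) sub(1) S(2)] eval_path_superset[OF assms(2) S(1) sub(2) S(2)]
    by simp
qed

lemma eval_path_smult:
  assumes "c \<in> carrier K" "f \<in> carrier P"
  shows "eval_path (c \<odot>\<^bsub>P\<^esub> f) = c \<odot> eval_path f"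
proof -
  let ?S = "{w. f w \<noteq> \<zero>\<^bsub>K\<^esub>}"
  note S = supp_finite[OF assms(2)] supp_pp[OF assms(2)]
  have closed: "(\<lambda>w. f w \<odot> word_val w) \<in> ?S \<rightarrow> carrier A"
    using S(2) assms(2) by (auto intro!: A.smult_closed word_val_closed path_space_apply)
  have sub: "{w. (c \<odot>\<^bsub>P\<^esub> f) w \<noteq> \<zero>\<^bsub>K\<^esub>} \<subseteq> ?S"
    using assms(1) by auto
  have "eval_path (c \<odot>\<^bsub>P\<^esub> f) = (\<Oplus>\<^bsub>A\<^esub> w \<in> ?S. (c \<odot>\<^bsub>P\<^esub> f) w \<odot> word_val w)"
    by (rule eval_path_superset[OF path_space_smult_closed[OF assms] S(1) sub]) (simp add: S(2))
  also have "\<dots> = (\<Oplus>\<^bsub>A\<^esub> w \<in> ?S. c \<odot> (f w \<odot> word_val w))"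
    using assms closed S(2) by (intro A.finsum_cong')
      (auto simp: A.smult_assoc1 path_space_apply word_val_closed)
  also have "\<dots> = c \<odot> eval_path f"
    unfolding eval_path_def using A.finsum_smult_ldistr[OF S(1) assms(1) closed] by simp
  finally show ?thesis .
qed

lemma eval_path_vec:
  assumes "pp w"
  shows "eval_path (pv w) = word_val w"
proof -
  have "{v. pv w v \<noteq> \<zero>\<^bsub>K\<^esub>} \<subseteq> {w}"
    by (auto simp: path_vec_def)
  then have "eval_path (pv w) = (\<Oplus>\<^bsub>A\<^esub> v \<in> {w}. pv w v \<odot> word_val v)"
    using assms by (intro eval_path_superset) auto
  then show ?thesis
    using assms by (simp add: word_val_closed path_vec_def)
qed

lemma eval_path_zero: "eval_path \<zero>\<^bsub>P\<^esub> = \<zero>"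
  by (simp add: eval_path_def)

text \<open>Both sides are bilinear, and on words the equation is
  \<open>word_val_mult\<close>.\<close>

lemma eval_path_mult:
  assumes "f \<in> carrier P" "g \<in> carrier P"
  shows "eval_path (f \<otimes>\<^bsub>P\<^esub> g) = eval_path f \<otimes> eval_path g"
proof -
  note rules = eval_path_zero eval_path_closed eval_path_add eval_path_smult eval_path_vec
    P.smult_mult_left P.smult_mult_right P.mult_add_left P.mult_add_right
    A.smult_mult_left A.smult_mult_right A.l_distr A.r_distr word_val_closed
  have 1: "eval_path (pv u \<otimes>\<^bsub>P\<^esub> pv v) = word_val u \<otimes> word_val v" if "pp u" "pp v" for u v
  proof (cases "tgt u = src v")
    case True
    then have "pp (u @ v)"
      using that pp_not_Nil by (simp add: pp_append)
    then show ?thesis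
      using True that by (simp add: path_vec_mult word_val_mult eval_path_vec)
  next
    case False
    then show ?thesis
      using that by (simp add: path_vec_mult word_val_mult eval_path_zero del: path_space_simps)
  qed
  have 2: "eval_path (pv u \<otimes>\<^bsub>P\<^esub> g) = word_val u \<otimes> eval_path g" if "pp u" for u
    using assms(2)
    by (induct rule: path_space_induct) (simp_all add: that 1 rules del: path_space_simps)
  show ?thesis
    using assms(1)
    by (induct rule: path_space_induct) (simp_all add: assms(2) 2 rules del: path_space_simps)
qed

lemma eval_path_one: "eval_path \<one>\<^bsub>P\<^esub> = \<one>"
proof -
  let ?S = "(\<lambda>i. [Elt i \<one>\<^bsub>\<A> i\<^esub>]) ` verts \<Delta>"
  have S: "finite ?S" "{w. \<one>\<^bsub>P\<^esub> w \<noteq> \<zero>\<^bsub>K\<^esub>} \<subseteq> ?S" "\<And>w. w \<in> ?S \<Longrightarrow> pp w"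
    using finite_verts vertex_one(1) by (auto simp: path_one pp_elt)
  have "eval_path \<one>\<^bsub>P\<^esub> = (\<Oplus>\<^bsub>A\<^esub> w \<in> ?S. \<one>\<^bsub>P\<^esub> w \<odot> word_val w)"
    by (rule eval_path_superset[OF path_one_carrier S])
  also have "\<dots> = (\<Oplus>\<^bsub>A\<^esub> i \<in> verts \<Delta>. \<one>\<^bsub>P\<^esub> [Elt i \<one>\<^bsub>\<A> i\<^esub>] \<odot> word_val [Elt i \<one>\<^bsub>\<A> i\<^esub>])"
    using S(3) by (intro A.finsum_reindex) (auto intro!: inj_onI A.smult_closed word_val_closed path_space_apply path_one_carrier)
  also have "\<dots> = (\<Oplus>\<^bsub>A\<^esub> i \<in> verts \<Delta>. e i)"
    by (intro A.finsum_cong') (auto simp: path_one e_closed)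
  finally show ?thesis
    using E_one by simp
qed

lemma eval_path_diff:
  assumes "f \<in> carrier P" "g \<in> carrier P"
  shows "eval_path (f \<ominus>\<^bsub>P\<^esub> g) = eval_path f \<ominus> eval_path g"
proof -
  have m: "\<ominus>\<^bsub>P\<^esub> g = (\<ominus>\<^bsub>K\<^esub> \<one>\<^bsub>K\<^esub>) \<odot>\<^bsub>P\<^esub> g"
    using assms(2) by (simp add: P.smult_l_minus del: path_space_simps)
  have "eval_path (\<ominus>\<^bsub>P\<^esub> g) = \<ominus> eval_path g"
    unfolding m using assms(2) by (simp add: eval_path_smult A.smult_l_minus eval_path_closed del: path_space_simps)
  then show ?thesis
    using assms by (simp add: a_minus_def[of P] a_minus_def[of A] eval_path_add del: path_space_simps)
qed

lemma letter_val_linear: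
  assumes "linear_letters c l1 l2 l3" "c \<in> carrier K"
  shows "letter_val l1 = c \<odot> letter_val l2 \<oplus> letter_val l3"
  using assms
  by cases (simp_all add: E_linear tail_vert head_vert E_closed x_closed A.l_distr A.r_distr
      A.smult_mult_left A.smult_mult_right)

lemma word_val_equal:
  assumes "equal_words w1 w2"
  shows "word_val w1 = word_val w2"
  using assms
proof cases
  case (1 i a b)
  then show ?thesis
    by (simp add: E_mult E_closed)
next
  case (2 a \<beta> b)
  then show ?thesis
    using letter_val_start[OF 2(3)] letter_val_closed[OF 2(3)] by (simp del: letter_val.simps(2))
next
  case (3 a \<beta> b)
  then show ?thesis
    using letter_val_end[OF 3(3)] letter_val_closed[OF 3(3)] e_closed[OF head_vert]
    by (simp del: letter_val.simps(2))
qed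

lemma eval_rel3:
  assumes "c \<in> carrier K" "parallel w1 w2" "parallel w3 w2" "word_val w1 = c \<odot> word_val w2 \<oplus> word_val w3"
  shows "eval_path (rel3 c w1 w2 w3) = \<zero>"
  using assms parallelD[OF assms(2)] parallelD[OF assms(3)] unfolding rel3_def
  by (simp add: eval_path_diff eval_path_add eval_path_smult eval_path_vec word_val_closed A.minus_eq_zero_iff
      del: path_space_simps)

lemma eval_rel2:
  assumes "parallel w1 w2" "word_val w1 = word_val w2"
  shows "eval_path (rel2 w1 w2) = \<zero>"
  using assms parallelD[OF assms(1)] unfolding rel2_def
  by (simp add: eval_path_diff eval_path_vec word_val_closed A.minus_eq_zero_iff del: path_space_simps)

lemma eval_relator:
  assumes "r \<in> pse_relators K \<Delta> \<A>"
  shows "eval_path r = \<zero>"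
  using assms
proof (cases rule: relator_cases)
  case (linear c u v l1 l2 l3)
  note par = linear_letters_parallel[OF linear(2,1)]
  have "\<forall>l\<in>set u. is_letter \<Delta> \<A> l" "\<forall>l\<in>set v. is_letter \<Delta> \<A> l"
    using pp_letters[OF linear(3)] by auto
  moreover have "is_letter \<Delta> \<A> l1" "is_letter \<Delta> \<A> l2" "is_letter \<Delta> \<A> l3"
    using par by (simp_all add: parallel_def pp_single)
  ultimately show ?thesis
    unfolding linear(4) using linear(1) letter_val_linear[OF linear(2,1)]
    by (intro eval_rel3 par[THEN parallel_context, OF disjI2, OF linear(3)])
      (simp_all add: word_val_append word_val_closed' letter_val_closed A.r_distr A.l_distr
        A.smult_mult_left A.smult_mult_right A.smult_r_distr)
next
  case (equal u v w1 w2)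
  note par = equal_words_parallel[OF equal(1)]
  have uv: "\<forall>l\<in>set u. is_letter \<Delta> \<A> l" "\<forall>l\<in>set v. is_letter \<Delta> \<A> l"
    using pp_letters[OF equal(2)] by auto
  have "word_val (u @ w @ v) = word_val u \<otimes> (word_val w \<otimes> word_val v)" if "pp w" for w
    using uv pp_letters[OF that] word_val_append[of u "w @ v"] word_val_append[of w v] by auto
  then have "word_val (u @ w1 @ v) = word_val (u @ w2 @ v)"
    using word_val_equal[OF equal(1)] parallelD[OF par] by simp
  then show ?thesis
    unfolding equal(3) by (intro eval_rel2 parallel_context[OF par disjI2[OF equal(2)]])
qed

text \<open>The vectors with value zero form a subspace that contains every relator, and
  \<open>N\<close> is the smallest such subspace.\<close>

lemma eval_null:
  assumes "f \<in> N"
  shows "eval_path f = \<zero>"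
proof -
  define S where "S = {f \<in> carrier P. eval_path f = \<zero>}"
  have "submodule S K P"
  proof (rule P.submoduleI)
    show "S \<subseteq> carrier P"
      by (auto simp: S_def)
    show "\<zero>\<^bsub>P\<^esub> \<in> S"
      using eval_path_zero path_space_zero_closed by (simp add: S_def del: path_space_simps)
    show "\<ominus>\<^bsub>P\<^esub> f \<in> S" if "f \<in> S" for f
      using that eval_path_diff[OF path_space_zero_closed, of f] eval_path_zero
      by (simp add: S_def a_minus_def A.minus_zero del: path_space_simps)
    show "f \<oplus>\<^bsub>P\<^esub> g \<in> S" if "f \<in> S" "g \<in> S" for f g
      using that by (simp add: S_def eval_path_add del: path_space_simps)
    show "c \<odot>\<^bsub>P\<^esub> f \<in> S" if "c \<in> carrier K" "f \<in> S" for c f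
      using that by (simp add: S_def eval_path_smult del: path_space_simps)
  qed
  moreover have "pse_relators K \<Delta> \<A> \<subseteq> S"
    using relators_in_carrier eval_relator by (auto simp: S_def)
  ultimately show ?thesis
    using pse_null_least assms by (auto simp: S_def)
qed

section \<open>The morphism induced on the pseudo path algebra\<close>

abbreviation "Q \<equiv> PSE K \<Delta> \<A>"
abbreviation "cls \<equiv> pse_class K \<Delta> \<A>"

sublocale Q: k_algebra K "PSE K \<Delta> \<A>"
  by (rule PSE_k_algebra)

lemma cls_carrier: "carrier Q = cls ` carrier P"
  by (simp add: PSE_def quot_alg_simps pse_class_def[abs_def])

lemma cls_closed [simp]: "f \<in> carrier P \<Longrightarrow> cls f \<in> carrier Q"
  by (simp add: cls_carrier)

lemma cls_add: "f \<in> carrier P \<Longrightarrow> g \<in> carrier P \<Longrightarrow> cls f \<oplus>\<^bsub>Q\<^esub> cls g = cls (f \<oplus>\<^bsub>P\<^esub> g)"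
  unfolding PSE_def pse_class_def by (rule P.coset_add[OF pse_null_alg_ideal])

lemma cls_mult: "f \<in> carrier P \<Longrightarrow> g \<in> carrier P \<Longrightarrow> cls f \<otimes>\<^bsub>Q\<^esub> cls g = cls (f \<otimes>\<^bsub>P\<^esub> g)"
  unfolding PSE_def pse_class_def by (rule P.coset_mult[OF pse_null_alg_ideal])

lemma cls_smult: "c \<in> carrier K \<Longrightarrow> f \<in> carrier P \<Longrightarrow> c \<odot>\<^bsub>Q\<^esub> cls f = cls (c \<odot>\<^bsub>P\<^esub> f)"
  unfolding PSE_def pse_class_def by (rule P.coset_smult[OF pse_null_alg_ideal])

lemma cls_zero: "cls \<zero>\<^bsub>P\<^esub> = \<zero>\<^bsub>Q\<^esub>"
  unfolding PSE_def pse_class_def using P.coset_zero[OF pse_null_alg_ideal] by (simp add: quot_alg_simps)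

lemma cls_one: "\<one>\<^bsub>Q\<^esub> = cls \<one>\<^bsub>P\<^esub>"
  by (simp add: PSE_def pse_class_def quot_alg_simps)

lemma cls_eq_iff: "f \<in> carrier P \<Longrightarrow> g \<in> carrier P \<Longrightarrow> cls f = cls g \<longleftrightarrow> f \<ominus>\<^bsub>P\<^esub> g \<in> N"
  unfolding pse_class_def by (rule P.coset_eq_iff[OF pse_null_alg_ideal])

text \<open>Evaluates an arbitrarily chosen representative. The choice does not matter because
  representatives differ by an element of \<open>N\<close>, whose value is zero.\<close>

definition eval_PSE :: "(('v, 'e, 'b) letter list \<Rightarrow> 'k) set \<Rightarrow> 'a"
  where "eval_PSE Y = eval_path (SOME f. f \<in> carrier P \<and> cls f = Y)"

lemma eval_PSE_cls:
  assumes "f \<in> carrier P"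
  shows "eval_PSE (cls f) = eval_path f"
proof -
  define g where "g = (SOME g. g \<in> carrier P \<and> cls g = cls f)"
  have g: "g \<in> carrier P \<and> cls g = cls f"
    unfolding g_def by (rule someI[of _ f]) (simp add: assms)
  then have "eval_path (g \<ominus>\<^bsub>P\<^esub> f) = \<zero>"
    using cls_eq_iff assms eval_null by blast
  then have "eval_path g = eval_path f"
    using g assms by (simp add: eval_path_diff eval_path_closed A.minus_eq_zero_iff)
  then show ?thesis
    by (simp add: eval_PSE_def g_def)
qed

lemma eval_PSE_hom: "eval_PSE \<in> alg_hom K Q A"
  unfolding alg_hom_def
proof (intro CollectI conjI ballI ring_hom_memI)
  fix X Y assume "X \<in> carrier Q" "Y \<in> carrier Q"
  then obtain f g where fg: "f \<in> carrier P" "g \<in> carrier P" "X = cls f" "Y = cls g"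
    by (auto simp: cls_carrier)
  show "eval_PSE X \<in> carrier A"
    using fg by (simp add: eval_PSE_cls eval_path_closed)
  show "eval_PSE (X \<otimes>\<^bsub>Q\<^esub> Y) = eval_PSE X \<otimes> eval_PSE Y"
    using fg by (simp add: eval_PSE_cls cls_mult eval_path_mult)
  show "eval_PSE (X \<oplus>\<^bsub>Q\<^esub> Y) = eval_PSE X \<oplus> eval_PSE Y"
    using fg by (simp add: eval_PSE_cls cls_add eval_path_add path_space_add_closed del: path_space_simps)
next
  show "eval_PSE \<one>\<^bsub>Q\<^esub> = \<one>"
    by (simp add: cls_one eval_PSE_cls path_one_carrier eval_path_one)
next
  fix c X assume "c \<in> carrier K" "X \<in> carrier Q"
  moreover then obtain f where "f \<in> carrier P" "X = cls f"
    by (auto simp: cls_carrier)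
  ultimately show "eval_PSE (c \<odot>\<^bsub>Q\<^esub> X) = c \<odot> eval_PSE X"
    by (simp add: eval_PSE_cls cls_smult eval_path_smult path_space_smult_closed del: path_space_simps)
qed

end

section \<open>The kernel of the evaluation\<close>

text \<open>No finiteness of \<open>I\<close> is assumed: over an infinite set the sum has the
  default value \<open>\<zero>\<close>, which is in \<open>U\<close>.\<close>

lemma (in abelian_monoid) finsum_in_closed:
  assumes "U \<subseteq> carrier G" "\<zero> \<in> U" "\<And>x y. x \<in> U \<Longrightarrow> y \<in> U \<Longrightarrow> x \<oplus> y \<in> U" "\<And>i. i \<in> I \<Longrightarrow> f i \<in> U"
  shows "finsum G f I \<in> U"
  using assms(4)
proof (induct I rule: infinite_finite_induct)
  case (insert i I)
  then have "f \<in> I \<rightarrow> carrier G" "f i \<in> carrier G"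
    using assms(1) by auto
  then show ?case
    using insert assms(3) by simp
qed (use assms(2) in auto)

lemma (in ring) ideal_finsum_closed:
  assumes "ideal I R" "\<And>i. i \<in> S \<Longrightarrow> f i \<in> I"
  shows "finsum R f S \<in> I"
proof -
  interpret ideal I R by fact
  show ?thesis
    using a_subset assms(2) by (intro finsum_in_closed) auto
qed

context path_evaluation
begin

interpretation eval: ring_hom_ring "PSE K \<Delta> \<A>" A eval_PSE
  by (rule alg_hom_ring_hom_ring[OF Q.k_algebra_axioms A.k_algebra_axioms eval_PSE_hom])

abbreviation "vx i a \<equiv> cls (pv [Elt i a])"

lemma vx_closed: "i \<in> verts \<Delta> \<Longrightarrow> a \<in> carrier (\<A> i) \<Longrightarrow> vx i a \<in> carrier Q"
  by (simp add: pp_elt)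

lemma vx_linear:
  assumes "i \<in> verts \<Delta>" "c \<in> carrier K" "a \<in> carrier (\<A> i)" "a' \<in> carrier (\<A> i)"
  shows "vx i (c \<odot>\<^bsub>\<A> i\<^esub> a \<oplus>\<^bsub>\<A> i\<^esub> a') = c \<odot>\<^bsub>Q\<^esub> vx i a \<oplus>\<^bsub>Q\<^esub> vx i a'"
proof -
  have p: "pp [Elt i a]" "pp [Elt i a']" "pp [Elt i (c \<odot>\<^bsub>\<A> i\<^esub> a \<oplus>\<^bsub>\<A> i\<^esub> a')]"
    using assms vertex_lincomb by (auto simp: pp_elt)
  have "pv [Elt i (c \<odot>\<^bsub>\<A> i\<^esub> a \<oplus>\<^bsub>\<A> i\<^esub> a')] \<ominus>\<^bsub>P\<^esub> (c \<odot>\<^bsub>P\<^esub> pv [Elt i a] \<oplus>\<^bsub>P\<^esub> pv [Elt i a']) \<in> N"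
    using pse_relators.linear_elt[of c K \<Delta> \<A> "[]" i a "[]" a'] assms(2) p relators_in_null
    by (auto simp del: path_space_simps)
  then show ?thesis
    using p assms(2)
    by (simp add: cls_smult cls_add cls_eq_iff path_space_smult_closed path_space_add_closed del: path_space_simps)
qed

lemma vx_mult:
  assumes "i \<in> verts \<Delta>" "a \<in> carrier (\<A> i)" "b \<in> carrier (\<A> i)"
  shows "vx i a \<otimes>\<^bsub>Q\<^esub> vx i b = vx i (a \<otimes>\<^bsub>\<A> i\<^esub> b)"
proof -
  have p: "pp [Elt i a]" "pp [Elt i b]" "pp [Elt i (a \<otimes>\<^bsub>\<A> i\<^esub> b)]" "pp [Elt i a, Elt i b]"
    using assms vertex_mult by (auto simp: pp_elt pp_Cons)
  have "pv [Elt i a, Elt i b] \<ominus>\<^bsub>P\<^esub> pv [Elt i (a \<otimes>\<^bsub>\<A> i\<^esub> b)] \<in> N"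
    using pse_relators.mult_elt[of \<Delta> \<A> "[]" i a b "[]" K] p(4) relators_in_null by auto
  then show ?thesis
    using p by (simp add: cls_mult path_vec_mult cls_eq_iff)
qed

lemma vertex_zero:
  assumes "i \<in> verts \<Delta>"
  shows "\<zero>\<^bsub>\<A> i\<^esub> \<in> carrier (\<A> i)" "\<one>\<^bsub>K\<^esub> \<odot>\<^bsub>\<A> i\<^esub> \<zero>\<^bsub>\<A> i\<^esub> \<oplus>\<^bsub>\<A> i\<^esub> \<zero>\<^bsub>\<A> i\<^esub> = \<zero>\<^bsub>\<A> i\<^esub>"
proof -
  interpret k_algebra K "\<A> i"
    by (rule vertex_algebra[OF assms])
  show "\<zero>\<^bsub>\<A> i\<^esub> \<in> carrier (\<A> i)" "\<one>\<^bsub>K\<^esub> \<odot>\<^bsub>\<A> i\<^esub> \<zero>\<^bsub>\<A> i\<^esub> \<oplus>\<^bsub>\<A> i\<^esub> \<zero>\<^bsub>\<A> i\<^esub> = \<zero>\<^bsub>\<A> i\<^esub>"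
    by simp_all
qed

text \<open>In the path space the word consisting of the zero element of a vertex algebra is a
  nonzero basis vector. Its class vanishes because linearity with coefficient one makes it equal to
  twice itself.\<close>

lemma vx_zero:
  assumes "i \<in> verts \<Delta>"
  shows "vx i \<zero>\<^bsub>\<A> i\<^esub> = \<zero>\<^bsub>Q\<^esub>"
proof -
  note z = vertex_zero[OF assms]
  have c: "vx i \<zero>\<^bsub>\<A> i\<^esub> \<in> carrier Q"
    by (rule vx_closed[OF assms z(1)])
  have "vx i \<zero>\<^bsub>\<A> i\<^esub> = \<one>\<^bsub>K\<^esub> \<odot>\<^bsub>Q\<^esub> vx i \<zero>\<^bsub>\<A> i\<^esub> \<oplus>\<^bsub>Q\<^esub> vx i \<zero>\<^bsub>\<A> i\<^esub>"
    using vx_linear[OF assms K.one_closed z(1) z(1)] unfolding z(2) .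
  then have "vx i \<zero>\<^bsub>\<A> i\<^esub> = vx i \<zero>\<^bsub>\<A> i\<^esub> \<oplus>\<^bsub>Q\<^esub> vx i \<zero>\<^bsub>\<A> i\<^esub>"
    using Q.smult_one[OF c] by argo
  then show ?thesis
    using c by (metis Q.add.l_cancel_one')
qed

lemma Q_one: "(\<Oplus>\<^bsub>Q\<^esub> i \<in> verts \<Delta>. vx i \<one>\<^bsub>\<A> i\<^esub>) = \<one>\<^bsub>Q\<^esub>"
proof -
  \<comment> \<open>\<open>u S\<close> is the part of the formal unit supported on the vertices in
    \<open>S\<close>. It allows an induction over vertices, and for all vertices it is the unit
    itself.\<close>
  define u :: "'v set \<Rightarrow> ('v, 'e, 'b) letter list \<Rightarrow> 'k"
    where "u S = (\<lambda>w. if \<exists>i\<in>S. w = [Elt i \<one>\<^bsub>\<A> i\<^esub>] then \<one>\<^bsub>K\<^esub> else \<zero>\<^bsub>K\<^esub>)" for S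
  have "(\<Oplus>\<^bsub>Q\<^esub> i \<in> S. vx i \<one>\<^bsub>\<A> i\<^esub>) = cls (u S) \<and> u S \<in> carrier P" if "finite S" "S \<subseteq> verts \<Delta>" for S
    using that
  proof (induct S)
    case empty
    have "u {} = \<zero>\<^bsub>P\<^esub>"
      by (simp add: u_def)
    then show ?case
      using path_space_zero_closed cls_zero by (simp del: path_space_simps)
  next
    case (insert i S)
    then have i: "i \<in> verts \<Delta>" "S \<subseteq> verts \<Delta>" "pp [Elt i \<one>\<^bsub>\<A> i\<^esub>]"
      using vertex_one(1) by (auto simp: pp_elt)
    have IH: "(\<Oplus>\<^bsub>Q\<^esub> i \<in> S. vx i \<one>\<^bsub>\<A> i\<^esub>) = cls (u S)" "u S \<in> carrier P"
      using insert.hyps(3) i(2) by auto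
    have eq: "u (insert i S) = pv [Elt i \<one>\<^bsub>\<A> i\<^esub>] \<oplus>\<^bsub>P\<^esub> u S"
      using insert.hyps(2) by (auto simp: u_def path_vec_def fun_eq_iff)
    have "(\<Oplus>\<^bsub>Q\<^esub> i \<in> insert i S. vx i \<one>\<^bsub>\<A> i\<^esub>) = vx i \<one>\<^bsub>\<A> i\<^esub> \<oplus>\<^bsub>Q\<^esub> (\<Oplus>\<^bsub>Q\<^esub> i \<in> S. vx i \<one>\<^bsub>\<A> i\<^esub>)"
      using insert.hyps(1,2) i vertex_one(1) by (intro Q.finsum_insert) (auto intro!: vx_closed)
    then show ?case
      unfolding eq IH(1) using i(3) IH(2) path_space_add_closed by (simp add: cls_add del: path_space_simps)
  qed
  from this[OF finite_verts] show ?thesis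
    by (simp add: u_def cls_one path_one)
qed

definition eval_kernel :: "(('v, 'e, 'b) letter list \<Rightarrow> 'k) set set"
  where "eval_kernel = {Y \<in> carrier Q. eval_PSE Y = \<zero>}"

lemma eval_kernel_ideal: "ideal eval_kernel Q"
  using eval.kernel_is_ideal unfolding eval_kernel_def a_kernel_def' .

text \<open>Every surviving word begins with \<open>u\<close> and ends with \<open>v\<close>. The
  computation is done with formal paths and not in the quotient, because being a relation is a
  condition on the support of a representative.\<close>

lemma corner_support:
  assumes "f \<in> carrier P" "pp u" "pp v" "((pv u \<otimes>\<^bsub>P\<^esub> f) \<otimes>\<^bsub>P\<^esub> pv v) w \<noteq> \<zero>\<^bsub>K\<^esub>"
  shows "src w = src u \<and> tgt w = tgt v"
  using assms(1,4)
proof (induct arbitrary: w rule: path_space_induct)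
  case zero
  then show ?case
    using assms(2,3) by (simp add: P.mult_zero_left P.mult_zero_right path_vec_carrier del: path_space_simps)
      (simp add: path_space_simps)
next
  case (vec c w')
  have "(pv u \<otimes>\<^bsub>P\<^esub> (c \<odot>\<^bsub>P\<^esub> pv w')) \<otimes>\<^bsub>P\<^esub> pv v = c \<odot>\<^bsub>P\<^esub> ((pv u \<otimes>\<^bsub>P\<^esub> pv w') \<otimes>\<^bsub>P\<^esub> pv v)"
    using vec(1,2) assms(2,3) by (simp add: P.smult_mult_left P.smult_mult_right del: path_space_simps)
  then have nz: "((pv u \<otimes>\<^bsub>P\<^esub> pv w') \<otimes>\<^bsub>P\<^esub> pv v) w \<noteq> \<zero>\<^bsub>K\<^esub>"
    using vec(1,3) by auto
  have ne: "u \<noteq> []" "v \<noteq> []" "w' \<noteq> []"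
    using assms(2,3) vec(2) pp_not_Nil by auto
  have t1: "tgt u = src w'"
  proof (rule ccontr)
    assume "tgt u \<noteq> src w'"
    then have "(pv u \<otimes>\<^bsub>P\<^esub> pv w') \<otimes>\<^bsub>P\<^esub> pv v = \<zero>\<^bsub>P\<^esub>"
      using assms(2,3) vec(2) by (simp add: path_vec_mult path_vec_carrier del: path_space_simps)
    then show False
      using nz by simp
  qed
  then have uw: "pp (u @ w')"
    using assms(2) vec(2) ne by (simp add: pp_append)
  then have *: "(pv u \<otimes>\<^bsub>P\<^esub> pv w') \<otimes>\<^bsub>P\<^esub> pv v = (if tgt (u @ w') = src v then pv ((u @ w') @ v) else \<zero>\<^bsub>P\<^esub>)"
    using t1 assms(2,3) vec(2) path_vec_mult by simp
  have "w = (u @ w') @ v"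
    using nz unfolding * by (auto simp: path_vec_def split: if_splits)
  then show ?case
    using ne by simp
next
  case (add f g)
  have "(pv u \<otimes>\<^bsub>P\<^esub> (f \<oplus>\<^bsub>P\<^esub> g)) \<otimes>\<^bsub>P\<^esub> pv v =
      ((pv u \<otimes>\<^bsub>P\<^esub> f) \<otimes>\<^bsub>P\<^esub> pv v) \<oplus>\<^bsub>P\<^esub> ((pv u \<otimes>\<^bsub>P\<^esub> g) \<otimes>\<^bsub>P\<^esub> pv v)"
    using add(1,2) assms(2,3) by (simp add: P.mult_add_left P.mult_add_right del: path_space_simps)
  then have "((pv u \<otimes>\<^bsub>P\<^esub> f) \<otimes>\<^bsub>P\<^esub> pv v) w \<oplus>\<^bsub>K\<^esub> ((pv u \<otimes>\<^bsub>P\<^esub> g) \<otimes>\<^bsub>P\<^esub> pv v) w \<noteq> \<zero>\<^bsub>K\<^esub>"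
    using add(5) by simp
  then have "((pv u \<otimes>\<^bsub>P\<^esub> f) \<otimes>\<^bsub>P\<^esub> pv v) w \<noteq> \<zero>\<^bsub>K\<^esub> \<or> ((pv u \<otimes>\<^bsub>P\<^esub> g) \<otimes>\<^bsub>P\<^esub> pv v) w \<noteq> \<zero>\<^bsub>K\<^esub>"
    by auto
  then show ?case
    using add(3,4) by blast
qed

lemma corner_relation:
  assumes "f \<in> carrier P" "i \<in> verts \<Delta>" "j \<in> verts \<Delta>"
  shows "(vx i \<one>\<^bsub>\<A> i\<^esub> \<otimes>\<^bsub>Q\<^esub> cls f) \<otimes>\<^bsub>Q\<^esub> vx j \<one>\<^bsub>\<A> j\<^esub> \<in> pse_relations K \<Delta> \<A>"
proof -
  let ?g = "(pv [Elt i \<one>\<^bsub>\<A> i\<^esub>] \<otimes>\<^bsub>P\<^esub> f) \<otimes>\<^bsub>P\<^esub> pv [Elt j \<one>\<^bsub>\<A> j\<^esub>]"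
  have p: "pp [Elt i \<one>\<^bsub>\<A> i\<^esub>]" "pp [Elt j \<one>\<^bsub>\<A> j\<^esub>]"
    using assms(2,3) vertex_one(1) by (auto simp: pp_elt)
  have c: "?g \<in> carrier P"
    using p assms(1) by (intro P.mult_closed path_vec_carrier)
  have s: "\<forall>w. ?g w \<noteq> \<zero>\<^bsub>K\<^esub> \<longrightarrow> src w = i \<and> tgt w = j"
    using corner_support[OF assms(1) p] by simp
  have "cls ?g \<in> pse_relations K \<Delta> \<A>"
    unfolding pse_relations_def using assms(2,3) c s by blast
  then show ?thesis
    using p assms(1) by (simp add: cls_mult path_vec_carrier)
qed

text \<open>As the vertex identities sum to one, an element \<open>Y\<close> of the kernel is the
  sum of its corners. Each corner is again in the kernel and is a relation, so the relations inside
  the kernel already generate it.\<close>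

lemma genideal_kernel_relations:
  "genideal Q (pse_relations K \<Delta> \<A> \<inter> eval_kernel) = eval_kernel"
proof
  let ?\<rho> = "pse_relations K \<Delta> \<A> \<inter> eval_kernel"
  show "genideal Q ?\<rho> \<subseteq> eval_kernel"
    by (rule Q.genideal_minimal[OF eval_kernel_ideal]) blast
  have sub: "?\<rho> \<subseteq> carrier Q"
    by (auto simp: eval_kernel_def)
  note I = Q.genideal_ideal[OF sub]
  show "eval_kernel \<subseteq> genideal Q ?\<rho>"
  proof
    fix Y assume Y: "Y \<in> eval_kernel"
    then have Yc: "Y \<in> carrier Q"
      by (simp add: eval_kernel_def)
    then obtain f where f: "f \<in> carrier P" "Y = cls f"
      by (auto simp: cls_carrier)
    let ?c = "\<lambda>i. vx i \<one>\<^bsub>\<A> i\<^esub>"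
    have c: "?c i \<in> carrier Q" if "i \<in> verts \<Delta>" for i
      using that vertex_one(1) by (intro vx_closed)
    have corner: "?c i \<otimes>\<^bsub>Q\<^esub> (Y \<otimes>\<^bsub>Q\<^esub> ?c j) \<in> genideal Q ?\<rho>" if ij: "i \<in> verts \<Delta>" "j \<in> verts \<Delta>" for i j
    proof -
      have "(?c i \<otimes>\<^bsub>Q\<^esub> Y) \<otimes>\<^bsub>Q\<^esub> ?c j \<in> eval_kernel"
        using ideal.I_r_closed[OF eval_kernel_ideal ideal.I_l_closed[OF eval_kernel_ideal Y c[OF ij(1)]] c[OF ij(2)]] .
      then have "(?c i \<otimes>\<^bsub>Q\<^esub> Y) \<otimes>\<^bsub>Q\<^esub> ?c j \<in> ?\<rho>"
        using corner_relation[OF f(1) ij] f(2) by simp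
      then show ?thesis
        using Q.genideal_self[OF sub] Q.m_assoc[OF c[OF ij(1)] Yc c[OF ij(2)]] by auto
    qed
    have right: "Y \<otimes>\<^bsub>Q\<^esub> ?c j \<in> genideal Q ?\<rho>" if j: "j \<in> verts \<Delta>" for j
    proof -
      have Yj: "Y \<otimes>\<^bsub>Q\<^esub> ?c j \<in> carrier Q"
        using Yc c[OF j] by simp
      have "Y \<otimes>\<^bsub>Q\<^esub> ?c j = (\<Oplus>\<^bsub>Q\<^esub> i \<in> verts \<Delta>. ?c i) \<otimes>\<^bsub>Q\<^esub> (Y \<otimes>\<^bsub>Q\<^esub> ?c j)"
        using Yj by (simp add: Q_one)
      also have "\<dots> = (\<Oplus>\<^bsub>Q\<^esub> i \<in> verts \<Delta>. ?c i \<otimes>\<^bsub>Q\<^esub> (Y \<otimes>\<^bsub>Q\<^esub> ?c j))"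
        using Yj c by (intro Q.finsum_ldistr finite_verts) auto
      also have "\<dots> \<in> genideal Q ?\<rho>"
        using corner j by (intro Q.ideal_finsum_closed[OF I]) blast
      finally show ?thesis .
    qed
    have "Y = Y \<otimes>\<^bsub>Q\<^esub> (\<Oplus>\<^bsub>Q\<^esub> j \<in> verts \<Delta>. ?c j)"
      using Yc by (simp add: Q_one)
    also have "\<dots> = (\<Oplus>\<^bsub>Q\<^esub> j \<in> verts \<Delta>. Y \<otimes>\<^bsub>Q\<^esub> ?c j)"
      using Yc c by (intro Q.finsum_rdistr finite_verts) auto
    also have "\<dots> \<in> genideal Q ?\<rho>"
      using right by (intro Q.ideal_finsum_closed[OF I]) blast
    finally show "Y \<in> genideal Q ?\<rho>" .
  qed
qed

section \<open>The arrow ideal and its image under evaluation\<close>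

abbreviation "J \<equiv> arrow_ideal K \<Delta> \<A>"

lemma arrow_generators_closed:
  "{cls (pv [Arr a \<beta> b]) | a \<beta> b. is_letter \<Delta> \<A> (Arr a \<beta> b)} \<subseteq> carrier Q"
proof -
  have "cls (pv [Arr a \<beta> b]) \<in> carrier Q" if "is_letter \<Delta> \<A> (Arr a \<beta> b)" for a \<beta> b
    using that by (intro cls_closed path_vec_carrier) (simp only: pp_single)
  then show ?thesis
    by blast
qed

lemma arrow_ideal_ideal: "ideal J Q"
  unfolding arrow_ideal_def by (rule Q.genideal_ideal[OF arrow_generators_closed])

lemma arrow_in_arrow_ideal:
  assumes "is_letter \<Delta> \<A> (Arr a \<beta> b)"
  shows "cls (pv [Arr a \<beta> b]) \<in> J"
proof -
  have "cls (pv [Arr a \<beta> b]) \<in> {cls (pv [Arr a \<beta> b]) | a \<beta> b. is_letter \<Delta> \<A> (Arr a \<beta> b)}"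
    using assms by blast
  then show ?thesis
    unfolding arrow_ideal_def using Q.genideal_self[OF arrow_generators_closed] by blast
qed

lemma cls_vec_append:
  assumes "pp (u @ v)" "u \<noteq> []" "v \<noteq> []"
  shows "cls (pv (u @ v)) = cls (pv u) \<otimes>\<^bsub>Q\<^esub> cls (pv v)"
proof -
  have "pp u" "pp v" "tgt u = src v"
    using assms by (auto simp: pp_append)
  then show ?thesis
    by (simp add: cls_mult path_vec_mult path_vec_carrier)
qed

lemma arrow_word_in_arrow_ideal:
  assumes "pp (u @ [Arr a \<beta> b] @ v)"
  shows "cls (pv (u @ [Arr a \<beta> b] @ v)) \<in> J"
proof -
  interpret J: ideal J Q
    by (rule arrow_ideal_ideal)
  have l: "is_letter \<Delta> \<A> (Arr a \<beta> b)"
    using pp_letters[OF assms] by simp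
  have 1: "cls (pv ([Arr a \<beta> b] @ v)) \<in> J" if "pp ([Arr a \<beta> b] @ v)"
  proof (cases "v = []")
    case False
    then have "pp v"
      using that by (simp add: pp_append[of "[Arr a \<beta> b]" v, simplified])
    then have "cls (pv [Arr a \<beta> b]) \<otimes>\<^bsub>Q\<^esub> cls (pv v) \<in> J"
      by (intro J.I_r_closed arrow_in_arrow_ideal l cls_closed path_vec_carrier)
    then show ?thesis
      using cls_vec_append[OF that _ False] by simp
  qed (use arrow_in_arrow_ideal[OF l] in simp)
  show ?thesis
  proof (cases "u = []")
    case False
    then have "pp u" "pp ([Arr a \<beta> b] @ v)"
      using assms pp_append[of u "[Arr a \<beta> b] @ v"] by auto
    then have "cls (pv u) \<otimes>\<^bsub>Q\<^esub> cls (pv ([Arr a \<beta> b] @ v)) \<in> J"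
      by (intro J.I_l_closed 1 cls_closed path_vec_carrier)
    then show ?thesis
      using cls_vec_append[OF assms False] by simp
  qed (use 1 assms in simp)
qed

text \<open>Without arrows a composable word stays at one vertex and multiplies out to one element
  there. That same \<open>a\<close> accounts for the class and for the value, which is what
  comparing the two requires.\<close>

lemma arrow_free_word:
  assumes "pp w" "\<And>a \<beta> b. Arr a \<beta> b \<notin> set w"
  shows "\<exists>a \<in> carrier (\<A> (src w)). cls (pv w) = vx (src w) a \<and> word_val w = E (src w) a"
  using assms
proof (induct w)
  case Nil
  then show ?case
    using pp_not_Nil by blast
next
  case (Cons l w)
  then obtain i a where l: "l = Elt i a"
    by (cases l) auto
  show ?case
  proof (cases "w = []")
    case True
    then have "i \<in> verts \<Delta>" "a \<in> carrier (\<A> i)"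
      using Cons.prems(1) l by (auto simp: pp_elt)
    then show ?thesis
      using True l by (auto simp: E_closed)
  next
    case False
    then have w: "i \<in> verts \<Delta>" "a \<in> carrier (\<A> i)" "pp w" "src w = i"
      using Cons.prems(1) l by (auto simp: pp_Cons)
    then obtain b where b: "b \<in> carrier (\<A> i)" "cls (pv w) = vx i b" "word_val w = E i b"
      using Cons.hyps Cons.prems(2) by auto
    have "cls (pv (l # w)) = vx i a \<otimes>\<^bsub>Q\<^esub> vx i b"
      using cls_vec_append[of "[l]" w] False Cons.prems(1) l b(2) by simp
    then show ?thesis
      using l w b by (auto simp: vx_mult E_mult intro!: bexI[of _ "a \<otimes>\<^bsub>\<A> i\<^esub> b"] vertex_mult)
  qed
qed

context
  fixes r :: "'a set"
  assumes r: "ideal r A" and x_r: "\<And>\<beta>. \<beta> \<in> arcs \<Delta> \<Longrightarrow> x \<beta> \<in> r"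
begin

text \<open>The preimage of \<open>r\<close> is an ideal containing the generators of
  \<open>J\<close>, since each value of an arrow letter has a factor \<open>x \<beta>\<close> in
  \<open>r\<close>.\<close>

lemma eval_arrow_ideal:
  assumes "Y \<in> J"
  shows "eval_PSE Y \<in> r"
proof -
  interpret r: ideal r A
    by (rule r)
  have "ideal {Y \<in> carrier Q. eval_PSE Y \<in> r} Q"
  proof (rule idealI[OF Q.ring_axioms])
    show "subgroup {Y \<in> carrier Q. eval_PSE Y \<in> r} (add_monoid Q)"
      by (rule Q.add.subgroupI) (auto intro!: exI[of _ "\<zero>\<^bsub>Q\<^esub>"])
  qed (auto intro: r.I_l_closed r.I_r_closed)
  moreover have "{cls (pv [Arr a \<beta> b]) | a \<beta> b. is_letter \<Delta> \<A> (Arr a \<beta> b)} \<subseteq> {Y \<in> carrier Q. eval_PSE Y \<in> r}"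
  proof -
    have "eval_PSE (cls (pv [Arr a \<beta> b])) \<in> r" if l: "is_letter \<Delta> \<A> (Arr a \<beta> b)" for a \<beta> b
    proof -
      have p: "pp [Arr a \<beta> b]"
        using l by (simp only: pp_single)
      have b: "\<beta> \<in> arcs \<Delta>" "E (tail \<Delta> \<beta>) a \<in> carrier A" "E (head \<Delta> \<beta>) b \<in> carrier A"
        using l E_closed tail_vert head_vert by auto
      have "E (tail \<Delta> \<beta>) a \<otimes> x \<beta> \<otimes> E (head \<Delta> \<beta>) b \<in> r"
        by (rule r.I_r_closed[OF r.I_l_closed[OF x_r[OF b(1)] b(2)] b(3)])
      then show ?thesis
        using p b by (simp add: eval_PSE_cls path_vec_carrier eval_path_vec x_closed)
    qed
    then show ?thesis
      using arrow_generators_closed by blast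
  qed
  ultimately have "J \<subseteq> {Y \<in> carrier Q. eval_PSE Y \<in> r}"
    unfolding arrow_ideal_def by (rule Q.genideal_minimal)
  then show ?thesis
    using assms by blast
qed

lemma eval_arrow_ideal_power:
  "Y \<in> J [^]\<^bsub>ideals_set Q\<^esub> (n::nat) \<Longrightarrow> eval_PSE Y \<in> r [^]\<^bsub>ideals_set A\<^esub> n"
proof (induct n arbitrary: Y)
  case 0
  then show ?case
    using eval.hom_closed by simp
next
  case (Suc n)
  have c: "J [^]\<^bsub>ideals_set Q\<^esub> n \<subseteq> carrier Q" "J \<subseteq> carrier Q"
    using ideal.Icarr[OF Q.ideal_pow_ideal[OF arrow_ideal_ideal]] ideal.Icarr[OF arrow_ideal_ideal] by auto
  have "ideal_prod Q (J [^]\<^bsub>ideals_set Q\<^esub> n) J \<subseteq>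
      {Y \<in> carrier Q. eval_PSE Y \<in> ideal_prod A (r [^]\<^bsub>ideals_set A\<^esub> n) r}"
  proof (rule Q.ideal_prod_least)
    show "X \<otimes>\<^bsub>Q\<^esub> Z \<in> {Y \<in> carrier Q. eval_PSE Y \<in> ideal_prod A (r [^]\<^bsub>ideals_set A\<^esub> n) r}"
      if "X \<in> J [^]\<^bsub>ideals_set Q\<^esub> n" "Z \<in> J" for X Z
      using subsetD[OF c(1) that(1)] subsetD[OF c(2) that(2)]
        ideal_prod.prod[OF Suc.hyps[OF that(1)] eval_arrow_ideal[OF that(2)], of A] by simp
    show "X \<oplus>\<^bsub>Q\<^esub> Z \<in> {Y \<in> carrier Q. eval_PSE Y \<in> ideal_prod A (r [^]\<^bsub>ideals_set A\<^esub> n) r}"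
      if "X \<in> {Y \<in> carrier Q. eval_PSE Y \<in> ideal_prod A (r [^]\<^bsub>ideals_set A\<^esub> n) r}"
        "Z \<in> {Y \<in> carrier Q. eval_PSE Y \<in> ideal_prod A (r [^]\<^bsub>ideals_set A\<^esub> n) r}" for X Z
      using that by (auto intro!: ideal_prod.sum)
  qed
  then show ?case
    using Suc.prems by auto
qed

section \<open>The kernel of the evaluation lies in the arrow ideal\<close>

context
  fixes p :: "'v \<Rightarrow> 'a \<Rightarrow> 'b"
  assumes p_closed: "\<And>i y. i \<in> verts \<Delta> \<Longrightarrow> y \<in> carrier A \<Longrightarrow> p i y \<in> carrier (\<A> i)"
    and p_linear: "\<And>i c y z. i \<in> verts \<Delta> \<Longrightarrow> c \<in> carrier K \<Longrightarrow> y \<in> carrier A \<Longrightarrow> z \<in> carrier A \<Longrightarrow>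
      p i (c \<odot> y \<oplus> z) = c \<odot>\<^bsub>\<A> i\<^esub> p i y \<oplus>\<^bsub>\<A> i\<^esub> p i z"
    and p_E: "\<And>i a. i \<in> verts \<Delta> \<Longrightarrow> a \<in> carrier (\<A> i) \<Longrightarrow> p i (E i a) = a"
    and p_E': "\<And>i j a. i \<in> verts \<Delta> \<Longrightarrow> j \<in> verts \<Delta> \<Longrightarrow> j \<noteq> i \<Longrightarrow> a \<in> carrier (\<A> i) \<Longrightarrow>
      p j (E i a) = \<zero>\<^bsub>\<A> j\<^esub>"
    and p_r: "\<And>i y. i \<in> verts \<Delta> \<Longrightarrow> y \<in> r \<Longrightarrow> p i y = \<zero>\<^bsub>\<A> i\<^esub>"
begin

text \<open>With \<open>p i\<close> reading off the component at the vertex \<open>i\<close>, this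
  map undoes the evaluation on vertex elements and kills \<open>r\<close>. It is linear, which is
  enough for comparing it with the identity on words.\<close>

definition section_map :: "'a \<Rightarrow> (('v, 'e, 'b) letter list \<Rightarrow> 'k) set"
  where "section_map y = (\<Oplus>\<^bsub>Q\<^esub> i \<in> verts \<Delta>. vx i (p i y))"

lemma section_map_closed: "y \<in> carrier A \<Longrightarrow> section_map y \<in> carrier Q"
  unfolding section_map_def by (rule Q.finsum_closed) (auto intro!: vx_closed p_closed)

lemma section_map_linear:
  assumes "c \<in> carrier K" "y \<in> carrier A" "z \<in> carrier A"
  shows "section_map (c \<odot> y \<oplus> z) = c \<odot>\<^bsub>Q\<^esub> section_map y \<oplus>\<^bsub>Q\<^esub> section_map z"
proof -
  have closed: "(\<lambda>i. vx i (p i y)) \<in> verts \<Delta> \<rightarrow> carrier Q" if "y \<in> carrier A" for y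
    using that by (auto intro!: vx_closed p_closed)
  have closed': "(\<lambda>i. c \<odot>\<^bsub>Q\<^esub> vx i (p i y)) \<in> verts \<Delta> \<rightarrow> carrier Q"
    using assms by (auto intro!: vx_closed p_closed Q.smult_closed)
  have "section_map (c \<odot> y \<oplus> z) = (\<Oplus>\<^bsub>Q\<^esub> i \<in> verts \<Delta>. c \<odot>\<^bsub>Q\<^esub> vx i (p i y) \<oplus>\<^bsub>Q\<^esub> vx i (p i z))"
    unfolding section_map_def
  proof (rule Q.finsum_cong'[OF refl])
    show "(\<lambda>i. c \<odot>\<^bsub>Q\<^esub> vx i (p i y) \<oplus>\<^bsub>Q\<^esub> vx i (p i z)) \<in> verts \<Delta> \<rightarrow> carrier Q"
      using closed' closed[OF assms(3)] by (auto simp: Pi_iff)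
    show "vx i (p i (c \<odot> y \<oplus> z)) = c \<odot>\<^bsub>Q\<^esub> vx i (p i y) \<oplus>\<^bsub>Q\<^esub> vx i (p i z)" if "i \<in> verts \<Delta>" for i
      using that assms by (simp add: p_linear vx_linear p_closed)
  qed
  also have "\<dots> = (\<Oplus>\<^bsub>Q\<^esub> i \<in> verts \<Delta>. c \<odot>\<^bsub>Q\<^esub> vx i (p i y)) \<oplus>\<^bsub>Q\<^esub> section_map z"
    unfolding section_map_def by (rule Q.finsum_addf[OF closed' closed[OF assms(3)]])
  also have "(\<Oplus>\<^bsub>Q\<^esub> i \<in> verts \<Delta>. c \<odot>\<^bsub>Q\<^esub> vx i (p i y)) = c \<odot>\<^bsub>Q\<^esub> section_map y"
    unfolding section_map_def using Q.finsum_smult_ldistr[OF finite_verts assms(1) closed[OF assms(2)]] by simp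
  finally show ?thesis .
qed

lemma section_map_r: "y \<in> r \<Longrightarrow> section_map y = \<zero>\<^bsub>Q\<^esub>"
  unfolding section_map_def by (rule Q.add.finprod_one_eqI) (simp add: p_r vx_zero)

lemma section_map_zero: "section_map \<zero> = \<zero>\<^bsub>Q\<^esub>"
  using section_map_r additive_subgroup.zero_closed[OF ideal.axioms(1)[OF r]] by blast

lemma section_map_E:
  assumes "i \<in> verts \<Delta>" "a \<in> carrier (\<A> i)"
  shows "section_map (E i a) = vx i a"
proof -
  have "section_map (E i a) = (\<Oplus>\<^bsub>Q\<^esub> j \<in> verts \<Delta>. if i = j then vx i a else \<zero>\<^bsub>Q\<^esub>)"
    unfolding section_map_def
    using assms by (intro Q.finsum_cong'[OF refl]) (auto simp: p_E p_E' vx_zero vx_closed simp del: cls_closed)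
  also have "\<dots> = vx i a"
    using Q.finsum_singleton[OF assms(1) finite_verts, of "\<lambda>_. vx i a"] vx_closed[OF assms] by simp
  finally show ?thesis .
qed

text \<open>Checked on words. A word with an arrow lies in \<open>J\<close> and has its value in
  \<open>r\<close>, where \<open>section_map\<close> is zero. A word without arrows is a vertex
  element, which \<open>section_map\<close> recovers exactly, so the difference is zero.\<close>

lemma section_map_mod_arrow_ideal:
  assumes "f \<in> carrier P"
  shows "cls f \<ominus>\<^bsub>Q\<^esub> section_map (eval_path f) \<in> J"
  using assms
proof (induct rule: path_space_induct)
  case zero
  interpret J: ideal J Q
    by (rule arrow_ideal_ideal)
  show ?case
    using J.zero_closed by (simp add: eval_path_zero section_map_zero cls_zero a_minus_def del: path_space_simps)
next
  case (vec c w)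
  interpret J: ideal J Q
    by (rule arrow_ideal_ideal)
  have "cls (pv w) \<ominus>\<^bsub>Q\<^esub> section_map (word_val w) \<in> J"
  proof (cases "\<exists>a \<beta> b. Arr a \<beta> b \<in> set w")
    case True
    then obtain a \<beta> b u v where w: "w = u @ [Arr a \<beta> b] @ v"
      by (metis append_Cons append_Nil split_list)
    then have J: "cls (pv w) \<in> J"
      using arrow_word_in_arrow_ideal vec(2) by blast
    then have "word_val w \<in> r"
      using eval_arrow_ideal[OF J] vec(2) by (simp add: eval_PSE_cls path_vec_carrier eval_path_vec)
    then show ?thesis
      using J by (simp add: section_map_r a_minus_def)
  next
    case False
    then obtain a where "a \<in> carrier (\<A> (src w))" "cls (pv w) = vx (src w) a" "word_val w = E (src w) a"
      using arrow_free_word[OF vec(2)] by blast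
    then show ?thesis
      using section_map_E[OF src_vert[OF vec(2)]] vx_closed[OF src_vert[OF vec(2)]] J.zero_closed
      by (simp add: a_minus_def Q.r_neg del: cls_closed)
  qed
  then have *: "c \<odot>\<^bsub>Q\<^esub> (cls (pv w) \<ominus>\<^bsub>Q\<^esub> section_map (word_val w)) \<in> J"
    using submodule.smult_closed[OF Q.ideal_submodule[OF arrow_ideal_ideal] vec(1)] by blast
  have s: "section_map (word_val w) \<in> carrier Q"
    using section_map_closed word_val_closed vec(2) by blast
  have "section_map (c \<odot> word_val w) = c \<odot>\<^bsub>Q\<^esub> section_map (word_val w)"
    using section_map_linear[OF vec(1) word_val_closed[OF vec(2)] A.zero_closed] s vec word_val_closed[OF vec(2)]
    by (simp add: section_map_zero)
  then show ?case
    using * vec s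
    by (simp add: eval_path_smult eval_path_vec path_vec_carrier cls_smult[symmetric] a_minus_def
        Q.smult_r_distr Q.smult_r_minus del: path_space_simps)
next
  case (add f g)
  interpret J: ideal J Q
    by (rule arrow_ideal_ideal)
  have e: "eval_path f \<in> carrier A" "eval_path g \<in> carrier A"
    using add eval_path_closed by auto
  have s: "section_map (eval_path (f \<oplus>\<^bsub>P\<^esub> g)) = section_map (eval_path f) \<oplus>\<^bsub>Q\<^esub> section_map (eval_path g)"
    using section_map_linear[OF K.one_closed e] e add(1,2) section_map_closed[OF e(1)]
    by (simp add: eval_path_add del: path_space_simps)
  have "cls (f \<oplus>\<^bsub>P\<^esub> g) \<ominus>\<^bsub>Q\<^esub> section_map (eval_path (f \<oplus>\<^bsub>P\<^esub> g)) =
      (cls f \<ominus>\<^bsub>Q\<^esub> section_map (eval_path f)) \<oplus>\<^bsub>Q\<^esub> (cls g \<ominus>\<^bsub>Q\<^esub> section_map (eval_path g))"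
    unfolding s cls_add[OF add(1,2), symmetric]
    using cls_closed[OF add(1)] cls_closed[OF add(2)] section_map_closed[OF e(1)] section_map_closed[OF e(2)]
    by (simp add: a_minus_def Q.minus_add Q.a_ac del: cls_closed)
  then show ?case
    using J.a_closed[OF add(3,4)] by simp
qed

lemma eval_kernel_in_arrow_ideal: "eval_kernel \<subseteq> J"
proof
  fix Y assume Y: "Y \<in> eval_kernel"
  then obtain f where f: "f \<in> carrier P" "Y = cls f"
    by (auto simp: eval_kernel_def cls_carrier)
  then have "eval_path f = \<zero>"
    using Y by (simp add: eval_kernel_def eval_PSE_cls)
  then show "Y \<in> J"
    using section_map_mod_arrow_ideal[OF f(1)] f by (simp add: section_map_zero a_minus_def)
qed

text \<open>All relations inside the kernel serve as \<open>\<rho>\<close>. The exponent of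
  \<open>J\<close> is the one that annihilates \<open>r\<close>, because the power of
  \<open>J\<close> is mapped into the same power of \<open>r\<close>.\<close>

theorem pse_presentation:
  assumes surj: "eval_PSE ` carrier Q = carrier A" and nilp: "r [^]\<^bsub>ideals_set A\<^esub> n = {\<zero>}" "1 \<le> (n::nat)"
  shows "\<exists>\<rho> \<subseteq> pse_relations K \<Delta> \<A>.
    alg_isomorphic K A (PSE_rel K \<Delta> \<A> \<rho>) \<and>
    (\<exists>s::nat. s \<ge> 1 \<and>
      arrow_ideal K \<Delta> \<A> [^]\<^bsub>ideals_set (PSE K \<Delta> \<A>)\<^esub> s \<subseteq> genideal (PSE K \<Delta> \<A>) \<rho> \<and>
      genideal (PSE K \<Delta> \<A>) \<rho> \<subseteq> arrow_ideal K \<Delta> \<A>)"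
proof (intro exI[of _ "pse_relations K \<Delta> \<A> \<inter> eval_kernel"] conjI exI[of _ n])
  show "alg_isomorphic K A (PSE_rel K \<Delta> \<A> (pse_relations K \<Delta> \<A> \<inter> eval_kernel))"
    unfolding PSE_rel_def genideal_kernel_relations
    by (rule quot_alg_isomorphic[OF Q.k_algebra_axioms A.k_algebra_axioms eval_PSE_hom surj eval_kernel_def])
  show "J [^]\<^bsub>ideals_set Q\<^esub> n \<subseteq> genideal Q (pse_relations K \<Delta> \<A> \<inter> eval_kernel)"
    unfolding genideal_kernel_relations
  proof
    fix Y assume Y: "Y \<in> J [^]\<^bsub>ideals_set Q\<^esub> n"
    then have "eval_PSE Y = \<zero>"
      using eval_arrow_ideal_power[OF Y] nilp(1) by simp
    moreover have "Y \<in> carrier Q"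
      using Y ideal.Icarr[OF Q.ideal_pow_ideal[OF arrow_ideal_ideal]] by blast
    ultimately show "Y \<in> eval_kernel"
      by (simp add: eval_kernel_def)
  qed
  show "genideal Q (pse_relations K \<Delta> \<A> \<inter> eval_kernel) \<subseteq> J"
    unfolding genideal_kernel_relations by (rule eval_kernel_in_arrow_ideal)
qed (use nilp(2) in auto)

end

end

end

section \<open>Lifted algebras and their quivers\<close>

text \<open>\<open>rad_layer\<close> and \<open>bimod_prod\<close> restrict the carrier of a
  quotient ring, so neither is a ring to which the quotient theory applies. The additive group is
  therefore established for any record whose elements are cosets of members of \<open>W\<close>.
  Negatives are recomputed as well, since inverses are looked up in the carrier.\<close>

lemma (in ideal) coset_group:
  fixes R' :: "('a set, 'z) ring_scheme"
  assumes "W \<subseteq> carrier R" "\<zero> \<in> W" and add: "\<And>x y. x \<in> W \<Longrightarrow> y \<in> W \<Longrightarrow> x \<oplus> y \<in> W"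
    and neg: "\<And>x. x \<in> W \<Longrightarrow> \<ominus> x \<in> W"
    and R': "carrier R' = (\<lambda>x. I +> x) ` W" "add R' = set_add R" "\<zero>\<^bsub>R'\<^esub> = I"
  shows "group (add_monoid R')" and "\<And>x. x \<in> W \<Longrightarrow> \<ominus>\<^bsub>R'\<^esub> (I +> x) = I +> \<ominus> x"
proof -
  have sum: "add R' (I +> x) (I +> y) = I +> (x \<oplus> y)" if "x \<in> W" "y \<in> W" for x y
    using that assms(1) by (simp add: R'(2) a_rcos_sum subset_iff)
  have zero: "\<zero>\<^bsub>R'\<^esub> = I +> \<zero>"
    using a_coset_add_zero[OF a_subset] by (simp add: R'(3))
  have carr: "x \<in> carrier R" if "x \<in> W" for x
    using that assms(1) by blast
  have inv: "add R' (I +> \<ominus> x) (I +> x) = \<zero>\<^bsub>R'\<^esub>" if "x \<in> W" for x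
    using that sum neg carr by (simp add: zero l_neg)
  show grp: "group (add_monoid R')"
  proof (rule groupI; simp)
    show "X \<oplus>\<^bsub>R'\<^esub> Y \<in> carrier R'" if "X \<in> carrier R'" "Y \<in> carrier R'" for X Y
      using that sum add by (auto simp: R'(1))
    show "\<zero>\<^bsub>R'\<^esub> \<in> carrier R'"
      using assms(2) by (auto simp: R'(1) zero)
    show "X \<oplus>\<^bsub>R'\<^esub> Y \<oplus>\<^bsub>R'\<^esub> Z = X \<oplus>\<^bsub>R'\<^esub> (Y \<oplus>\<^bsub>R'\<^esub> Z)"
      if "X \<in> carrier R'" "Y \<in> carrier R'" "Z \<in> carrier R'" for X Y Z
      using that sum add carr by (auto simp: R'(1) a_assoc)
    show "\<zero>\<^bsub>R'\<^esub> \<oplus>\<^bsub>R'\<^esub> X = X" if "X \<in> carrier R'" for X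
      using that sum assms(2) carr unfolding zero by (auto simp: R'(1))
    show "\<exists>Y\<in>carrier R'. Y \<oplus>\<^bsub>R'\<^esub> X = \<zero>\<^bsub>R'\<^esub>" if "X \<in> carrier R'" for X
      using that inv neg by (auto simp: R'(1))
  qed
  show "\<ominus>\<^bsub>R'\<^esub> (I +> x) = I +> \<ominus> x" if "x \<in> W" for x
    unfolding a_inv_def using group.inv_equality[OF grp, of "I +> \<ominus> x" "I +> x"] inv[OF that] neg[OF that] that
    by (simp add: R'(1) a_inv_def)
qed

lemma (in ideal) coset_additive_subgroup:
  fixes R' :: "('a set, 'z) ring_scheme"
  assumes "W \<subseteq> carrier R" "\<zero> \<in> W" "\<And>x y. x \<in> W \<Longrightarrow> y \<in> W \<Longrightarrow> x \<oplus> y \<in> W"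
    "\<And>x. x \<in> W \<Longrightarrow> \<ominus> x \<in> W"
    and R': "carrier R' = (\<lambda>x. I +> x) ` W" "add R' = set_add R" "\<zero>\<^bsub>R'\<^esub> = I"
    and W': "W' \<subseteq> W" "\<zero> \<in> W'" "\<And>x y. x \<in> W' \<Longrightarrow> y \<in> W' \<Longrightarrow> x \<oplus> y \<in> W'" "\<And>x. x \<in> W' \<Longrightarrow> \<ominus> x \<in> W'"
  shows "additive_subgroup ((\<lambda>x. I +> x) ` W') R'"
proof -
  interpret group "add_monoid R'"
    by (rule coset_group(1)[OF assms(1-7)])
  note inv = coset_group(2)[OF assms(1-7)]
  show ?thesis
  proof (intro additive_subgroup.intro subgroupI)
    show "(\<lambda>x. I +> x) ` W' \<subseteq> carrier (add_monoid R')" "(\<lambda>x. I +> x) ` W' \<noteq> {}"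
      using W'(1,2) by (auto simp: R'(1))
    show "inv\<^bsub>add_monoid R'\<^esub> X \<in> (\<lambda>x. I +> x) ` W'" if "X \<in> (\<lambda>x. I +> x) ` W'" for X
    proof -
      from that obtain x where x: "x \<in> W'" "X = I +> x"
        by blast
      then have "inv\<^bsub>add_monoid R'\<^esub> X = I +> \<ominus> x"
        using inv[of x] W'(1) by (auto simp: a_inv_def[of R'])
      then show ?thesis
        using W'(4)[OF x(1)] by blast
    qed
    show "X \<otimes>\<^bsub>add_monoid R'\<^esub> Y \<in> (\<lambda>x. I +> x) ` W'"
      if "X \<in> (\<lambda>x. I +> x) ` W'" "Y \<in> (\<lambda>x. I +> x) ` W'" for X Y
    proof -
      from that obtain x y where xy: "x \<in> W'" "X = I +> x" "y \<in> W'" "Y = I +> y"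
        by blast
      then have "X \<otimes>\<^bsub>add_monoid R'\<^esub> Y = I +> (x \<oplus> y)"
        using W'(1) assms(1) by (auto simp: R'(2) a_rcos_sum subset_iff)
      then show ?thesis
        using W'(3)[OF xy(1,3)] by blast
    qed
  qed
qed

locale lifted_algebra = A: k_algebra K A
  for K :: "('k, 'c) ring_scheme" and A :: "('k, 'a, 'd) module_scheme" (structure) +
  fixes m :: nat and B :: "nat \<Rightarrow> 'a set set" and \<A> :: "nat \<Rightarrow> ('k, 'a set) module"
    and \<Delta> :: "(nat, 'e) pre_digraph" and \<epsilon> :: "'a set \<Rightarrow> 'a"
  assumes artinian: "left_artinian A"
    and \<epsilon>_hom: "\<epsilon> \<in> alg_hom K (semisimple_quot A) A"
    and \<epsilon>_lift: "Y \<in> carrier (semisimple_quot A) \<Longrightarrow> radical A +> \<epsilon> Y = Y"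
    and direct_sum: "ideal_direct_sum (semisimple_quot A) {1..m} B"
    and vertex_def: "\<A> i = ideal_alg (semisimple_quot A) (B i)"
    and vertex_simple: "i \<in> {1..m} \<Longrightarrow> simple_alg K (\<A> i)"
    and quiver: "quiver_of A m B \<Delta>"
begin

abbreviation "r \<equiv> radical A"
abbreviation "S \<equiv> semisimple_quot A"
text \<open>The interval is hidden behind a name, unfolded only for finiteness and where the
  assumptions of the locale are read off.\<close>

definition V :: "nat set"
  where "V = {1..m}"

lemma finite_V [simp]: "finite V"
  by (simp add: V_def)

sublocale S: k_algebra K "semisimple_quot A"
  by (rule A.quot_ideal_k_algebra[OF A.radical_ideal])

sublocale r: ideal "radical A" A
  by (rule A.radical_ideal)

lemma S_carrier: "carrier S = (\<lambda>x. r +> x) ` carrier A"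
  by (rule quot_alg_simps)

lemma eta_closed: "y \<in> carrier A \<Longrightarrow> r +> y \<in> carrier S"
  by (simp add: S_carrier)

lemmas eta_add = A.ideal_coset_add[OF A.radical_ideal]
  and eta_mult = A.ideal_coset_mult[OF A.radical_ideal]
  and eta_smult = A.ideal_coset_smult[OF A.radical_ideal]
  and eta_eq_iff = A.ideal_coset_eq_iff[OF A.radical_ideal]
  and eta_zero_iff = A.ideal_coset_eq_zero_iff[OF A.radical_ideal]

lemma S_zero: "\<zero>\<^bsub>S\<^esub> = r"
  by (rule quot_alg_simps)

lemmas \<epsilon>_closed = alg_homD(1)[OF \<epsilon>_hom]
  and \<epsilon>_mult = alg_homD(2)[OF \<epsilon>_hom]
  and \<epsilon>_add = alg_homD(3)[OF \<epsilon>_hom]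
  and \<epsilon>_one = alg_homD(4)[OF \<epsilon>_hom]
  and \<epsilon>_smult = alg_homD(5)[OF \<epsilon>_hom]

lemma \<epsilon>_zero: "\<epsilon> \<zero>\<^bsub>S\<^esub> = \<zero>"
  using ring_hom_ring.axioms(3)[OF alg_hom_ring_hom_ring[OF S.k_algebra_axioms A.k_algebra_axioms \<epsilon>_hom]]
    ring_hom_zero[OF _ S.ring_axioms A.ring_axioms] by (auto simp: ring_hom_ring_axioms_def)

text \<open>An element and the lift of its class have the same class. This is the decomposition of
  \<open>A\<close> into the lifted copy of \<open>A / r\<close> and \<open>r\<close>.\<close>

lemma minus_lift_in_radical:
  assumes "y \<in> carrier A"
  shows "y \<ominus> \<epsilon> (r +> y) \<in> r"
  using \<epsilon>_lift[OF eta_closed[OF assms]] assms eta_closed[OF assms] \<epsilon>_closed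
  by (simp add: eta_eq_iff[symmetric])

lemma V_verts: "verts \<Delta> = V"
  and fin_digraph: "fin_digraph \<Delta>"
  using quiver by (auto simp: quiver_of_def V_def)

lemma direct_sum_V: "ideal_direct_sum S V B"
  using direct_sum by (simp add: V_def)

lemma vertex_simps:
  "carrier (\<A> i) = B i" "mult (\<A> i) = mult S" "add (\<A> i) = add S" "smult (\<A> i) = smult S" "\<zero>\<^bsub>\<A> i\<^esub> = \<zero>\<^bsub>S\<^esub>"
  by (simp_all add: vertex_def ideal_alg_def)

lemma vertex_k_algebra: "i \<in> V \<Longrightarrow> k_algebra K (\<A> i)"
  using vertex_simple by (simp add: simple_alg_def V_def)

lemma B_ideal: "i \<in> V \<Longrightarrow> ideal (B i) S"
  using direct_sum_V by (simp add: ideal_direct_sum_def)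

lemma B_closed: "i \<in> V \<Longrightarrow> Y \<in> B i \<Longrightarrow> Y \<in> carrier S"
  using ideal.Icarr[OF B_ideal] by blast

section \<open>Orthogonal idempotents coming from the simple components\<close>

lemma decomposition_unique:
  assumes "f \<in> Pi\<^sub>E V B" "g \<in> Pi\<^sub>E V B" "finsum S f V = finsum S g V"
  shows "f = g"
proof -
  have "f \<in> V \<rightarrow> carrier S"
    using assms(1) B_closed by (auto simp: PiE_iff)
  then have "finsum S f V \<in> carrier S"
    by (rule S.finsum_closed)
  then have "\<exists>!f'. f' \<in> Pi\<^sub>E V B \<and> finsum S f V = finsum S f' V"
    using direct_sum_V by (simp add: ideal_direct_sum_def)
  then show ?thesis
    using assms by blast
qed

lemma finsum_single:
  assumes "i \<in> V" "Y \<in> carrier S"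
  shows "(\<Oplus>\<^bsub>S\<^esub> k \<in> V. if k = i then Y else \<zero>\<^bsub>S\<^esub>) = Y"
  using S.add.finprod_singleton_swap[of i V "\<lambda>_. Y"] assms by simp

text \<open>An element of two components would decompose in two ways, with all of it placed at
  \<open>i\<close> or all of it at \<open>j\<close>. Comparing the entries at \<open>i\<close> shows
  that it is zero.\<close>

lemma B_disjoint:
  assumes "i \<in> V" "j \<in> V" "i \<noteq> j" "Y \<in> B i" "Y \<in> B j"
  shows "Y = \<zero>\<^bsub>S\<^esub>"
proof -
  have zero: "\<zero>\<^bsub>S\<^esub> \<in> B k" if "k \<in> V" for k
    using additive_subgroup.zero_closed[OF ideal.axioms(1)[OF B_ideal[OF that]]] .
  define f where "f l = (\<lambda>k\<in>V. if k = l then Y else \<zero>\<^bsub>S\<^esub>)" for l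
  have f: "f l \<in> Pi\<^sub>E V B" "finsum S (f l) V = Y" if "l \<in> V" "Y \<in> B l" for l
  proof -
    show "f l \<in> Pi\<^sub>E V B"
      using that zero by (auto simp: f_def)
    have "finsum S (f l) V = (\<Oplus>\<^bsub>S\<^esub> k \<in> V. if k = l then Y else \<zero>\<^bsub>S\<^esub>)"
      using B_closed[OF that] by (intro S.finsum_cong') (auto simp: f_def)
    then show "finsum S (f l) V = Y"
      using finsum_single[OF that(1) B_closed[OF that]] by simp
  qed
  have "f i = f j"
    using f assms by (intro decomposition_unique) auto
  then have "f i i = f j i"
    by simp
  then show ?thesis
    using assms by (simp add: f_def)
qed

lemma B_mult_zero:
  assumes "i \<in> V" "j \<in> V" "i \<noteq> j" "X \<in> B i" "Y \<in> B j"
  shows "X \<otimes>\<^bsub>S\<^esub> Y = \<zero>\<^bsub>S\<^esub>"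
proof (rule B_disjoint[OF assms(1-3)])
  show "X \<otimes>\<^bsub>S\<^esub> Y \<in> B i"
    by (rule ideal.I_r_closed[OF B_ideal[OF assms(1)] assms(4) B_closed[OF assms(2,5)]])
  show "X \<otimes>\<^bsub>S\<^esub> Y \<in> B j"
    by (rule ideal.I_l_closed[OF B_ideal[OF assms(2)] assms(5) B_closed[OF assms(1,4)]])
qed

abbreviation "u i \<equiv> \<one>\<^bsub>\<A> i\<^esub>"

text \<open>The identity in \<open>ideal_alg\<close> is a definite description. That it denotes an
  identity of \<open>B i\<close> comes from \<open>simple_alg\<close>, which includes that the
  component is a \<open>k_algebra\<close>.\<close>

lemma u_in_B: "i \<in> V \<Longrightarrow> u i \<in> B i"
  and u_left: "i \<in> V \<Longrightarrow> Y \<in> B i \<Longrightarrow> u i \<otimes>\<^bsub>S\<^esub> Y = Y"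
  and u_right: "i \<in> V \<Longrightarrow> Y \<in> B i \<Longrightarrow> Y \<otimes>\<^bsub>S\<^esub> u i = Y"
proof -
  assume "i \<in> V"
  then interpret k_algebra K "\<A> i"
    by (rule vertex_k_algebra)
  show "u i \<in> B i" "Y \<in> B i \<Longrightarrow> u i \<otimes>\<^bsub>S\<^esub> Y = Y" "Y \<in> B i \<Longrightarrow> Y \<otimes>\<^bsub>S\<^esub> u i = Y"
    using one_closed l_one[of Y] r_one[of Y] by (auto simp: vertex_simps(1,2))
qed

text \<open>Decompose the identity of \<open>A / r\<close> as the sum of \<open>f j\<close> in
  \<open>B j\<close> and multiply by \<open>u i\<close>. Orthogonality leaves
  \<open>u i = f i\<close>.\<close>

lemma u_sum: "(\<Oplus>\<^bsub>S\<^esub> i \<in> V. u i) = \<one>\<^bsub>S\<^esub>"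
proof -
  obtain f where f: "f \<in> Pi\<^sub>E V B" "\<one>\<^bsub>S\<^esub> = finsum S f V"
  proof -
    have "\<exists>!f. f \<in> Pi\<^sub>E V B \<and> \<one>\<^bsub>S\<^esub> = finsum S f V"
      using direct_sum_V S.one_closed by (simp add: ideal_direct_sum_def)
    from ex1_implies_ex[OF this] show thesis
      by (elim exE conjE) (rule that)
  qed
  have fB: "f j \<in> B j" if "j \<in> V" for j
    using f(1) that by auto
  have fc: "f \<in> V \<rightarrow> carrier S"
    using fB B_closed by auto
  have eq: "f i = u i" if i: "i \<in> V" for i
  proof -
    have uc: "u i \<in> carrier S"
      using u_in_B[OF i] B_closed[OF i] by blast
    have "u i = u i \<otimes>\<^bsub>S\<^esub> finsum S f V"
      using uc f(2) by (metis S.r_one)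
    also have "\<dots> = (\<Oplus>\<^bsub>S\<^esub> j \<in> V. u i \<otimes>\<^bsub>S\<^esub> f j)"
      using uc fc by (intro S.finsum_rdistr) auto
    also have "\<dots> = (\<Oplus>\<^bsub>S\<^esub> j \<in> V. if j = i then f i else \<zero>\<^bsub>S\<^esub>)"
      using i fB fc B_mult_zero[OF i _ _ u_in_B[OF i]] u_left[OF i]
      by (intro S.finsum_cong') auto
    also have "\<dots> = f i"
      using finsum_single[OF i] fc i by auto
    finally show ?thesis
      by simp
  qed
  have "(\<Oplus>\<^bsub>S\<^esub> i \<in> V. u i) = finsum S f V"
    using fc by (intro S.finsum_cong') (auto simp: eq)
  then show ?thesis
    using f(2) by simp
qed

abbreviation "e i \<equiv> \<epsilon> (u i)"

lemma u_closed: "i \<in> V \<Longrightarrow> u i \<in> carrier S"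
  using B_closed u_in_B by blast

lemma e_closed: "i \<in> V \<Longrightarrow> e i \<in> carrier A"
  using \<epsilon>_closed u_closed by blast

lemma \<epsilon>_finsum:
  assumes "finite I" "f \<in> I \<rightarrow> carrier S"
  shows "\<epsilon> (finsum S f I) = (\<Oplus> i \<in> I. \<epsilon> (f i))"
  using assms
proof (induct I)
  case (insert i I)
  then have "f \<in> I \<rightarrow> carrier S" "f i \<in> carrier S" "(\<lambda>i. \<epsilon> (f i)) \<in> I \<rightarrow> carrier A"
    using \<epsilon>_closed by auto
  then show ?case
    using insert by (simp add: \<epsilon>_add \<epsilon>_closed)
qed (simp add: \<epsilon>_zero)

lemma e_sum: "(\<Oplus> i \<in> V. e i) = \<one>"
  using \<epsilon>_finsum[of V u] u_closed by (simp add: u_sum \<epsilon>_one)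

lemma e_left: "i \<in> V \<Longrightarrow> Y \<in> B i \<Longrightarrow> e i \<otimes> \<epsilon> Y = \<epsilon> Y"
  using \<epsilon>_mult[OF u_closed[of i] B_closed[of i Y]] by (simp add: u_left)

lemma e_right: "i \<in> V \<Longrightarrow> Y \<in> B i \<Longrightarrow> \<epsilon> Y \<otimes> e i = \<epsilon> Y"
  using \<epsilon>_mult[OF B_closed[of i Y] u_closed[of i]] by (simp add: u_right)

lemma e_idem: "i \<in> V \<Longrightarrow> e i \<otimes> e i = e i"
  by (simp add: e_left u_in_B)

lemma pseudo_path_data: "pseudo_path_data K \<Delta> \<A>"
proof -
  interpret fin_digraph \<Delta>
    by (rule fin_digraph)
  show ?thesis
  proof (intro pseudo_path_data.intro pseudo_path_data_axioms.intro)
    show "field K"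
      by (rule A.R.field_axioms)
    show "k_algebra K (\<A> i)" if "i \<in> verts \<Delta>" for i
      using that vertex_k_algebra by (simp only: V_verts)
  qed simp_all
qed

text \<open>The components are subsets of \<open>A / r\<close> with the inherited operations, so one
  map \<open>\<epsilon>\<close> serves at every vertex. Orthogonality of its images comes from the
  products between different components being zero.\<close>

lemma path_evaluation:
  assumes "\<And>\<beta>. \<beta> \<in> arcs \<Delta> \<Longrightarrow> x \<beta> \<in> carrier A"
  shows "path_evaluation K \<Delta> \<A> A (\<lambda>_. \<epsilon>) x"
proof -
  interpret pseudo_path_data K \<Delta> \<A>
    by (rule pseudo_path_data)
  show ?thesis
  proof (unfold_locales, unfold V_verts vertex_simps)
    show "\<epsilon> a \<in> carrier A" if "i \<in> V" "a \<in> B i" for i a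
      using that B_closed \<epsilon>_closed by blast
    show "\<epsilon> (c \<odot>\<^bsub>S\<^esub> a \<oplus>\<^bsub>S\<^esub> a') = c \<odot> \<epsilon> a \<oplus> \<epsilon> a'" if "i \<in> V" "c \<in> carrier K" "a \<in> B i" "a' \<in> B i" for i c a a'
      using that B_closed[of i] by (simp add: \<epsilon>_add \<epsilon>_smult)
    show "\<epsilon> (a \<otimes>\<^bsub>S\<^esub> b) = \<epsilon> a \<otimes> \<epsilon> b" if "i \<in> V" "a \<in> B i" "b \<in> B i" for i a b
      using that B_closed[of i] by (simp add: \<epsilon>_mult)
    show "\<epsilon> a \<otimes> \<epsilon> b = \<zero>" if "i \<in> V" "j \<in> V" "i \<noteq> j" "a \<in> B i" "b \<in> B j" for i j a b
      using that B_mult_zero[OF that] \<epsilon>_mult[of a b] B_closed[of i] B_closed[of j] by (simp add: \<epsilon>_zero)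
    show "(\<Oplus> i \<in> V. e i) = \<one>"
      by (rule e_sum)
  qed (use assms in auto)
qed

section \<open>The bimodule \<open>r / r2\<close> over the semisimple quotient\<close>

abbreviation "r2 \<equiv> ideal_prod A r r"
abbreviation "q y \<equiv> r2 +> y"

sublocale r2: ideal "ideal_prod A (radical A) (radical A)" A
  by (rule A.ideal_prod_is_ideal[OF A.radical_ideal A.radical_ideal])

lemma r2_subset_r: "r2 \<subseteq> r"
  using A.ideal_prod_inter[OF A.radical_ideal A.radical_ideal] by blast

lemmas q_eq_iff = A.ideal_coset_eq_iff[OF r2.is_ideal]

lemma q_zero: "q \<zero> = r2"
  by (rule A.a_coset_add_zero[OF r2.a_subset])

abbreviation "L \<equiv> rad_layer A"

lemma layer_simps:
  "carrier L = (\<lambda>y. q y) ` r" "add L = set_add A" "\<zero>\<^bsub>L\<^esub> = r2"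
  "lact L = rcoset_mult A r2" "ract L = rcoset_mult A r2"
  by (simp_all add: rad_layer_def Let_def FactRing_def ring.defs bimodule.defs)

abbreviation "M i j \<equiv> bimod_prod (ideal_alg S (B i)) L (ideal_alg S (B j))"

lemma ideal_alg_carrier: "carrier (ideal_alg S (B i)) = B i"
  by (simp add: ideal_alg_def)

lemma M_simps:
  "add (M i j) = set_add A" "\<zero>\<^bsub>M i j\<^esub> = r2" "lact (M i j) = rcoset_mult A r2" "ract (M i j) = rcoset_mult A r2"
  by (simp_all add: bimod_prod_def layer_simps)

text \<open>A coset of \<open>r\<close> is multiplied with a coset of \<open>r2\<close>. Changing
  the first representative by an element of \<open>r\<close> changes the product by an element of
  \<open>r2\<close>, because \<open>y\<close> is itself in \<open>r\<close>. The action can thus be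
  computed with the lift \<open>\<epsilon> Z\<close>, and so inside \<open>A\<close>.\<close>

lemma lact_q:
  assumes "Z \<in> carrier S" "y \<in> r"
  shows "rcoset_mult A r2 Z (q y) = q (\<epsilon> Z \<otimes> y)"
proof -
  have Z: "\<epsilon> Z \<in> carrier A" "Z = r +> \<epsilon> Z"
    using assms(1) \<epsilon>_closed \<epsilon>_lift by auto
  have yc: "y \<in> carrier A"
    using assms(2) by simp
  have *: "q (z \<otimes> y') = q (\<epsilon> Z \<otimes> y)" if zy: "z \<in> Z" "y' \<in> q y" for z y'
  proof -
    obtain a where a: "a \<in> r" "z = a \<oplus> \<epsilon> Z"
      using zy(1) Z(2) by (auto simp: a_r_coset_def')
    obtain b where b: "b \<in> r2" "y' = b \<oplus> y"
      using zy(2) by (auto simp: a_r_coset_def')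
    have c: "a \<in> carrier A" "b \<in> carrier A"
      using a b by simp_all
    have "z \<otimes> y' \<ominus> \<epsilon> Z \<otimes> y = (a \<oplus> \<epsilon> Z) \<otimes> b \<oplus> a \<otimes> y"
      unfolding a(2) b(2) using c Z(1) yc by algebra
    moreover have "(a \<oplus> \<epsilon> Z) \<otimes> b \<in> r2" "a \<otimes> y \<in> r2"
      using r2.I_l_closed[OF b(1), of "a \<oplus> \<epsilon> Z"] c Z(1) ideal_prod.prod[OF a(1) assms(2), of A] by auto
    ultimately have "z \<otimes> y' \<ominus> \<epsilon> Z \<otimes> y \<in> r2"
      using r2.a_closed by metis
    then show ?thesis
      using c Z(1) yc a b by (simp add: q_eq_iff)
  qed
  have "\<epsilon> Z \<in> Z" "y \<in> q y"
    using Z r.a_rcos_self[OF Z(1)] r2.a_rcos_self[OF yc] by auto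
  then show ?thesis
    unfolding rcoset_mult_def using * by blast
qed

lemma ract_q:
  assumes "Z \<in> carrier S" "y \<in> r"
  shows "rcoset_mult A r2 (q y) Z = q (y \<otimes> \<epsilon> Z)"
proof -
  have Z: "\<epsilon> Z \<in> carrier A" "Z = r +> \<epsilon> Z"
    using assms(1) \<epsilon>_closed \<epsilon>_lift by auto
  have yc: "y \<in> carrier A"
    using assms(2) by simp
  have *: "q (y' \<otimes> z) = q (y \<otimes> \<epsilon> Z)" if zy: "z \<in> Z" "y' \<in> q y" for z y'
  proof -
    obtain a where a: "a \<in> r" "z = a \<oplus> \<epsilon> Z"
      using zy(1) Z(2) by (auto simp: a_r_coset_def')
    obtain b where b: "b \<in> r2" "y' = b \<oplus> y"
      using zy(2) by (auto simp: a_r_coset_def')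
    have c: "a \<in> carrier A" "b \<in> carrier A"
      using a b by simp_all
    have "y' \<otimes> z \<ominus> y \<otimes> \<epsilon> Z = b \<otimes> (a \<oplus> \<epsilon> Z) \<oplus> y \<otimes> a"
      unfolding a(2) b(2) using c Z(1) yc by algebra
    moreover have "b \<otimes> (a \<oplus> \<epsilon> Z) \<in> r2" "y \<otimes> a \<in> r2"
      using r2.I_r_closed[OF b(1), of "a \<oplus> \<epsilon> Z"] c Z(1) ideal_prod.prod[OF assms(2) a(1), of A] by auto
    ultimately have "y' \<otimes> z \<ominus> y \<otimes> \<epsilon> Z \<in> r2"
      using r2.a_closed by metis
    then show ?thesis
      using c Z(1) yc a b by (simp add: q_eq_iff)
  qed
  have "\<epsilon> Z \<in> Z" "y \<in> q y"
    using Z r.a_rcos_self[OF Z(1)] r2.a_rcos_self[OF yc] by auto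
  then show ?thesis
    unfolding rcoset_mult_def using * by blast
qed


text \<open>The Peirce component of the radical for the idempotents \<open>e i\<close> and
  \<open>e j\<close>, described by fixed points so that membership is an equation.\<close>

definition corner :: "nat \<Rightarrow> nat \<Rightarrow> 'a set"
  where "corner i j = {y \<in> r. e i \<otimes> y \<otimes> e j = y}"

context
  fixes i j assumes ij: "i \<in> V" "j \<in> V"
begin

lemma e_carrier: "e i \<in> carrier A" "e j \<in> carrier A"
  using e_closed ij by auto

lemma corner_carrier: "y \<in> corner i j \<Longrightarrow> y \<in> carrier A"
  by (simp add: corner_def)

lemma corner_I:
  assumes "y \<in> r"
  shows "e i \<otimes> y \<otimes> e j \<in> corner i j"
proof -
  have yc: "y \<in> carrier A"
    using assms by simp
  have "e i \<otimes> (e i \<otimes> y \<otimes> e j) \<otimes> e j = (e i \<otimes> e i) \<otimes> y \<otimes> (e j \<otimes> e j)"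
    using e_carrier yc by (simp add: A.m_assoc)
  then show ?thesis
    using r.I_r_closed[OF r.I_l_closed[OF assms]] e_carrier by (simp add: corner_def e_idem ij)
qed

lemma corner_left:
  assumes "a \<in> B i" "y \<in> corner i j"
  shows "\<epsilon> a \<otimes> y \<in> corner i j"
proof -
  have c: "\<epsilon> a \<in> carrier A" "y \<in> carrier A" "y \<in> r" "e i \<otimes> y \<otimes> e j = y"
    using assms B_closed[OF ij(1)] \<epsilon>_closed by (auto simp: corner_def)
  have "e i \<otimes> (\<epsilon> a \<otimes> y) \<otimes> e j = (e i \<otimes> \<epsilon> a) \<otimes> (y \<otimes> e j)"
    using c e_carrier by (simp add: A.m_assoc)
  also have "\<dots> = (\<epsilon> a \<otimes> e i) \<otimes> (y \<otimes> e j)"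
    using e_left[OF ij(1) assms(1)] e_right[OF ij(1) assms(1)] by simp
  also have "\<dots> = \<epsilon> a \<otimes> (e i \<otimes> y \<otimes> e j)"
    using c(1,2) e_carrier by (simp add: A.m_assoc)
  finally show ?thesis
    using c r.I_l_closed by (simp add: corner_def)
qed

lemma corner_right:
  assumes "a \<in> B j" "y \<in> corner i j"
  shows "y \<otimes> \<epsilon> a \<in> corner i j"
proof -
  have c: "\<epsilon> a \<in> carrier A" "y \<in> carrier A" "y \<in> r" "e i \<otimes> y \<otimes> e j = y"
    using assms B_closed[OF ij(2)] \<epsilon>_closed by (auto simp: corner_def)
  have "e i \<otimes> (y \<otimes> \<epsilon> a) \<otimes> e j = (e i \<otimes> y) \<otimes> (\<epsilon> a \<otimes> e j)"
    using c e_carrier by (simp add: A.m_assoc)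
  also have "\<dots> = (e i \<otimes> y) \<otimes> (e j \<otimes> \<epsilon> a)"
    using e_left[OF ij(2) assms(1)] e_right[OF ij(2) assms(1)] by simp
  also have "\<dots> = (e i \<otimes> y \<otimes> e j) \<otimes> \<epsilon> a"
    using c(1,2) e_carrier by (simp add: A.m_assoc)
  finally show ?thesis
    using c r.I_r_closed by (simp add: corner_def)
qed

lemma corner_group:
  "corner i j \<subseteq> carrier A" "\<zero> \<in> corner i j"
  "\<And>x y. x \<in> corner i j \<Longrightarrow> y \<in> corner i j \<Longrightarrow> x \<oplus> y \<in> corner i j"
  "\<And>x. x \<in> corner i j \<Longrightarrow> \<ominus> x \<in> corner i j"
proof -
  show "corner i j \<subseteq> carrier A" "\<zero> \<in> corner i j"
    using e_carrier by (auto simp: corner_def)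
  show "x \<oplus> y \<in> corner i j" if "x \<in> corner i j" "y \<in> corner i j" for x y
    using that e_carrier by (simp add: corner_def A.l_distr A.r_distr)
  show "\<ominus> x \<in> corner i j" if "x \<in> corner i j" for x
    using that e_carrier by (simp add: corner_def A.l_minus A.r_minus)
qed

lemma r_group:
  "r \<subseteq> carrier A" "\<zero> \<in> r" "\<And>x y. x \<in> r \<Longrightarrow> y \<in> r \<Longrightarrow> x \<oplus> y \<in> r" "\<And>x. x \<in> r \<Longrightarrow> \<ominus> x \<in> r"
  using r.a_subset by auto

text \<open>Lifts from \<open>B i\<close> and \<open>B j\<close> absorb \<open>e i\<close> and
  \<open>e j\<close>, so every generator of the product bimodule is the class of a corner element.
  Conversely, acting by \<open>u i\<close> and \<open>u j\<close> fixes the class of a corner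
  element and exhibits it as a generator.\<close>

lemma M_carrier: "carrier (M i j) = (\<lambda>y. q y) ` corner i j"
proof
  let ?gens = "{ract L (lact L a X) b | a X b. a \<in> B i \<and> X \<in> carrier L \<and> b \<in> B j}"
  have M: "carrier (M i j) = generate (add_monoid L) ?gens"
    by (simp add: bimod_prod_def ideal_alg_carrier)
  interpret group "add_monoid L"
    by (rule r2.coset_group(1)[OF r_group layer_simps(1-3)])
  have act: "ract L (lact L a (q y)) b = q (\<epsilon> a \<otimes> y \<otimes> \<epsilon> b)" if "a \<in> B i" "y \<in> r" "b \<in> B j" for a y b
  proof -
    have "a \<in> carrier S" "b \<in> carrier S"
      using that B_closed ij by blast+
    then show ?thesis
      using that r.I_l_closed[OF that(2) \<epsilon>_closed] by (simp add: layer_simps lact_q ract_q)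
  qed
  show "carrier (M i j) \<subseteq> (\<lambda>y. q y) ` corner i j"
    unfolding M
  proof (rule generate_subgroup_incl)
    show "subgroup ((\<lambda>y. q y) ` corner i j) (add_monoid L)"
      using r2.coset_additive_subgroup[OF r_group layer_simps(1-3) _ corner_group(2-4)]
      by (auto simp: additive_subgroup_def corner_def)
    show "?gens \<subseteq> (\<lambda>y. q y) ` corner i j"
    proof
      fix Z assume "Z \<in> ?gens"
      then obtain a y b where ayb: "a \<in> B i" "y \<in> r" "b \<in> B j" "Z = ract L (lact L a (q y)) b"
        unfolding layer_simps(1) by blast
      have c: "\<epsilon> a \<in> carrier A" "\<epsilon> b \<in> carrier A" "y \<in> carrier A"
        using ayb B_closed[OF ij(1)] B_closed[OF ij(2)] \<epsilon>_closed by auto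
      have "\<epsilon> a \<otimes> y \<otimes> \<epsilon> b = (e i \<otimes> \<epsilon> a) \<otimes> y \<otimes> (\<epsilon> b \<otimes> e j)"
        by (simp add: e_left e_right ij ayb)
      also have "\<dots> = e i \<otimes> (\<epsilon> a \<otimes> y \<otimes> \<epsilon> b) \<otimes> e j"
        using c e_carrier by (simp add: A.m_assoc)
      finally have "\<epsilon> a \<otimes> y \<otimes> \<epsilon> b \<in> corner i j"
        using corner_I[OF r.I_r_closed[OF r.I_l_closed[OF ayb(2) c(1)] c(2)]] by simp
      then show "Z \<in> (\<lambda>y. q y) ` corner i j"
        using act[OF ayb(1-3)] ayb(4) by simp
    qed
  qed
  show "(\<lambda>y. q y) ` corner i j \<subseteq> carrier (M i j)"
  proof
    fix Z assume "Z \<in> (\<lambda>y. q y) ` corner i j"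
    then obtain y where y: "y \<in> corner i j" "Z = q y"
      by blast
    then have "Z = ract L (lact L (u i) (q y)) (u j)" "y \<in> r"
      using act[OF u_in_B[OF ij(1)] _ u_in_B[OF ij(2)], of y] by (auto simp: corner_def)
    then have "Z \<in> ?gens"
      unfolding layer_simps(1) using u_in_B ij by blast
    then show "Z \<in> carrier (M i j)"
      unfolding M by (rule generate.incl)
  qed
qed

definition sub_bimodule :: "'a set set \<Rightarrow> bool"
  where "sub_bimodule N \<longleftrightarrow> additive_subgroup N (M i j) \<and>
    (\<forall>a\<in>B i. \<forall>X\<in>N. rcoset_mult A r2 a X \<in> N) \<and> (\<forall>X\<in>N. \<forall>b\<in>B j. rcoset_mult A r2 X b \<in> N)"

abbreviation "corner_span G \<equiv> bimod_span (ideal_alg S (B i)) (ideal_alg S (B j)) (M i j) G"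

lemma corner_span_eq: "corner_span G = \<Inter> {N. sub_bimodule N \<and> G \<subseteq> N}"
  unfolding bimod_span_def sub_bimodule_def M_simps ideal_alg_carrier
  by (rule arg_cong[of _ _ Inter]) blast

lemma sub_bimodule_corner:
  assumes "W \<subseteq> corner i j" "\<zero> \<in> W" "\<And>x y. x \<in> W \<Longrightarrow> y \<in> W \<Longrightarrow> x \<oplus> y \<in> W" "\<And>x. x \<in> W \<Longrightarrow> \<ominus> x \<in> W"
    and left: "\<And>a x. a \<in> B i \<Longrightarrow> x \<in> W \<Longrightarrow> \<epsilon> a \<otimes> x \<in> W"
    and right: "\<And>a x. a \<in> B j \<Longrightarrow> x \<in> W \<Longrightarrow> x \<otimes> \<epsilon> a \<in> W"
  shows "sub_bimodule ((\<lambda>y. q y) ` W)"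
  unfolding sub_bimodule_def
proof (intro conjI ballI)
  show "additive_subgroup ((\<lambda>y. q y) ` W) (M i j)"
    by (rule r2.coset_additive_subgroup[OF corner_group M_carrier M_simps(1,2) assms(1-4)])
  have Wr: "y \<in> r" if "y \<in> W" for y
    using that assms(1) by (auto simp: corner_def)
  show "rcoset_mult A r2 a X \<in> (\<lambda>y. q y) ` W" if "a \<in> B i" "X \<in> (\<lambda>y. q y) ` W" for a X
    using that left Wr B_closed[OF ij(1)] by (auto simp: lact_q)
  show "rcoset_mult A r2 X a \<in> (\<lambda>y. q y) ` W" if "X \<in> (\<lambda>y. q y) ` W" "a \<in> B j" for a X
    using that right Wr B_closed[OF ij(2)] by (auto simp: ract_q)
qed

lemma sub_bimodule_M: "sub_bimodule (carrier (M i j))"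
  unfolding M_carrier by (rule sub_bimodule_corner[OF order_refl corner_group(2-4) corner_left corner_right])


text \<open>Left multiplication by \<open>r\<close> annihilates \<open>r\<close> modulo
  \<open>r2\<close>, so finitely many elements \<open>X\<close> of \<open>r\<close> generate this
  layer as a left module. Their corners generate the bimodule. Without such a finite set, the least
  cardinality in \<open>bimod_rank\<close> would carry no information.\<close>

lemma corner_finitely_generated: "\<exists>G \<subseteq> carrier (M i j). finite G \<and> corner_span G = carrier (M i j)"
proof -
  obtain X where X: "finite X" "X \<subseteq> r" "\<And>I. left_ideal I A \<Longrightarrow> r2 \<subseteq> I \<Longrightarrow> X \<subseteq> I \<Longrightarrow> r \<subseteq> I"
  proof (rule A.semisimple_layer_finitely_generated[OF artinian A.radical_left_ideal _ r2_subset_r])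
    show "left_ideal r2 A"
      by (rule A.left_ideal_of_ideal[OF r2.is_ideal])
    show "a \<otimes> x \<in> r2" if "a \<in> r" "x \<in> r" for a x
      using that by (rule ideal_prod.prod)
  qed (use that in blast)
  let ?G = "(\<lambda>x. q (e i \<otimes> x \<otimes> e j)) ` X"
  have G: "finite ?G" "?G \<subseteq> carrier (M i j)"
    using X(1,2) corner_I by (auto simp: M_carrier)
  have "carrier (M i j) \<subseteq> N" if N: "sub_bimodule N" "?G \<subseteq> N" for N
  proof -
    interpret N: additive_subgroup N "M i j"
      using N(1) by (simp add: sub_bimodule_def)
    have N0: "r2 \<in> N"
      using N.zero_closed by (simp add: M_simps)
    have Nadd: "X \<in> N \<Longrightarrow> Y \<in> N \<Longrightarrow> X <+>\<^bsub>A\<^esub> Y \<in> N" for X Y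
      using N.a_closed[of X Y] by (simp add: M_simps)
    have Nact: "rcoset_mult A r2 a X \<in> N" if "a \<in> B i" "X \<in> N" for a X
      using N(1) that by (simp add: sub_bimodule_def)
    \<comment> \<open>The generation property of \<open>X\<close> speaks of left ideals of
      \<open>A\<close>, so the sub-bimodule \<open>N\<close> is pulled back to one. Quantifying over
      all \<open>a\<close> in \<open>B i\<close> is what makes it stable under left multiplication
      by all of \<open>A\<close>.\<close>
    define I where "I = {y \<in> r. \<forall>a\<in>B i. q (\<epsilon> a \<otimes> y \<otimes> e j) \<in> N}"
    have \<epsilon>c: "\<epsilon> a \<in> carrier A" if "a \<in> B i" for a
      using that B_closed ij \<epsilon>_closed by blast
    have "left_ideal I A"
    proof (rule A.left_idealI)
      show "I \<subseteq> carrier A"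
        by (auto simp: I_def)
      show "\<zero> \<in> I"
        using \<epsilon>c e_carrier N0 by (auto simp: I_def q_zero)
      show "x \<oplus> y \<in> I" if xy: "x \<in> I" "y \<in> I" for x y
      proof -
        have c: "x \<in> r" "y \<in> r" "x \<in> carrier A" "y \<in> carrier A"
          using xy by (auto simp: I_def)
        have "q (\<epsilon> a \<otimes> (x \<oplus> y) \<otimes> e j) \<in> N" if a: "a \<in> B i" for a
        proof -
          have "\<epsilon> a \<otimes> (x \<oplus> y) \<otimes> e j = \<epsilon> a \<otimes> x \<otimes> e j \<oplus> \<epsilon> a \<otimes> y \<otimes> e j"
            using c \<epsilon>c[OF a] e_carrier by (simp add: A.l_distr A.r_distr)
          then have "q (\<epsilon> a \<otimes> (x \<oplus> y) \<otimes> e j) = q (\<epsilon> a \<otimes> x \<otimes> e j) <+>\<^bsub>A\<^esub> q (\<epsilon> a \<otimes> y \<otimes> e j)"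
            using c \<epsilon>c[OF a] e_carrier by (simp add: r2.a_rcos_sum)
          then show ?thesis
            using Nadd xy a by (simp add: I_def)
        qed
        then show ?thesis
          using c by (simp add: I_def)
      qed
      show "c \<otimes> y \<in> I" if cy: "c \<in> carrier A" "y \<in> I" for c y
      proof -
        have y: "y \<in> r" "y \<in> carrier A"
          using cy by (auto simp: I_def)
        have "q (\<epsilon> a \<otimes> (c \<otimes> y) \<otimes> e j) \<in> N" if a: "a \<in> B i" for a
        proof -
          \<comment> \<open>The component \<open>B i\<close> absorbs the class of \<open>c\<close>.
            The lift of the product differs from \<open>\<epsilon> a \<otimes> c\<close> by an
            element of \<open>r\<close>, which becomes invisible modulo \<open>r2\<close> after
            multiplication with \<open>y\<close> in \<open>r\<close>.\<close>
          let ?b = "a \<otimes>\<^bsub>S\<^esub> (r +> c)"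
          have b: "?b \<in> B i"
            by (rule ideal.I_r_closed[OF B_ideal[OF ij(1)] a eta_closed[OF cy(1)]])
          have aS: "a \<in> carrier S"
            by (rule B_closed[OF ij(1) a])
          have "\<epsilon> a \<otimes> c \<ominus> \<epsilon> ?b = \<epsilon> a \<otimes> (c \<ominus> \<epsilon> (r +> c))"
            using \<epsilon>_mult[OF aS eta_closed[OF cy(1)]] \<epsilon>c[OF a] cy(1) \<epsilon>_closed[OF eta_closed[OF cy(1)]]
            by (simp add: a_minus_def A.r_distr A.r_minus)
          then have d: "\<epsilon> a \<otimes> c \<ominus> \<epsilon> ?b \<in> r"
            using r.I_l_closed[OF minus_lift_in_radical[OF cy(1)] \<epsilon>c[OF a]] by simp
          have "\<epsilon> a \<otimes> (c \<otimes> y) \<otimes> e j \<ominus> \<epsilon> ?b \<otimes> y \<otimes> e j = (\<epsilon> a \<otimes> c \<ominus> \<epsilon> ?b) \<otimes> y \<otimes> e j"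
            using \<epsilon>c[OF a] \<epsilon>c[OF b] cy(1) y(2) e_carrier(2) by algebra
          also have "\<dots> \<in> r2"
            by (rule r2.I_r_closed[OF ideal_prod.prod[OF d y(1)] e_carrier(2)])
          finally have "q (\<epsilon> a \<otimes> (c \<otimes> y) \<otimes> e j) = q (\<epsilon> ?b \<otimes> y \<otimes> e j)"
            using \<epsilon>c[OF a] \<epsilon>c[OF b] cy(1) y(2) e_carrier(2) by (simp add: q_eq_iff)
          then show ?thesis
            using cy(2) b by (simp add: I_def)
        qed
        then show ?thesis
          using r.I_l_closed[OF y(1) cy(1)] by (simp add: I_def)
      qed
    qed
    moreover have "r2 \<subseteq> I"
    proof
      fix y assume y: "y \<in> r2"
      have "q (\<epsilon> a \<otimes> y \<otimes> e j) \<in> N" if a: "a \<in> B i" for a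
        using r2.a_rcos_const[OF r2.I_r_closed[OF r2.I_l_closed[OF y \<epsilon>c[OF a]] e_carrier(2)]] N0 by simp
      then show "y \<in> I"
        using y r2_subset_r by (auto simp: I_def)
    qed
    moreover have "X \<subseteq> I"
    proof
      fix y assume y: "y \<in> X"
      then have yr: "y \<in> r" "y \<in> carrier A"
        using X(2) by auto
      have "q (\<epsilon> a \<otimes> y \<otimes> e j) \<in> N" if a: "a \<in> B i" for a
      proof -
        have "rcoset_mult A r2 a (q (e i \<otimes> y \<otimes> e j)) \<in> N"
          using Nact[OF a] N(2) y by blast
        moreover have "rcoset_mult A r2 a (q (e i \<otimes> y \<otimes> e j)) = q (\<epsilon> a \<otimes> (e i \<otimes> y \<otimes> e j))"
          using corner_I[OF yr(1)] by (intro lact_q B_closed[OF ij(1) a]) (auto simp: corner_def)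
        moreover have "\<epsilon> a \<otimes> (e i \<otimes> y \<otimes> e j) = (\<epsilon> a \<otimes> e i) \<otimes> y \<otimes> e j"
          using \<epsilon>c[OF a] e_carrier yr(2) by (simp add: A.m_assoc)
        ultimately show ?thesis
          by (simp add: e_right[OF ij(1) a])
      qed
      then show "y \<in> I"
        using yr by (auto simp: I_def)
    qed
    ultimately have rI: "r \<subseteq> I"
      by (rule X(3))
    show ?thesis
    proof
      fix Z assume "Z \<in> carrier (M i j)"
      then obtain y where y: "y \<in> corner i j" "Z = q y"
        by (auto simp: M_carrier)
      then have "y \<in> r" "e i \<otimes> y \<otimes> e j = y"
        by (auto simp: corner_def)
      then have "q (e i \<otimes> y \<otimes> e j) \<in> N" "e i \<otimes> y \<otimes> e j = y"
        using subsetD[OF rI \<open>y \<in> r\<close>] u_in_B[OF ij(1)] unfolding I_def by blast+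
      then show "Z \<in> N"
        using y(2) by simp
    qed
  qed
  then have "corner_span ?G = carrier (M i j)"
    unfolding corner_span_eq using sub_bimodule_M G(2) by blast
  then show ?thesis
    using G by blast
qed

text \<open>The number of arrows from \<open>i\<close> to \<open>j\<close> is the rank, so a
  generating set of least size is in bijection with these arrows. Its members are then lifted from
  classes to elements of the corner.\<close>

lemma corner_generators:
  obtains x where "\<And>\<beta>. \<beta> \<in> arcs \<Delta> \<Longrightarrow> tail \<Delta> \<beta> = i \<Longrightarrow> head \<Delta> \<beta> = j \<Longrightarrow> x \<beta> \<in> corner i j"
    "corner_span ((\<lambda>\<beta>. q (x \<beta>)) ` {\<beta> \<in> arcs \<Delta>. tail \<Delta> \<beta> = i \<and> head \<Delta> \<beta> = j}) = carrier (M i j)"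
proof -
  let ?arcs = "{\<beta> \<in> arcs \<Delta>. tail \<Delta> \<beta> = i \<and> head \<Delta> \<beta> = j}"
  define rank where "rank n \<longleftrightarrow> (\<exists>G \<subseteq> carrier (M i j). finite G \<and> card G = n \<and> corner_span G = carrier (M i j))" for n
  have "\<exists>n. rank n"
    using corner_finitely_generated unfolding rank_def by blast
  then have "rank (LEAST n. rank n)"
    by (rule LeastI_ex)
  moreover have "card ?arcs = (LEAST n. rank n)"
    using quiver ij by (simp add: quiver_of_def Let_def bimod_rank_def rank_def[abs_def] V_def)
  ultimately obtain G where G: "G \<subseteq> carrier (M i j)" "finite G" "card G = card ?arcs" "corner_span G = carrier (M i j)"
    by (auto simp: rank_def)
  interpret fin_digraph \<Delta>
    by (rule fin_digraph)
  obtain g where g: "bij_betw g ?arcs G"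
    using finite_same_card_bij[of ?arcs G] G(2,3) by auto
  have "\<exists>y. y \<in> corner i j \<and> q y = g \<beta>" if "\<beta> \<in> ?arcs" for \<beta>
  proof -
    have "g \<beta> \<in> (\<lambda>y. q y) ` corner i j"
      using bij_betwE[OF g] that G(1) unfolding M_carrier by blast
    then obtain y where "y \<in> corner i j" "g \<beta> = q y"
      by blast
    then show ?thesis
      by metis
  qed
  then obtain x where x: "\<And>\<beta>. \<beta> \<in> ?arcs \<Longrightarrow> x \<beta> \<in> corner i j \<and> q (x \<beta>) = g \<beta>"
    by metis
  have "(\<lambda>\<beta>. q (x \<beta>)) ` ?arcs = g ` ?arcs"
    using x by (intro image_cong) auto
  then have "(\<lambda>\<beta>. q (x \<beta>)) ` ?arcs = G"
    using g by (simp add: bij_betw_def)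
  then show thesis
    using that[of x] x G(4) by simp
qed

end

end

context lifted_algebra
begin

text \<open>The families chosen for the pairs of vertices fit together into a single one because an
  arrow belongs to exactly one pair.\<close>

lemma arrow_generators:
  obtains x where "\<And>\<beta>. \<beta> \<in> arcs \<Delta> \<Longrightarrow> x \<beta> \<in> corner (tail \<Delta> \<beta>) (head \<Delta> \<beta>)"
    "\<And>i j. i \<in> V \<Longrightarrow> j \<in> V \<Longrightarrow>
      corner_span i j ((\<lambda>\<beta>. q (x \<beta>)) ` {\<beta> \<in> arcs \<Delta>. tail \<Delta> \<beta> = i \<and> head \<Delta> \<beta> = j}) = carrier (M i j)"
proof -
  define gens where "gens i j x \<longleftrightarrow>
      (\<forall>\<beta>\<in>arcs \<Delta>. tail \<Delta> \<beta> = i \<longrightarrow> head \<Delta> \<beta> = j \<longrightarrow> x \<beta> \<in> corner i j) \<and>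
      corner_span i j ((\<lambda>\<beta>. q (x \<beta>)) ` {\<beta> \<in> arcs \<Delta>. tail \<Delta> \<beta> = i \<and> head \<Delta> \<beta> = j}) = carrier (M i j)"
    for i j and x :: "'e \<Rightarrow> 'a"
  have ex: "\<exists>x. gens i j x" if "i \<in> V" "j \<in> V" for i j
  proof (rule corner_generators[OF that])
    fix x
    assume x: "\<And>\<beta>. \<beta> \<in> arcs \<Delta> \<Longrightarrow> tail \<Delta> \<beta> = i \<Longrightarrow> head \<Delta> \<beta> = j \<Longrightarrow> x \<beta> \<in> corner i j"
      "corner_span i j ((\<lambda>\<beta>. q (x \<beta>)) ` {\<beta> \<in> arcs \<Delta>. tail \<Delta> \<beta> = i \<and> head \<Delta> \<beta> = j}) = carrier (M i j)"
    have "gens i j x"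
      unfolding gens_def by (intro conjI ballI impI x)
    then show "\<exists>x. gens i j x"
      by (rule exI[of _ x])
  qed
  define X where "X i j = (SOME x. gens i j x)" for i j
  have gens: "gens i j (X i j)" if "i \<in> V" "j \<in> V" for i j
    unfolding X_def by (rule someI_ex[OF ex[OF that]])
  have X: "X i j \<beta> \<in> corner i j"
    if "i \<in> V" "j \<in> V" "\<beta> \<in> arcs \<Delta>" "tail \<Delta> \<beta> = i" "head \<Delta> \<beta> = j" for i j \<beta>
    using gens[OF that(1,2)] that(3-5) by (simp add: gens_def)
  have X_span: "corner_span i j ((\<lambda>\<beta>. q (X i j \<beta>)) ` {\<beta> \<in> arcs \<Delta>. tail \<Delta> \<beta> = i \<and> head \<Delta> \<beta> = j}) = carrier (M i j)"
    if "i \<in> V" "j \<in> V" for i j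
    using gens[OF that] unfolding gens_def by (rule conjunct2)
  define x where "x \<beta> = X (tail \<Delta> \<beta>) (head \<Delta> \<beta>) \<beta>" for \<beta>
  interpret fin_digraph \<Delta>
    by (rule fin_digraph)
  show thesis
  proof (rule that[of x])
    show "x \<beta> \<in> corner (tail \<Delta> \<beta>) (head \<Delta> \<beta>)" if "\<beta> \<in> arcs \<Delta>" for \<beta>
      unfolding x_def using that tail_in_verts[OF that] head_in_verts[OF that]
      by (intro X) (simp_all only: V_verts)
    show "corner_span i j ((\<lambda>\<beta>. q (x \<beta>)) ` {\<beta> \<in> arcs \<Delta>. tail \<Delta> \<beta> = i \<and> head \<Delta> \<beta> = j}) = carrier (M i j)"
      if "i \<in> V" "j \<in> V" for i j
    proof -
      have "(\<lambda>\<beta>. q (x \<beta>)) ` {\<beta> \<in> arcs \<Delta>. tail \<Delta> \<beta> = i \<and> head \<Delta> \<beta> = j} =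
          (\<lambda>\<beta>. q (X i j \<beta>)) ` {\<beta> \<in> arcs \<Delta>. tail \<Delta> \<beta> = i \<and> head \<Delta> \<beta> = j}"
        by (intro image_cong) (auto simp: x_def)
      then show ?thesis
        using X_span[OF that] by simp
    qed
  qed
qed

section \<open>Generation of \<open>A\<close> by the lifted semisimple part and the arrow
  elements\<close>

context
  fixes x :: "'e \<Rightarrow> 'a" and T :: "'a set"
  assumes x_corner: "\<And>\<beta>. \<beta> \<in> arcs \<Delta> \<Longrightarrow> x \<beta> \<in> corner (tail \<Delta> \<beta>) (head \<Delta> \<beta>)"
    and x_span: "\<And>i j. i \<in> V \<Longrightarrow> j \<in> V \<Longrightarrow>
      corner_span i j ((\<lambda>\<beta>. q (x \<beta>)) ` {\<beta> \<in> arcs \<Delta>. tail \<Delta> \<beta> = i \<and> head \<Delta> \<beta> = j}) = carrier (M i j)"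
    and T_subset: "T \<subseteq> carrier A" and T_zero: "\<zero> \<in> T"
    and T_add: "\<And>y z. y \<in> T \<Longrightarrow> z \<in> T \<Longrightarrow> y \<oplus> z \<in> T"
    and T_minus: "\<And>y. y \<in> T \<Longrightarrow> \<ominus> y \<in> T"
    and T_mult: "\<And>y z. y \<in> T \<Longrightarrow> z \<in> T \<Longrightarrow> y \<otimes> z \<in> T"
    and T_\<epsilon>: "\<And>Y. Y \<in> carrier S \<Longrightarrow> \<epsilon> Y \<in> T"
    and T_x: "\<And>\<beta>. \<beta> \<in> arcs \<Delta> \<Longrightarrow> x \<beta> \<in> T"
begin

text \<open>\<open>T\<close> stands for the image of the evaluation. The classes of
  \<open>T \<inter> corner i j\<close> form a sub-bimodule, as \<open>T\<close> contains the lifts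
  that act, and it contains the generators given by the arrows. Hence it is everything.\<close>

lemma corner_approx:
  assumes ij: "i \<in> V" "j \<in> V" and y: "y \<in> corner i j"
  shows "\<exists>z \<in> T \<inter> r. y \<ominus> z \<in> r2"
proof -
  note g = corner_group[OF ij]
  have "sub_bimodule i j ((\<lambda>y. q y) ` (T \<inter> corner i j))"
  proof (rule sub_bimodule_corner[OF ij])
    show "\<epsilon> a \<otimes> x \<in> T \<inter> corner i j" if "a \<in> B i" "x \<in> T \<inter> corner i j" for a x
      using that T_mult T_\<epsilon> B_closed[OF ij(1)] corner_left[OF ij] by blast
    show "x \<otimes> \<epsilon> a \<in> T \<inter> corner i j" if "a \<in> B j" "x \<in> T \<inter> corner i j" for a x
      using that T_mult T_\<epsilon> B_closed[OF ij(2)] corner_right[OF ij] by blast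
  qed (use g T_zero T_add T_minus in auto)
  moreover have "(\<lambda>\<beta>. q (x \<beta>)) ` {\<beta> \<in> arcs \<Delta>. tail \<Delta> \<beta> = i \<and> head \<Delta> \<beta> = j} \<subseteq> (\<lambda>y. q y) ` (T \<inter> corner i j)"
    using x_corner T_x by auto
  ultimately have "carrier (M i j) \<subseteq> (\<lambda>y. q y) ` (T \<inter> corner i j)"
    unfolding x_span[OF ij, symmetric] corner_span_eq[OF ij] by (intro Inter_lower) blast
  then obtain z where z: "z \<in> T" "z \<in> corner i j" "q y = q z"
    using y unfolding M_carrier[OF ij] by blast
  then have "y \<ominus> z \<in> r2"
    using q_eq_iff[OF corner_carrier[OF ij y] corner_carrier[OF ij z(2)]] by simp
  then show ?thesis
    using z by (auto simp: corner_def)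
qed

text \<open>As the \<open>e i\<close> sum to \<open>\<one>\<close>, \<open>y\<close> is the sum of
  its corners, and each of them is approximated separately.\<close>

lemma radical_approx:
  assumes "y \<in> r"
  shows "\<exists>z \<in> T \<inter> r. y \<ominus> z \<in> r2"
proof -
  define U where "U = {y \<in> r. \<exists>z \<in> T \<inter> r. y \<ominus> z \<in> r2}"
  have Uadd: "y \<oplus> z \<in> U" if yz: "y \<in> U" "z \<in> U" for y z
  proof -
    obtain y' z' where *: "y' \<in> T" "y' \<in> r" "y \<ominus> y' \<in> r2" "z' \<in> T" "z' \<in> r" "z \<ominus> z' \<in> r2" "y \<in> r" "z \<in> r"
      using yz by (auto simp: U_def)
    have "(y \<oplus> z) \<ominus> (y' \<oplus> z') = (y \<ominus> y') \<oplus> (z \<ominus> z')"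
      using * by (simp add: a_minus_def A.minus_add A.a_ac)
    then have "(y \<oplus> z) \<ominus> (y' \<oplus> z') \<in> r2"
      using r2.a_closed[OF *(3,6)] by simp
    then show ?thesis
      using * T_add by (auto simp: U_def intro!: bexI[of _ "y' \<oplus> z'"])
  qed
  have U0: "\<zero> \<in> U" "U \<subseteq> carrier A"
    using T_zero by (auto simp: U_def a_minus_def intro!: bexI[of _ \<zero>])
  note closed = A.finsum_in_closed[OF U0(2,1) Uadd]
  have yc: "y \<in> carrier A"
    using assms by simp
  have ec: "(\<lambda>i. e i) \<in> V \<rightarrow> carrier A"
    using e_closed by auto
  have inner: "y \<otimes> e j \<in> U" if j: "j \<in> V" for j
  proof -
    have yj: "y \<otimes> e j \<in> carrier A"
      using yc e_closed[OF j] by simp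
    have "y \<otimes> e j = (\<Oplus> i \<in> V. e i) \<otimes> (y \<otimes> e j)"
      using yj by (simp add: e_sum)
    also have "\<dots> = (\<Oplus> i \<in> V. e i \<otimes> (y \<otimes> e j))"
      using yj ec by (intro A.finsum_ldistr) auto
    also have "\<dots> \<in> U"
    proof (rule closed)
      show "e i \<otimes> (y \<otimes> e j) \<in> U" if i: "i \<in> V" for i
      proof -
        have "e i \<otimes> y \<otimes> e j \<in> corner i j"
          by (rule corner_I[OF i j assms])
        then show ?thesis
          using corner_approx[OF i j] yc e_closed[OF i] e_closed[OF j]
          by (auto simp: U_def corner_def A.m_assoc)
      qed
    qed
    finally show ?thesis .
  qed
  have "y = y \<otimes> (\<Oplus> j \<in> V. e j)"
    using yc by (simp add: e_sum)
  also have "\<dots> = (\<Oplus> j \<in> V. y \<otimes> e j)"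
    using yc ec by (intro A.finsum_rdistr) auto
  also have "\<dots> \<in> U"
    by (rule closed; (assumption | rule inner))
  finally show ?thesis
    by (simp add: U_def)
qed

abbreviation "rpow n \<equiv> r [^]\<^bsub>ideals_set A\<^esub> (n::nat)"

lemma rpow_1: "rpow 1 = r"
  by (rule A.ideal_pow_1[OF A.radical_ideal])

lemma rpow_2: "rpow 2 = r2"
  using A.ideal_pow_1[OF A.radical_ideal] by (simp add: numeral_2_eq_2)

text \<open>Products of approximations are approximations: if \<open>z\<close> approximates
  \<open>y\<close> in the k-th power and \<open>t\<close> approximates \<open>w\<close> in
  \<open>r\<close>, then \<open>y \<otimes> w \<ominus> z \<otimes> t = (y \<ominus> z) \<otimes> w
  \<oplus> z \<otimes> (w \<ominus> t)\<close>. Both terms lie one power deeper than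
  \<open>y \<otimes> w\<close>.\<close>

lemma rpow_approx:
  assumes "1 \<le> k" "y \<in> rpow k"
  shows "\<exists>z \<in> T \<inter> rpow k. y \<ominus> z \<in> rpow (Suc k)"
  using assms
proof (induct k arbitrary: y rule: nat_induct_at_least)
  case base
  then show ?case
    using radical_approx[of y] rpow_2 by (simp only: rpow_1 Suc_1)
next
  case (Suc k)
  note I = A.ideal_pow_ideal[OF A.radical_ideal]
  define U where "U = {y \<in> carrier A. \<exists>z \<in> T \<inter> rpow (Suc k). y \<ominus> z \<in> rpow (Suc (Suc k))}"
  have "ideal_prod A (rpow k) r \<subseteq> U"
  proof (rule A.ideal_prod_least)
    show "y \<otimes> w \<in> U" if y: "y \<in> rpow k" and w: "w \<in> r" for y w
    proof -
      obtain z where z: "z \<in> T" "z \<in> rpow k" "y \<ominus> z \<in> rpow (Suc k)"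
        using Suc.hyps(2)[OF y] by blast
      obtain t where t: "t \<in> T" "t \<in> r" "w \<ominus> t \<in> r2"
        using radical_approx[OF w] by blast
      have c: "y \<in> carrier A" "z \<in> carrier A" "w \<in> carrier A" "t \<in> carrier A"
        using y z w t ideal.Icarr[OF I] by auto
      have "y \<otimes> w \<ominus> z \<otimes> t = (y \<ominus> z) \<otimes> w \<oplus> z \<otimes> (w \<ominus> t)"
        using c by algebra
      moreover have "(y \<ominus> z) \<otimes> w \<in> rpow (Suc (Suc k))"
        using ideal_prod.prod[OF z(3) w, of A] by simp
      moreover have "z \<otimes> (w \<ominus> t) \<in> rpow (Suc (Suc k))"
        using ideal_prod.prod[OF z(2) t(3)[folded rpow_2], of A] A.ideal_pow_add[OF A.radical_ideal, of k 2]
        by simp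
      ultimately have "y \<otimes> w \<ominus> z \<otimes> t \<in> rpow (Suc (Suc k))"
        using additive_subgroup.a_closed[OF ideal.axioms(1)[OF I]] by metis
      moreover have "z \<otimes> t \<in> rpow (Suc k)"
        using ideal_prod.prod[OF z(2) t(2), of A] by simp
      ultimately show ?thesis
        unfolding U_def using T_mult[OF z(1) t(1)] c by blast
    qed
    show "y \<oplus> w \<in> U" if yw: "y \<in> U" "w \<in> U" for y w
    proof -
      obtain z t where *: "y \<in> carrier A" "w \<in> carrier A" "z \<in> T" "t \<in> T" "z \<in> rpow (Suc k)" "t \<in> rpow (Suc k)"
        "y \<ominus> z \<in> rpow (Suc (Suc k))" "w \<ominus> t \<in> rpow (Suc (Suc k))"
        using yw unfolding U_def by blast
      have "(y \<oplus> w) \<ominus> (z \<oplus> t) = (y \<ominus> z) \<oplus> (w \<ominus> t)"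
        using *(1-4) T_subset by (simp add: a_minus_def A.minus_add A.a_ac subset_iff)
      then have "(y \<oplus> w) \<ominus> (z \<oplus> t) \<in> rpow (Suc (Suc k))"
        using additive_subgroup.a_closed[OF ideal.axioms(1)[OF I] *(7,8)] by simp
      moreover have "z \<oplus> t \<in> rpow (Suc k)"
        by (rule additive_subgroup.a_closed[OF ideal.axioms(1)[OF I] *(5,6)])
      ultimately show ?thesis
        unfolding U_def using T_add[OF *(3,4)] *(1,2) by blast
    qed
  qed
  then show ?case
    using Suc.prems by (auto simp: U_def)
qed

text \<open>Descending induction on \<open>k\<close>, with \<open>d\<close> bounding the distance to
  the vanishing power. An element is its approximation in \<open>T\<close> plus an error in the next
  power, which is in \<open>T\<close> by induction.\<close>

lemma rpow_in_T:
  assumes "rpow n = {\<zero>}" "1 \<le> k" "n \<le> k + d"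
  shows "rpow k \<subseteq> T"
  using assms(2,3)
proof (induct d arbitrary: k)
  case 0
  then have "rpow k \<subseteq> {\<zero>}"
    using A.ideal_pow_mono[OF A.radical_ideal, of n k] assms(1) by simp
  then show ?case
    using T_zero by blast
next
  case (Suc d)
  then have IH: "rpow (Suc k) \<subseteq> T"
    by (intro Suc.hyps) auto
  show ?case
  proof
    fix y assume y: "y \<in> rpow k"
    then obtain z where z: "z \<in> T" "y \<ominus> z \<in> T"
      using rpow_approx[OF Suc.prems(1) y] IH by blast
    have "y \<in> carrier A" "z \<in> carrier A"
      using y z(1) T_subset ideal.Icarr[OF A.ideal_pow_ideal[OF A.radical_ideal]] by auto
    then have "y = (y \<ominus> z) \<oplus> z"
      by algebra
    then show "y \<in> T"
      using T_add[OF z(2,1)] by simp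
  qed
qed

lemma generated_subring: "T = carrier A"
proof
  obtain n where n: "rpow n = {\<zero>}"
    using A.radical_nilpotent[OF artinian] by blast
  have rT: "r \<subseteq> T"
    using rpow_in_T[OF n, of 1 n] unfolding rpow_1 by simp
  show "carrier A \<subseteq> T"
  proof
    fix y assume y: "y \<in> carrier A"
    have c: "\<epsilon> (r +> y) \<in> carrier A" "\<epsilon> (r +> y) \<in> T"
      using \<epsilon>_closed T_\<epsilon> eta_closed[OF y] by auto
    have "y = (y \<ominus> \<epsilon> (r +> y)) \<oplus> \<epsilon> (r +> y)"
      using y c(1) by algebra
    then show "y \<in> T"
      using T_add[of "y \<ominus> \<epsilon> (r +> y)" "\<epsilon> (r +> y)"] minus_lift_in_radical[OF y] rT c(2) by auto
  qed
qed (rule T_subset)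

end

theorem lifted_presentation: "\<exists>\<rho> \<subseteq> pse_relations K \<Delta> \<A>.
    alg_isomorphic K A (PSE_rel K \<Delta> \<A> \<rho>) \<and>
    (\<exists>s::nat. s \<ge> 1 \<and>
      arrow_ideal K \<Delta> \<A> [^]\<^bsub>ideals_set (PSE K \<Delta> \<A>)\<^esub> s \<subseteq> genideal (PSE K \<Delta> \<A>) \<rho> \<and>
      genideal (PSE K \<Delta> \<A>) \<rho> \<subseteq> arrow_ideal K \<Delta> \<A>)"
proof -
  obtain x where x: "\<And>\<beta>. \<beta> \<in> arcs \<Delta> \<Longrightarrow> x \<beta> \<in> corner (tail \<Delta> \<beta>) (head \<Delta> \<beta>)"
    "\<And>i j. i \<in> V \<Longrightarrow> j \<in> V \<Longrightarrow>
      corner_span i j ((\<lambda>\<beta>. q (x \<beta>)) ` {\<beta> \<in> arcs \<Delta>. tail \<Delta> \<beta> = i \<and> head \<Delta> \<beta> = j}) = carrier (M i j)"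
    using arrow_generators by blast
  have xr: "x \<beta> \<in> r" if "\<beta> \<in> arcs \<Delta>" for \<beta>
    using x(1)[OF that] by (simp add: corner_def)
  interpret E: path_evaluation K \<Delta> \<A> A "\<lambda>_. \<epsilon>" x
    by (rule path_evaluation) (use xr in simp)
  interpret eval: ring_hom_ring "PSE K \<Delta> \<A>" A E.eval_PSE
    by (rule alg_hom_ring_hom_ring[OF E.Q.k_algebra_axioms A.k_algebra_axioms E.eval_PSE_hom])
  let ?T = "E.eval_PSE ` carrier (PSE K \<Delta> \<A>)"
  have word: "E.word_val w \<in> ?T" if "pseudo_path \<Delta> \<A> w" for w
  proof -
    have "E.eval_PSE (E.cls (E.pv w)) = E.word_val w"
      using that by (simp add: E.eval_PSE_cls E.path_vec_carrier E.eval_path_vec)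
    then show ?thesis
      using that by (metis E.cls_closed E.path_vec_carrier image_eqI)
  qed
  have T: "?T \<subseteq> carrier A" "\<zero> \<in> ?T" "\<And>y z. y \<in> ?T \<Longrightarrow> z \<in> ?T \<Longrightarrow> y \<oplus> z \<in> ?T"
    "\<And>y. y \<in> ?T \<Longrightarrow> \<ominus> y \<in> ?T" "\<And>y z. y \<in> ?T \<Longrightarrow> z \<in> ?T \<Longrightarrow> y \<otimes> z \<in> ?T"
  proof -
    show "?T \<subseteq> carrier A"
      by auto
    show "\<zero> \<in> ?T"
      using eval.hom_zero E.Q.zero_closed by (metis image_eqI)
    show "y \<oplus> z \<in> ?T" if "y \<in> ?T" "z \<in> ?T" for y z
    proof -
      from that obtain X Z where "X \<in> carrier (PSE K \<Delta> \<A>)" "Z \<in> carrier (PSE K \<Delta> \<A>)"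
        "y = E.eval_PSE X" "z = E.eval_PSE Z"
        by blast
      then show ?thesis
        by (intro image_eqI[of _ _ "X \<oplus>\<^bsub>PSE K \<Delta> \<A>\<^esub> Z"]) simp_all
    qed
    show "\<ominus> y \<in> ?T" if "y \<in> ?T" for y
    proof -
      from that obtain X where "X \<in> carrier (PSE K \<Delta> \<A>)" "y = E.eval_PSE X"
        by blast
      then show ?thesis
        by (intro image_eqI[of _ _ "\<ominus>\<^bsub>PSE K \<Delta> \<A>\<^esub> X"]) simp_all
    qed
    show "y \<otimes> z \<in> ?T" if "y \<in> ?T" "z \<in> ?T" for y z
    proof -
      from that obtain X Z where "X \<in> carrier (PSE K \<Delta> \<A>)" "Z \<in> carrier (PSE K \<Delta> \<A>)"
        "y = E.eval_PSE X" "z = E.eval_PSE Z"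
        by blast
      then show ?thesis
        by (intro image_eqI[of _ _ "X \<otimes>\<^bsub>PSE K \<Delta> \<A>\<^esub> Z"]) simp_all
    qed
  qed
  \<comment> \<open>A letter holds an element of a single component, so \<open>Y\<close> is first
    split along the identities \<open>u i\<close>.\<close>
  have T_\<epsilon>: "\<epsilon> Y \<in> ?T" if Y: "Y \<in> carrier S" for Y
  proof -
    have YB: "Y \<otimes>\<^bsub>S\<^esub> u i \<in> B i" if "i \<in> V" for i
      by (rule ideal.I_l_closed[OF B_ideal[OF that] u_in_B[OF that] Y])
    have uc: "u \<in> V \<rightarrow> carrier S" "(\<lambda>i. Y \<otimes>\<^bsub>S\<^esub> u i) \<in> V \<rightarrow> carrier S"
      using u_closed Y by auto
    have "Y = Y \<otimes>\<^bsub>S\<^esub> (\<Oplus>\<^bsub>S\<^esub> i \<in> V. u i)"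
      using Y by (simp add: u_sum)
    also have "\<dots> = (\<Oplus>\<^bsub>S\<^esub> i \<in> V. Y \<otimes>\<^bsub>S\<^esub> u i)"
      using Y uc by (intro S.finsum_rdistr) auto
    finally have "\<epsilon> Y = (\<Oplus> i \<in> V. \<epsilon> (Y \<otimes>\<^bsub>S\<^esub> u i))"
      using \<epsilon>_finsum[OF _ uc(2)] by simp
    also have "\<dots> \<in> ?T"
    proof (rule A.finsum_in_closed[OF T(1-3)])
      show "\<epsilon> (Y \<otimes>\<^bsub>S\<^esub> u i) \<in> ?T" if i: "i \<in> V" for i
      proof -
        have "pseudo_path \<Delta> \<A> [Elt i (Y \<otimes>\<^bsub>S\<^esub> u i)]"
          using i YB[OF i] by (simp add: E.pp_elt V_verts vertex_simps)
        then show ?thesis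
          using word[of "[Elt i (Y \<otimes>\<^bsub>S\<^esub> u i)]"] \<epsilon>_closed[OF B_closed[OF i YB[OF i]]] by simp
      qed
    qed
    finally show ?thesis .
  qed
  \<comment> \<open>The arrow with the vertex identities on both sides evaluates to
    \<open>x \<beta>\<close>, because \<open>x \<beta>\<close> was chosen in the corner belonging to
    the ends of \<open>\<beta>\<close>.\<close>
  have T_x: "x \<beta> \<in> ?T" if \<beta>: "\<beta> \<in> arcs \<Delta>" for \<beta>
  proof -
    have v: "tail \<Delta> \<beta> \<in> V" "head \<Delta> \<beta> \<in> V"
      using E.tail_vert[OF \<beta>] E.head_vert[OF \<beta>] by (simp_all only: V_verts)
    have "pseudo_path \<Delta> \<A> [Arr (u (tail \<Delta> \<beta>)) \<beta> (u (head \<Delta> \<beta>))]"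
      using \<beta> u_in_B[OF v(1)] u_in_B[OF v(2)] by (simp add: E.pp_arr vertex_simps)
    moreover have "E.word_val [Arr (u (tail \<Delta> \<beta>)) \<beta> (u (head \<Delta> \<beta>))] = x \<beta>"
      using x(1)[OF \<beta>] e_closed[OF v(1)] e_closed[OF v(2)] by (simp add: corner_def)
    ultimately show ?thesis
      using word by metis
  qed
  have surj: "?T = carrier A"
    by (rule generated_subring[OF x T T_\<epsilon> T_x])
  \<comment> \<open>Multiplication by \<open>u i\<close> projects \<open>A / r\<close> onto
    \<open>B i\<close>. This provides the component maps from which the section is built.\<close>
  define p where "p i y = u i \<otimes>\<^bsub>S\<^esub> (r +> y)" for i y
  obtain n where n: "r [^]\<^bsub>ideals_set A\<^esub> (n::nat) = {\<zero>}"
    using A.radical_nilpotent[OF artinian] by blast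
  \<comment> \<open>The exponent \<open>n\<close> can be 0 if \<open>A\<close> is the zero ring.
    Passing to \<open>Suc n\<close> guarantees a positive exponent.\<close>
  have n': "r [^]\<^bsub>ideals_set A\<^esub> Suc n = {\<zero>}"
    using A.ideal_pow_mono[OF A.radical_ideal, of n "Suc n"] n
      additive_subgroup.zero_closed[OF ideal.axioms(1)[OF A.ideal_pow_ideal[OF A.radical_ideal, of "Suc n"]]]
    by (auto simp del: nat_pow_Suc)
  show ?thesis
  proof (rule E.pse_presentation[OF A.radical_ideal xr _ _ _ _ _ surj n'])
    show "p i y \<in> carrier (\<A> i)" if "i \<in> verts \<Delta>" "y \<in> carrier A" for i y
      using that ideal.I_r_closed[OF B_ideal u_in_B eta_closed] by (simp add: p_def vertex_simps V_verts)
    show "p i (c \<odot> y \<oplus> z) = c \<odot>\<^bsub>\<A> i\<^esub> p i y \<oplus>\<^bsub>\<A> i\<^esub> p i z"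
      if "i \<in> verts \<Delta>" "c \<in> carrier K" "y \<in> carrier A" "z \<in> carrier A" for i c y z
    proof -
      have uS: "u i \<in> carrier S"
        using that(1) u_closed by (simp only: V_verts)
      have "r +> (c \<odot> y \<oplus> z) = c \<odot>\<^bsub>S\<^esub> (r +> y) \<oplus>\<^bsub>S\<^esub> (r +> z)"
        using that by (simp add: eta_add eta_smult)
      then show ?thesis
        using that(2) uS eta_closed[OF that(3)] eta_closed[OF that(4)]
        by (simp add: p_def vertex_simps S.r_distr S.smult_mult_right)
    qed
    show "p i (\<epsilon> a) = a" if "i \<in> verts \<Delta>" "a \<in> carrier (\<A> i)" for i a
      using that B_closed \<epsilon>_lift u_left by (simp add: p_def vertex_simps V_verts)
    show "p j (\<epsilon> a) = \<zero>\<^bsub>\<A> j\<^esub>"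
      if "i \<in> verts \<Delta>" "j \<in> verts \<Delta>" "j \<noteq> i" "a \<in> carrier (\<A> i)" for i j a
      using that B_closed[of i a] \<epsilon>_lift[of a] B_mult_zero[of j i "u j" a] u_in_B[of j]
      by (simp add: p_def vertex_simps V_verts)
    show "p i y = \<zero>\<^bsub>\<A> i\<^esub>" if "i \<in> verts \<Delta>" "y \<in> r" for i y
    proof -
      have "r +> y = \<zero>\<^bsub>S\<^esub>"
        using that(2) r.a_rcos_const by (simp add: S_zero)
      moreover have "u i \<in> carrier S"
        using that(1) u_closed by (simp only: V_verts)
      ultimately show ?thesis
        by (simp add: p_def vertex_simps)
    qed
  qed simp_all
qed

end

theorem theorem3p2:
  fixes K :: "('k, 'c) ring_scheme"
    and A :: "('k, 'a, 'd) module_scheme"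
    and m :: nat
    and B :: "nat \<Rightarrow> 'a set set"
    and \<A> :: "nat \<Rightarrow> ('k, 'a set) module"
    and \<Delta> :: "(nat, 'e) pre_digraph"
  assumes "field K" and "k_algebra K A" and "left_artinian A"
    and "liftable K A"
    and "ideal_direct_sum (semisimple_quot A) {1..m} B"
    and "\<And>i. \<A> i = ideal_alg (semisimple_quot A) (B i)"
    and "\<And>i. i \<in> {1..m} \<Longrightarrow> simple_alg K (\<A> i)"
    and "quiver_of A m B \<Delta>"
  shows "\<exists>\<rho> \<subseteq> pse_relations K \<Delta> \<A>.
    alg_isomorphic K A (PSE_rel K \<Delta> \<A> \<rho>) \<and>
    (\<exists>s::nat. s \<ge> 1 \<and>
      arrow_ideal K \<Delta> \<A> [^]\<^bsub>ideals_set (PSE K \<Delta> \<A>)\<^esub> s \<subseteq> genideal (PSE K \<Delta> \<A>) \<rho> \<and>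
      genideal (PSE K \<Delta> \<A>) \<rho> \<subseteq> arrow_ideal K \<Delta> \<A>)"
proof -
  obtain \<epsilon> where "\<epsilon> \<in> alg_hom K (semisimple_quot A) A"
    "\<And>Y. Y \<in> carrier (semisimple_quot A) \<Longrightarrow> radical A +>\<^bsub>A\<^esub> \<epsilon> Y = Y"
    using assms(4) by (auto simp: liftable_def)
  then interpret lifted_algebra K A m B \<A> \<Delta> \<epsilon>
    using assms by (intro lifted_algebra.intro lifted_algebra_axioms.intro) auto
  show ?thesis
    by (rule lifted_presentation)
qed

end
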